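(* Let $d\ge 1$ and let $c\in C_b(\mathbb{H}^d)$ be real-valued. For $\tau\ge 0$ and $\psi\in C_0(\mathbb{H}^d)$ put $$[S(\tau)\psi](z,s):=\int_{\mathbb{R}^{2d}}\psi\big(z+\sqrt{\tau}\,\zeta,\;s+\sqrt{\tau}\,z\cdot_\sigma\zeta\big)\,\mathrm{d}\mu_G(\zeta)+\tau\,c(z,s)\,\psi(z,s),\qquad (z,s)\in\mathbb{R}^{2d}\times\mathbb{R}.$$ Then $S(\tau)(C_0(\mathbb{H}^d))\subset C_0(\mathbb{H}^d)$ for all $\tau\ge 0$. Furthermore, $$\lim_{n\to\infty}\sup_{\tau\in[0,\tau_0]}\big\|S(\tau/n)^n\psi-e^{\tau L_c}\psi\big\|_{C_0(\mathbb{H}^d)}=0$$ for all $\psi\in C_0(\mathbb{H}^d)$ and all $\tau_0>0$, where $L_c=\frac{L}{2}+c$.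
   Context: The Heisenberg group is $\mathbb{H}^d=\mathbb{R}^{2d}\times\mathbb{R}$ with points $(z,s)=(x,y,s)$, $x,y\in\mathbb{R}^d$, $s\in\mathbb{R}$, and group law $(x,y,s)\cdot(x',y',s')=(x+x',y+y',s+s'+x'y-xy')$. For $z=(x,y)$ and $z'=(x',y')$ in $\mathbb{R}^{2d}$, $z\cdot_\sigma z':=x'y-xy'$ (Euclidean scalar products in $\mathbb{R}^d$). $C_0(\mathbb{H}^d)$ is the Banach space (sup norm) of continuous functions on $\mathbb{H}^d$ vanishing at infinity, $C_b(\mathbb{H}^d)$ the bounded continuous functions. $\mathrm{d}\mu_G(\zeta)=(2\pi)^{-d}e^{-|\zeta|^2/2}\,\mathrm{d}^{2d}\zeta$ is the standard Gaussian measure on $\mathbb{R}^{2d}$. Let $X_i=\partial_{x^i}+y^i\partial_s$, $Y_i=\partial_{y^i}-x^i\partial_s$, $i=1,\dots,d$, and $L_0=\sum_{i=1}^d(X_i^2+Y_i^2)$. Here $L:D(L)\subset C_0(\mathbb{H}^d)\to C_0(\mathbb{H}^d)$ is the operator such that $\frac{L}{2}$ is the generator of the Feller semigroup of horizontal Brownian motion on $\mathbb{H}^d$: the semigroup is $(V(t)f)(\xi)=\mathbb{E}[f(\xi\cdot W(t))]$, where $W(t)=(B^1(t),B^2(t),A(t))$, $B^1=(B^1_1,\dots,B^1_d)$ and $B^2=(B^2_1,\dots,B^2_d)$ are independent standard Brownian motions in $\mathbb{R}^d$ started at $0$ (giving the $x$- and $y$-components respectively), and $A(t)=\sum_{j=1}^d\int_0^t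 B_j^2(r)\,\mathrm{d}B_j^1(r)-B_j^1(r)\,\mathrm{d}B_j^2(r)$ (Itô integrals). $L$ coincides with $L_0$ on $C_c^\infty(\mathbb{H}^d)$, which is a core for $L$. $L_c=\frac{L}{2}+c$ has domain $D(L)$, where $c$ acts as a bounded multiplication operator; it generates a strongly continuous semigroup on $C_0(\mathbb{H}^d)$, denoted $e^{tL_c}$, $t\ge 0$. $S(\tau/n)^n$ is the composition of $n$ copies of $S(\tau/n)$. *)

theory Defs
  imports "HOL-Probability.Probability"
begin

section \<open>The Heisenberg group\<close>

text \<open>The dimension \<open>d\<close> is \<open>CARD('d)\<close>; points are written \<open>(z, s)\<close> with \<open>z = (x, y)\<close>.\<close>

type_synonym 'd phase = "(real^'d) \<times> (real^'d)"
type_synonym 'd heis = "'d phase \<times> real"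

definition symp :: "'d::finite phase \<Rightarrow> 'd phase \<Rightarrow> real" where
  "symp z z' = (case z of (x, y) \<Rightarrow> case z' of (x', y') \<Rightarrow> x' \<bullet> y - x \<bullet> y')"

definition heis_mult :: "'d::finite heis \<Rightarrow> 'd heis \<Rightarrow> 'd heis" where
  "heis_mult \<xi> \<xi>' = (fst \<xi> + fst \<xi>', snd \<xi> + snd \<xi>' + symp (fst \<xi>) (fst \<xi>'))"

text \<open>The space \<open>C\<^sub>0\<close>, as a (closed) subspace of the Banach space of bounded continuous functions;
  its norm is the supremum norm.\<close>

definition C0 :: "('a::real_normed_vector \<Rightarrow>\<^sub>C 'v::real_normed_vector) set" where
  "C0 = {f. (apply_bcontfun f \<longlongrightarrow> 0) at_infinity}"


section \<open>Strongly continuous semigroups and their generators\<close>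

definition strongly_continuous_semigroup ::
  "'x::real_normed_vector set \<Rightarrow> (real \<Rightarrow> 'x \<Rightarrow> 'x) \<Rightarrow> bool" where
  "strongly_continuous_semigroup X T \<longleftrightarrow>
     (\<forall>t\<ge>0. \<forall>f\<in>X. T t f \<in> X) \<and>
     (\<forall>t\<ge>0. \<forall>f\<in>X. \<forall>g\<in>X. \<forall>a b. T t (a *\<^sub>R f + b *\<^sub>R g) = a *\<^sub>R T t f + b *\<^sub>R T t g) \<and>
     (\<forall>t\<ge>0. \<exists>K. \<forall>f\<in>X. norm (T t f) \<le> K * norm f) \<and>
     (\<forall>f\<in>X. T 0 f = f) \<and>
     (\<forall>s\<ge>0. \<forall>t\<ge>0. \<forall>f\<in>X. T (s + t) f = T s (T t f)) \<and>
     (\<forall>f\<in>X. ((\<lambda>t. T t f) \<longlongrightarrow> f) (at_right 0))"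

text \<open>Unbounded operators are represented by their graphs, so that equality of operators includes
  equality of domains.\<close>

definition generator ::
  "'x::real_normed_vector set \<Rightarrow> (real \<Rightarrow> 'x \<Rightarrow> 'x) \<Rightarrow> ('x \<times> 'x) set" where
  "generator X T =
     {(f, g). f \<in> X \<and> g \<in> X \<and> ((\<lambda>t. (1 / t) *\<^sub>R (T t f - f)) \<longlongrightarrow> g) (at_right 0)}"

text \<open>A strongly continuous semigroup is determined by its generator at all times \<open>t \<ge> 0\<close> and on all
  of \<open>X\<close>; the choice operator only affects irrelevant arguments.\<close>

definition semigroup_of ::
  "'x::real_normed_vector set \<Rightarrow> ('x \<times> 'x) set \<Rightarrow> real \<Rightarrow> 'x \<Rightarrow> 'x" where
  "semigroup_of X G = (SOME T. strongly_continuous_semigroup X T \<and> generator X T = G)"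


section \<open>Brownian motion and the Ito integral\<close>

definition natural_filtration ::
  "'w measure \<Rightarrow> (real \<Rightarrow> 'w \<Rightarrow> 'a::topological_space) \<Rightarrow> real \<Rightarrow> 'w measure" where
  "natural_filtration M X t =
     sigma (space M) {X r -` U \<inter> space M | r U. 0 \<le> r \<and> r \<le> t \<and> U \<in> sets borel}"

definition standard_brownian_motion ::
  "'w measure \<Rightarrow> (real \<Rightarrow> 'w \<Rightarrow> real^'d::finite) \<Rightarrow> bool" where
  "standard_brownian_motion M B \<longleftrightarrow>
     prob_space M \<and>
     (\<forall>t\<ge>0. B t \<in> borel_measurable M) \<and>
     (AE \<omega> in M. B 0 \<omega> = 0) \<and>
     (AE \<omega> in M. continuous_on {0..} (\<lambda>t. B t \<omega>)) \<and>
     (\<forall>s t. 0 \<le> s \<and> s < t \<longrightarrow>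
        distributed M lborel (\<lambda>\<omega>. B t \<omega> - B s \<omega>)
          (\<lambda>x. \<Prod>i\<in>UNIV. ennreal (normal_density 0 (sqrt (t - s)) (x $ i))) \<and>
        prob_space.indep_set M
          (sets (natural_filtration M B s))
          {(\<lambda>\<omega>. B t \<omega> - B s \<omega>) -` U \<inter> space M | U. U \<in> sets borel})"

text \<open>A simple integrand is \<open>\<Sum>k<n. \<eta> k * indicator {p k<..p (Suc k)}\<close> with \<open>\<eta> k\<close> square integrable and
  measurable at time \<open>p k\<close>.\<close>

definition simple_integrand ::
  "'w measure \<Rightarrow> (real \<Rightarrow> 'w measure) \<Rightarrow> nat \<Rightarrow> (nat \<Rightarrow> real) \<Rightarrow> (nat \<Rightarrow> 'w \<Rightarrow> real) \<Rightarrow> bool" where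
  "simple_integrand M F n p \<eta> \<longleftrightarrow>
     0 \<le> p 0 \<and> (\<forall>k<n. p k \<le> p (Suc k)) \<and>
     (\<forall>k<n. \<eta> k \<in> borel_measurable (F (p k)) \<and> integrable M (\<lambda>\<omega>. (\<eta> k \<omega>)\<^sup>2))"

definition simple_process ::
  "nat \<Rightarrow> (nat \<Rightarrow> real) \<Rightarrow> (nat \<Rightarrow> 'w \<Rightarrow> real) \<Rightarrow> real \<Rightarrow> 'w \<Rightarrow> real" where
  "simple_process n p \<eta> r \<omega> = (\<Sum>k<n. \<eta> k \<omega> * indicator {p k<..p (Suc k)} r)"

definition simple_ito ::
  "nat \<Rightarrow> (nat \<Rightarrow> real) \<Rightarrow> (nat \<Rightarrow> 'w \<Rightarrow> real) \<Rightarrow> (real \<Rightarrow> 'w \<Rightarrow> real) \<Rightarrow> real \<Rightarrow> 'w \<Rightarrow> real" where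
  "simple_ito n p \<eta> B t \<omega> = (\<Sum>k<n. \<eta> k \<omega> * (B (min (p (Suc k)) t) \<omega> - B (min (p k) t) \<omega>))"

text \<open>\<open>I\<close> is a version of the Ito integral of \<open>H\<close> with respect to \<open>B\<close> over \<open>[0, t]\<close>, for the filtration
  \<open>F\<close>: the mean-square limit of the integrals of simple integrands approximating \<open>H\<close>.\<close>

definition is_ito_integral ::
  "'w measure \<Rightarrow> (real \<Rightarrow> 'w measure) \<Rightarrow> (real \<Rightarrow> 'w \<Rightarrow> real) \<Rightarrow> (real \<Rightarrow> 'w \<Rightarrow> real) \<Rightarrow>
    real \<Rightarrow> ('w \<Rightarrow> real) \<Rightarrow> bool" where
  "is_ito_integral M F H B t I \<longleftrightarrow>
     I \<in> borel_measurable M \<and>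
     (\<exists>n p \<eta>.
        (\<forall>m. simple_integrand M F (n m) (p m) (\<eta> m)) \<and>
        (\<lambda>m. \<integral>\<^sup>+ r \<in> {0..t}.
               (\<integral>\<^sup>+ \<omega>. ennreal ((simple_process (n m) (p m) (\<eta> m) r \<omega> - H r \<omega>)\<^sup>2) \<partial>M) \<partial>lborel)
          \<longlonglongrightarrow> 0 \<and>
        (\<lambda>m. \<integral>\<^sup>+ \<omega>. ennreal ((simple_ito (n m) (p m) (\<eta> m) B t \<omega> - I \<omega>)\<^sup>2) \<partial>M) \<longlonglongrightarrow> 0)"


section \<open>Horizontal Brownian motion and the operator \<open>L\<close>\<close>

definition horizontal_brownian_motion ::
  "'w measure \<Rightarrow> (real \<Rightarrow> 'w \<Rightarrow> real^'d::finite) \<Rightarrow> (real \<Rightarrow> 'w \<Rightarrow> real^'d) \<Rightarrow>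
    (real \<Rightarrow> 'w \<Rightarrow> real) \<Rightarrow> bool" where
  "horizontal_brownian_motion M B1 B2 A \<longleftrightarrow>
     standard_brownian_motion M B1 \<and> standard_brownian_motion M B2 \<and>
     prob_space.indep_var M
       (\<Pi>\<^sub>M t\<in>{0..}. borel) (\<lambda>\<omega>. \<lambda>t\<in>{0..}. B1 t \<omega>)
       (\<Pi>\<^sub>M t\<in>{0..}. borel) (\<lambda>\<omega>. \<lambda>t\<in>{0..}. B2 t \<omega>) \<and>
     (\<forall>t\<ge>0. A t \<in> borel_measurable M \<and>
        (let F = natural_filtration M (\<lambda>r \<omega>. (B1 r \<omega>, B2 r \<omega>)) in
         \<exists>I J. (\<forall>j. is_ito_integral M F (\<lambda>r \<omega>. B2 r \<omega> $ j) (\<lambda>r \<omega>. B1 r \<omega> $ j) t (I j)) \<and>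
               (\<forall>j. is_ito_integral M F (\<lambda>r \<omega>. B1 r \<omega> $ j) (\<lambda>r \<omega>. B2 r \<omega> $ j) t (J j)) \<and>
               (AE \<omega> in M. A t \<omega> = (\<Sum>j\<in>UNIV. I j \<omega> - J j \<omega>))))"

definition hbm_semigroup ::
  "'w measure \<Rightarrow> (real \<Rightarrow> 'w \<Rightarrow> 'd::finite heis) \<Rightarrow> real \<Rightarrow>
    ('d heis \<Rightarrow>\<^sub>C 'v::euclidean_space) \<Rightarrow> ('d heis \<Rightarrow>\<^sub>C 'v)" where
  "hbm_semigroup M W t f = Bcontfun (\<lambda>\<xi>. \<integral>\<omega>. f (heis_mult \<xi> (W t \<omega>)) \<partial>M)"

text \<open>The operator whose half is the generator of the semigroup of horizontal Brownian motion.\<close>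

definition L_op ::
  "'w measure \<Rightarrow> (real \<Rightarrow> 'w \<Rightarrow> 'd::finite heis) \<Rightarrow>
    (('d heis \<Rightarrow>\<^sub>C 'v::euclidean_space) \<times> ('d heis \<Rightarrow>\<^sub>C 'v)) set" where
  "L_op M W = {(f, 2 *\<^sub>R g) | f g. (f, g) \<in> generator C0 (hbm_semigroup M W)}"

definition L_c ::
  "'w measure \<Rightarrow> (real \<Rightarrow> 'w \<Rightarrow> 'd::finite heis) \<Rightarrow> ('d heis \<Rightarrow>\<^sub>C real) \<Rightarrow>
    (('d heis \<Rightarrow>\<^sub>C 'v::euclidean_space) \<times> ('d heis \<Rightarrow>\<^sub>C 'v)) set" where
  "L_c M W c = {(f, h). \<exists>g. (f, g) \<in> L_op M W \<and> (\<forall>\<xi>. apply_bcontfun h \<xi> = (1 / 2) *\<^sub>R g \<xi> + c \<xi> *\<^sub>R f \<xi>)}"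


section \<open>The approximating operators\<close>

definition gauss :: "'d::finite phase measure" where
  "gauss = density lborel (\<lambda>\<zeta>. ennreal (exp (- (norm \<zeta>)\<^sup>2 / 2) / (2 * pi) ^ CARD('d)))"

text \<open>The formula for \<open>S(\<tau>)\<psi>\<close> as a plain function, so that its membership in \<open>C\<^sub>0\<close> is a genuine claim.\<close>

definition S_fun ::
  "('d::finite heis \<Rightarrow>\<^sub>C real) \<Rightarrow> real \<Rightarrow> ('d heis \<Rightarrow>\<^sub>C 'v::euclidean_space) \<Rightarrow> 'd heis \<Rightarrow> 'v" where
  "S_fun c \<tau> \<psi> = (\<lambda>(z, s).
     (\<integral>\<zeta>. \<psi> (z + sqrt \<tau> *\<^sub>R \<zeta>, s + sqrt \<tau> * symp z \<zeta>) \<partial>gauss) + \<tau> *\<^sub>R c (z, s) *\<^sub>R \<psi> (z, s))"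

definition S_op ::
  "('d::finite heis \<Rightarrow>\<^sub>C real) \<Rightarrow> real \<Rightarrow> ('d heis \<Rightarrow>\<^sub>C 'v::euclidean_space) \<Rightarrow> ('d heis \<Rightarrow>\<^sub>C 'v)" where
  "S_op c \<tau> \<psi> = Bcontfun (S_fun c \<tau> \<psi>)"

end

theory Submission
  imports Defs
begin

text \<open>
  Write \<open>S0(h)\<close> for the Gaussian part of \<open>S(h)\<close>. In the Heisenberg group
  \<open>(z + sqrt h \<zeta>, s + sqrt h symp z \<zeta>)\<close> is the product of \<open>(z, s)\<close> and \<open>(sqrt h \<zeta>, 0)\<close>, so \<open>S0(h) f(\<xi>)\<close> is the
  expectation of \<open>f\<close> at \<open>\<xi>\<close> multiplied from the right by a horizontal Brownian increment, with central
  component \<open>0\<close>. Multiplying the increments over a partition of \<open>[0, t]\<close> gives the Brownian motion at time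
  \<open>t\<close> in the horizontal component and, in the central component, exactly the Riemann sum of the Ito
  integrals that define the area process (\<open>expectation_step_product\<close>). The Ito isometry bounds the mean
  square of the difference between this sum and \<open>A(t)\<close> by a constant times \<open>t\<close> times the mesh
  (\<open>ito_riemann_error\<close>, \<open>area_error\<close>). Functions in \<open>C0\<close> are uniformly continuous with respect to right
  translations, so the products of the \<open>S0\<close> converge in the supremum norm to the semigroup \<open>V\<close> of
  horizontal Brownian motion, locally uniformly in time (\<open>step_product_approximates_V\<close>). The semigroup
  law and strong continuity of \<open>V\<close> on \<open>C0\<close> are consequences of this approximation (\<open>V_scs\<close>).

  The potential \<open>c\<close> is a bounded perturbation. The solutions of the Duhamel equation
  \<open>T(t) f = V(t) f + \<integral>\<^sub>0\<^sup>t V(t - s) c T(s) f ds\<close> form a strongly continuous semigroup, its generator is that of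
  \<open>V\<close> plus \<open>c\<close> with the same domain (\<open>generator_T\<close>), and a semigroup is determined by its generator
  (\<open>semigroup_eq_if_generator_eq\<close>). Hence \<open>T\<close> is the semigroup generated by \<open>L/2 + c\<close>. The powers of
  \<open>S(h) = S0(h) + h c\<close> satisfy the discrete Duhamel formula in which \<open>V\<close> is replaced by powers of \<open>S0(h)\<close> and
  the integral by a Riemann sum. Comparing the two with a discrete Gronwall inequality transfers the
  convergence from \<open>S0\<close> and \<open>V\<close> to \<open>S\<close> and \<open>T\<close> (\<open>product_formula\<close>).
\<close>

section \<open>Strongly continuous semigroups\<close>

text \<open>Riemann sums of \<open>g\<close> are linear combinations of its values, so they stay in the subspace, and the
  integral is one of their limits.\<close>

lemma integral_in_closed_subspace:
  fixes g :: "real \<Rightarrow> 'x::banach"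
  assumes "closed X" "subspace X" "\<And>s. s \<in> {a..b} \<Longrightarrow> g s \<in> X"
  shows "integral {a..b} g \<in> X"
proof (cases "g integrable_on {a..b}")
  case False
  then show ?thesis using subspace_0[OF \<open>subspace X\<close>] by (simp add: not_integrable_integral)
next
  case True
  then have "(g has_integral integral {a..b} g) {a..b}" by blast
  then have I: "(g has_integral integral {a..b} g) (cbox a b)" by simp
  have "integral {a..b} g \<in> closure X"
    unfolding closure_approachable
  proof (intro allI impI)
    fix e :: real assume "e > 0"
    with I obtain \<gamma> where \<gamma>: "gauge \<gamma>"
      and fine: "\<And>D. D tagged_division_of cbox a b \<Longrightarrow> \<gamma> fine D \<Longrightarrow>
        norm ((\<Sum>(x,k)\<in>D. measure lborel k *\<^sub>R g x) - integral {a..b} g) < e"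
      unfolding has_integral by metis
    obtain p where p: "p tagged_division_of cbox a b" "\<gamma> fine p"
      using fine_division_exists[OF \<gamma>] by blast
    have "(\<Sum>(x,k)\<in>p. measure lborel k *\<^sub>R g x) \<in> X"
    proof (intro subspace_sum[OF \<open>subspace X\<close>])
      fix q assume "q \<in> p"
      obtain x k where q: "q = (x, k)" by force
      then have "x \<in> {a..b}"
        using p(1) \<open>q \<in> p\<close> tagged_division_ofD(2,3)[OF p(1), of x k] by auto
      then show "(case q of (x, k) \<Rightarrow> measure lborel k *\<^sub>R g x) \<in> X"
        using assms subspace_scale[OF \<open>subspace X\<close>] by (simp add: q)
    qed
    then show "\<exists>y\<in>X. dist y (integral {a..b} g) < e"
      using fine[OF p] by (auto simp: dist_norm)
  qed
  then show ?thesis using \<open>closed X\<close> by simp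
qed

lemma scs_diff:
  assumes "strongly_continuous_semigroup X T" "t \<ge> 0" "f \<in> X" "g \<in> X"
  shows "T t (f - g) = T t f - T t g"
proof -
  have "T t (1 *\<^sub>R f + (- 1) *\<^sub>R g) = 1 *\<^sub>R T t f + (- 1) *\<^sub>R T t g"
    using assms unfolding strongly_continuous_semigroup_def by blast
  then show ?thesis by simp
qed

lemma scs_scale:
  assumes "strongly_continuous_semigroup X T" "t \<ge> 0" "f \<in> X"
  shows "T t (a *\<^sub>R f) = a *\<^sub>R T t f"
proof -
  have "T t (a *\<^sub>R f + 0 *\<^sub>R f) = a *\<^sub>R T t f + 0 *\<^sub>R T t f"
    using assms unfolding strongly_continuous_semigroup_def by blast
  then show ?thesis by simp
qed

lemma scs_in:
  "strongly_continuous_semigroup X T \<Longrightarrow> t \<ge> 0 \<Longrightarrow> f \<in> X \<Longrightarrow> T t f \<in> X"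
  unfolding strongly_continuous_semigroup_def by blast

lemma scs_add:
  "strongly_continuous_semigroup X T \<Longrightarrow> s \<ge> 0 \<Longrightarrow> t \<ge> 0 \<Longrightarrow> f \<in> X \<Longrightarrow> T (s + t) f = T s (T t f)"
  unfolding strongly_continuous_semigroup_def by blast

lemma scs_0:
  "strongly_continuous_semigroup X T \<Longrightarrow> f \<in> X \<Longrightarrow> T 0 f = f"
  unfolding strongly_continuous_semigroup_def by blast

lemma scs_tendsto_0:
  "strongly_continuous_semigroup X T \<Longrightarrow> f \<in> X \<Longrightarrow> ((\<lambda>t. T t f) \<longlongrightarrow> f) (at_right 0)"
  unfolding strongly_continuous_semigroup_def by blast

lemma scs_bound:
  assumes "strongly_continuous_semigroup X T" "t \<ge> 0"
  obtains K where "K \<ge> 0" "\<And>f. f \<in> X \<Longrightarrow> norm (T t f) \<le> K * norm f"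
proof -
  have "\<forall>t\<ge>0. \<exists>K. \<forall>f\<in>X. norm (T t f) \<le> K * norm f"
    using assms(1) unfolding strongly_continuous_semigroup_def by simp
  then obtain K where K: "\<And>f. f \<in> X \<Longrightarrow> norm (T t f) \<le> K * norm f"
    using assms(2) by blast
  have "norm (T t f) \<le> max K 0 * norm f" if "f \<in> X" for f
    using K[OF that] by (rule order_trans) (simp add: mult_right_mono)
  then show ?thesis using that[of "max K 0"] by auto
qed

text \<open>The definition of a strongly continuous semigroup bounds each \<open>T t\<close> separately. A bound that is
  uniform in \<open>t\<close> comes from the Baire category theorem: each \<open>f \<in> X\<close> has a bounded orbit near \<open>0\<close>, so the
  closed sets \<open>E n\<close> cover \<open>X\<close> and one of them contains a ball, whose radius controls all \<open>T t\<close> at once by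
  linearity.\<close>

lemma scs_bounded_near_0:
  fixes X :: "'x::banach set"
  assumes X: "closed X" "subspace X" and T: "strongly_continuous_semigroup X T"
  obtains \<delta> M where "\<delta> > 0" "M \<ge> 1" "\<And>t f. 0 \<le> t \<Longrightarrow> t \<le> \<delta> \<Longrightarrow> f \<in> X \<Longrightarrow> norm (T t f) \<le> M * norm f"
proof -
  define E where "E n = {f \<in> X. \<forall>t. 0 \<le> t \<and> t \<le> 1 / real (Suc n) \<longrightarrow> norm (T t f) \<le> real n}" for n
  have E_closed: "closed (E n)" for n
  proof (subst closed_sequential_limits, intro allI impI)
    fix u f assume u: "(\<forall>k. u k \<in> E n) \<and> u \<longlonglongrightarrow> f"
    then have uX: "\<And>k. u k \<in> X" by (auto simp: E_def)
    then have f: "f \<in> X" using u X(1) by (meson closed_sequentially)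
    have "norm (T t f) \<le> real n" if t: "0 \<le> t" "t \<le> 1 / real (Suc n)" for t
    proof -
      obtain K where K: "K \<ge> 0" "\<And>f. f \<in> X \<Longrightarrow> norm (T t f) \<le> K * norm f"
        using scs_bound[OF T t(1)] by metis
      have "(\<lambda>k. u k - f) \<longlonglongrightarrow> 0" using u by (simp add: LIM_zero)
      then have "(\<lambda>k. K * norm (u k - f)) \<longlonglongrightarrow> 0"
        by (intro tendsto_mult_right_zero tendsto_norm_zero)
      moreover have "\<forall>\<^sub>F k in sequentially. norm (T t (u k) - T t f) \<le> K * norm (u k - f)"
      proof (intro always_eventually allI)
        fix k
        have "T t (u k) - T t f = T t (u k - f)" using scs_diff[OF T t(1) uX f] by simp
        then show "norm (T t (u k) - T t f) \<le> K * norm (u k - f)"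
          using K(2)[of "u k - f"] subspace_diff[OF X(2) uX f] by simp
      qed
      ultimately have "(\<lambda>k. T t (u k) - T t f) \<longlonglongrightarrow> 0"
        by (rule Lim_null_comparison[rotated])
      then have "(\<lambda>k. T t (u k)) \<longlonglongrightarrow> T t f" by (simp add: LIM_zero_iff)
      then have "(\<lambda>k. norm (T t (u k))) \<longlonglongrightarrow> norm (T t f)" by (rule tendsto_norm)
      moreover have "norm (T t (u k)) \<le> real n" for k using u t by (auto simp: E_def)
      ultimately show ?thesis by (intro LIMSEQ_le_const2) auto
    qed
    then show "f \<in> E n" using f by (auto simp: E_def)
  qed
  have E_union: "(\<Union>n. E n) = X"
  proof (intro equalityI subsetI)
    fix f assume f: "f \<in> X"
    have "\<forall>\<^sub>F t in at_right 0. dist (T t f) f < 1"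
      using scs_tendsto_0[OF T f] by (rule tendstoD) simp
    then obtain b where b: "b > 0" "\<And>t. 0 < t \<Longrightarrow> t < b \<Longrightarrow> dist (T t f) f < 1"
      unfolding eventually_at_right_field by auto
    obtain n1 where n1: "1 / b < real n1" using reals_Archimedean2 by blast
    obtain n2 where n2: "norm f + 1 \<le> real n2" using real_arch_simple by blast
    define n where "n = max n1 n2"
    have "norm (T t f) \<le> real n" if t: "0 \<le> t" "t \<le> 1 / real (Suc n)" for t
    proof (cases "t = 0")
      case True
      then show ?thesis using n2 scs_0[OF T f] by (simp add: n_def)
    next
      case False
      have "1 / b < real (Suc n)" using n1 by (simp add: n_def)
      then have "1 / real (Suc n) < b" using b(1) by (simp add: field_simps del: of_nat_Suc)
      then have "dist (T t f) f < 1" using b(2)[of t] t False by simp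
      moreover have "norm (T t f) \<le> dist (T t f) f + norm f" using norm_triangle_sub[of "T t f" f] by (simp add: dist_norm)
      ultimately show ?thesis using n2 by (simp add: n_def)
    qed
    then show "f \<in> (\<Union>n. E n)" using f by (auto simp: E_def)
  qed (auto simp: E_def)
  have "\<exists>n. (top_of_set X) interior_of (E n) \<noteq> {}"
  proof (rule ccontr)
    assume "\<not> ?thesis"
    then have "(top_of_set X) interior_of (\<Union>(range E)) = {}"
      using X(1) E_closed E_union
      by (intro Baire_category_alt)
         (auto intro!: completely_metrizable_space_closedin completely_metrizable_space_euclidean
           closed_subset)
    then show False using E_union subspace_0[OF X(2)] by (metis empty_iff interior_of_topspace topspace_euclidean_subtopology)
  qed
  then obtain n f0 where "f0 \<in> (top_of_set X) interior_of (E n)" by blast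
  then obtain U where U: "openin (top_of_set X) U" "f0 \<in> U" "U \<subseteq> E n"
    by (auto simp: interior_of_def)
  then obtain r where r: "r > 0" "ball f0 r \<inter> X \<subseteq> E n"
    unfolding openin_contains_ball by blast
  have f0: "f0 \<in> E n" "f0 \<in> X" using U by (auto simp: E_def)
  define M where "M = 2 * real n * (2 / r) + 1"
  have "norm (T t f) \<le> M * norm f" if t: "0 \<le> t" "t \<le> 1 / real (Suc n)" and f: "f \<in> X" for t f
  proof (cases "f = 0")
    case True
    then have "T t f = 0" using scs_scale[OF T t(1) f, of 0] by simp
    then show ?thesis using True by simp
  next
    case False
    define a where "a = r / (2 * norm f)"
    have a: "a > 0" using False r by (simp add: a_def)
    define g where "g = f0 + a *\<^sub>R f"
    have gX: "g \<in> X" using f0 f by (simp add: g_def subspace_add[OF X(2)] subspace_scale[OF X(2)])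
    have "dist f0 g < r" using False r by (simp add: g_def dist_norm a_def)
    then have "g \<in> E n" using r gX by auto
    then have 1: "norm (T t g) \<le> real n" "norm (T t f0) \<le> real n" using t f0 by (auto simp: E_def)
    have "a *\<^sub>R T t f = T t g - T t f0"
      using scs_diff[OF T t(1) gX f0(2)] scs_scale[OF T t(1) f, of a] by (simp add: g_def)
    then have "a * norm (T t f) = norm (T t g - T t f0)" using a by (metis abs_of_pos norm_scaleR)
    also have "\<dots> \<le> 2 * real n" using 1 norm_triangle_ineq4[of "T t g" "T t f0"] by linarith
    finally have "norm (T t f) \<le> 2 * real n / a" using a by (simp add: field_simps)
    also have "\<dots> = 2 * real n * (2 / r) * norm f" by (simp add: a_def)
    also have "\<dots> \<le> M * norm f" unfolding M_def by (intro mult_right_mono) auto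
    finally show ?thesis .
  qed
  moreover have "M \<ge> 1" using r by (simp add: M_def)
  ultimately show ?thesis using that[of "1 / real (Suc n)" M] by auto
qed

lemma scs_locally_bounded:
  fixes X :: "'x::banach set"
  assumes X: "closed X" "subspace X" and T: "strongly_continuous_semigroup X T"
  obtains M where "M \<ge> 1" "\<And>t f. 0 \<le> t \<Longrightarrow> t \<le> \<tau> \<Longrightarrow> f \<in> X \<Longrightarrow> norm (T t f) \<le> M * norm f"
proof -
  obtain \<delta> M where M: "\<delta> > 0" "M \<ge> 1"
    and b: "\<And>t f. 0 \<le> t \<Longrightarrow> t \<le> \<delta> \<Longrightarrow> f \<in> X \<Longrightarrow> norm (T t f) \<le> M * norm f"
    using scs_bounded_near_0[OF X T] by metis
  have step: "norm (T t f) \<le> M ^ Suc n * norm f" if "0 \<le> t" "t \<le> real (Suc n) * \<delta>" "f \<in> X" for n t f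
    using that
  proof (induction n arbitrary: t)
    case 0
    then show ?case using b by simp
  next
    case (Suc n)
    show ?case
    proof (cases "t \<le> \<delta>")
      case True
      then have "norm (T t f) \<le> M * norm f" using b Suc by simp
      also have "\<dots> \<le> M ^ Suc (Suc n) * norm f"
      proof (intro mult_right_mono)
        have "1 \<le> M ^ Suc n" using M(2) by (rule one_le_power)
        then have "M * 1 \<le> M * M ^ Suc n" using M(2) by (intro mult_left_mono) auto
        then show "M \<le> M ^ Suc (Suc n)" by simp
      qed simp
      finally show ?thesis .
    next
      case False
      have t: "T t f = T \<delta> (T (t - \<delta>) f)"
        using scs_add[OF T, of \<delta> "t - \<delta>" f] False M Suc.prems by simp
      have "norm (T (t - \<delta>) f) \<le> M ^ Suc n * norm f"
        using False Suc.prems by (intro Suc.IH) (auto simp: algebra_simps)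
      moreover have "T (t - \<delta>) f \<in> X" using False Suc.prems by (intro scs_in[OF T]) auto
      ultimately have "norm (T t f) \<le> M * (M ^ Suc n * norm f)"
        unfolding t using M b[of \<delta> "T (t - \<delta>) f"]
        by (smt (verit) mult_left_mono)
      then show ?thesis by (simp add: algebra_simps)
    qed
  qed
  obtain n where "\<tau> / \<delta> \<le> real n" using real_arch_simple by blast
  then have "\<tau> \<le> real (Suc n) * \<delta>" using M(1) by (simp add: field_simps)
  then have "norm (T t f) \<le> M ^ Suc n * norm f" if "0 \<le> t" "t \<le> \<tau>" "f \<in> X" for t f
    using step that by (meson order_trans)
  moreover have "1 \<le> M ^ Suc n" using M(2) by (rule one_le_power)
  ultimately show ?thesis using that by blast
qed

lemma scs_continuous_on:
  fixes X :: "'x::banach set"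
  assumes X: "closed X" "subspace X" and T: "strongly_continuous_semigroup X T" and f: "f \<in> X"
  shows "continuous_on {0..} (\<lambda>t. T t f)"
  unfolding continuous_on_iff
proof (intro ballI allI impI)
  fix t e :: real assume t: "t \<in> {0..}" and e: "e > 0"
  obtain M where M: "M \<ge> 1" "\<And>s f. 0 \<le> s \<Longrightarrow> s \<le> t + 1 \<Longrightarrow> f \<in> X \<Longrightarrow> norm (T s f) \<le> M * norm f"
    using scs_locally_bounded[OF X T, of "t + 1"] by metis
  have "\<forall>\<^sub>F s in at_right 0. dist (T s f) f < e / M"
    using scs_tendsto_0[OF T f] e M(1) by (intro tendstoD) auto
  then obtain b where b: "b > 0" "\<And>s. 0 < s \<Longrightarrow> s < b \<Longrightarrow> dist (T s f) f < e / M"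
    unfolding eventually_at_right_field by auto
  have key: "dist (T (s + h) f) (T s f) < e" if "0 \<le> s" "s \<le> t + 1" "0 < h" "h < b" for s h
  proof -
    have "T (s + h) f - T s f = T s (T h f - f)"
      using that f T by (simp add: scs_add scs_diff scs_in)
    then have "norm (T (s + h) f - T s f) \<le> M * norm (T h f - f)"
      using that f T X M(2)[of s "T h f - f"] by (simp add: subspace_diff scs_in)
    also have "\<dots> < M * (e / M)" using b(2)[of h] that M(1) by (intro mult_strict_left_mono) (auto simp: dist_norm)
    finally show ?thesis using M(1) by (simp add: dist_norm)
  qed
  show "\<exists>d>0. \<forall>s\<in>{0..}. dist s t < d \<longrightarrow> dist (T s f) (T t f) < e"
  proof (intro exI[of _ "min b 1"] conjI ballI impI)
    fix s assume s: "s \<in> {0..}" "dist s t < min b 1"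
    consider "s = t" | "s < t" | "t < s" by linarith
    then show "dist (T s f) (T t f) < e"
    proof cases
      case 2
      then show ?thesis using key[of s "t - s"] s t by (simp add: dist_commute dist_real_def)
    next
      case 3
      then show ?thesis using key[of t "s - t"] s t by (simp add: dist_commute dist_real_def)
    qed (use e in simp)
  qed (use b in simp)
qed

text \<open>Generators only provide one-sided derivatives. For every \<open>e > 0\<close> the set of times up to which
  the growth of \<open>\<phi>\<close> is at most \<open>e\<close> times the elapsed time is closed by continuity, and the right
  derivative lets it extend beyond each of its points before \<open>b\<close>.\<close>

lemma zero_right_derivative_imp_constant:
  fixes \<phi> :: "real \<Rightarrow> 'x::real_normed_vector"
  assumes ab: "a \<le> b" and cont: "continuous_on {a..b} \<phi>"
    and der: "\<And>s. a \<le> s \<Longrightarrow> s < b \<Longrightarrow> ((\<lambda>h. (1 / h) *\<^sub>R (\<phi> (s + h) - \<phi> s)) \<longlongrightarrow> 0) (at_right 0)"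
  shows "\<phi> b = \<phi> a"
proof -
  have "norm (\<phi> b - \<phi> a) \<le> e * (b - a)" if e: "e > 0" for e
  proof -
    define S where "S = {s \<in> {a..b}. \<forall>r\<in>{a..s}. norm (\<phi> r - \<phi> a) \<le> e * (r - a)}"
    have aS: "a \<in> S" using ab by (auto simp: S_def)
    have bdd: "bdd_above S" by (rule bdd_aboveI[of _ b]) (auto simp: S_def)
    define m where "m = Sup S"
    have am: "a \<le> m" unfolding m_def using aS bdd by (rule cSup_upper)
    have mb: "m \<le> b" unfolding m_def using aS by (intro cSup_least) (auto simp: S_def)
    have below: "norm (\<phi> r - \<phi> a) \<le> e * (r - a)" if r: "a \<le> r" "r < m" for r
    proof -
      obtain s where "s \<in> S" "r < s" using r aS unfolding m_def by (metis empty_iff less_cSup_iff bdd)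
      then show ?thesis using r by (auto simp: S_def)
    qed
    have at_m: "norm (\<phi> m - \<phi> a) \<le> e * (m - a)"
    proof (cases "m = a")
      case False
      have "continuous_on {a..m} (\<lambda>r. norm (\<phi> r - \<phi> a) - e * (r - a))"
        using mb by (intro continuous_intros continuous_on_subset[OF cont]) auto
      then have "((\<lambda>r. norm (\<phi> r - \<phi> a) - e * (r - a)) \<longlongrightarrow> norm (\<phi> m - \<phi> a) - e * (m - a)) (at m within {a..m})"
        using am by (simp add: continuous_on_def)
      then have lim: "((\<lambda>r. norm (\<phi> r - \<phi> a) - e * (r - a)) \<longlongrightarrow> norm (\<phi> m - \<phi> a) - e * (m - a)) (at_left m)"
        using am False by (simp add: at_within_Icc_at_left)
      have "\<forall>\<^sub>F r in at_left m. r \<in> {a<..<m}"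
        using am False by (intro eventually_at_left_real) auto
      then have "\<forall>\<^sub>F r in at_left m. norm (\<phi> r - \<phi> a) - e * (r - a) \<le> 0"
        by eventually_elim (use below in auto)
      then have "norm (\<phi> m - \<phi> a) - e * (m - a) \<le> 0"
        using lim by (intro tendsto_upperbound[OF lim]) auto
      then show ?thesis by simp
    qed simp
    have "m = b"
    proof (rule ccontr)
      assume "m \<noteq> b"
      then have m: "m < b" using mb by simp
      have "\<forall>\<^sub>F h in at_right 0. dist ((1 / h) *\<^sub>R (\<phi> (m + h) - \<phi> m)) 0 < e"
        using der[OF am m] e by (rule tendstoD)
      then obtain d where d: "d > 0" "\<And>h. 0 < h \<Longrightarrow> h < d \<Longrightarrow> norm ((1 / h) *\<^sub>R (\<phi> (m + h) - \<phi> m)) < e"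
        unfolding eventually_at_right_field by auto
      define s where "s = m + min d (b - m) / 2"
      have s: "m < s" "s \<le> b" "s < m + d" using d m by (auto simp: s_def min_def field_simps)
      have "norm (\<phi> r - \<phi> a) \<le> e * (r - a)" if r: "r \<in> {a..s}" for r
      proof (cases "r \<le> m")
        case True
        then show ?thesis using below[of r] at_m r by (cases "r = m") auto
      next
        case False
        define h where "h = r - m"
        have h: "0 < h" "h < d" "r = m + h" using False r s by (auto simp: h_def)
        have "norm (\<phi> (m + h) - \<phi> m) / h < e"
          using d(2)[OF h(1,2)] h(1) by simp
        then have "norm (\<phi> r - \<phi> m) \<le> e * h" using h by (simp add: field_simps)
        moreover have "norm (\<phi> r - \<phi> a) \<le> norm (\<phi> r - \<phi> m) + norm (\<phi> m - \<phi> a)"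
          by (metis norm_triangle_ineq diff_add_cancel add_diff_eq)
        ultimately show ?thesis using at_m h by (simp add: algebra_simps)
      qed
      then have "s \<in> S" using s am by (auto simp: S_def)
      then have "s \<le> m" unfolding m_def using bdd by (rule cSup_upper)
      then show False using s by simp
    qed
    then show ?thesis using at_m by simp
  qed
  then have 1: "norm (\<phi> b - \<phi> a) \<le> e * (b - a)" if "e > 0" for e using that by blast
  have "norm (\<phi> b - \<phi> a) \<le> 0"
  proof (rule field_le_epsilon)
    fix e :: real assume "e > 0"
    have "norm (\<phi> b - \<phi> a) \<le> e / (b - a + 1) * (b - a)" using 1[of "e / (b - a + 1)"] \<open>e > 0\<close> ab by simp
    also have "\<dots> \<le> e" using ab \<open>e > 0\<close> by (simp add: field_simps)
    finally show "norm (\<phi> b - \<phi> a) \<le> 0 + e" by simp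
  qed
  then show ?thesis by simp
qed

text \<open>The generator commutes with the semigroup, since \<open>T s\<close> is bounded and commutes with the difference
  quotients.\<close>

lemma generator_orbit:
  fixes X :: "'x::banach set"
  assumes X: "closed X" "subspace X" and T: "strongly_continuous_semigroup X T"
    and fg: "(f, g) \<in> generator X T" and s: "s \<ge> 0"
  shows "(T s f, T s g) \<in> generator X T"
    and "((\<lambda>h. (1 / h) *\<^sub>R (T (s + h) f - T s f)) \<longlongrightarrow> T s g) (at_right 0)"
proof -
  have f: "f \<in> X" and g: "g \<in> X" and lim: "((\<lambda>t. (1 / t) *\<^sub>R (T t f - f)) \<longlongrightarrow> g) (at_right 0)"
    using fg by (auto simp: generator_def)
  obtain K where K: "K \<ge> 0" "\<And>f. f \<in> X \<Longrightarrow> norm (T s f) \<le> K * norm f"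
    using scs_bound[OF T s] by metis
  have eq: "(1 / h) *\<^sub>R (T (s + h) f - T s f) - T s g = T s ((1 / h) *\<^sub>R (T h f - f) - g)" if "h > 0" for h
    using that f g s T X by (simp add: scs_add scs_diff scs_in scs_scale subspace_diff subspace_scale)
  have "((\<lambda>h. K * norm ((1 / h) *\<^sub>R (T h f - f) - g)) \<longlongrightarrow> 0) (at_right 0)"
    using LIM_zero[OF lim] by (intro tendsto_mult_right_zero tendsto_norm_zero)
  moreover have "\<forall>\<^sub>F h in at_right 0. norm ((1 / h) *\<^sub>R (T (s + h) f - T s f) - T s g)
      \<le> K * norm ((1 / h) *\<^sub>R (T h f - f) - g)"
    using eventually_at_right_less[of 0]
  proof eventually_elim
    case (elim h)
    have "(1 / h) *\<^sub>R (T h f - f) - g \<in> X"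
      using elim f g T X by (simp add: scs_in subspace_diff subspace_scale)
    then show ?case unfolding eq[OF elim] by (rule K)
  qed
  ultimately have "((\<lambda>h. (1 / h) *\<^sub>R (T (s + h) f - T s f) - T s g) \<longlongrightarrow> 0) (at_right 0)"
    by (rule Lim_null_comparison[rotated])
  then show lim2: "((\<lambda>h. (1 / h) *\<^sub>R (T (s + h) f - T s f)) \<longlongrightarrow> T s g) (at_right 0)"
    by (simp add: LIM_zero_iff)
  have "((\<lambda>h. (1 / h) *\<^sub>R (T h (T s f) - T s f)) \<longlongrightarrow> T s g) (at_right 0)"
  proof (rule Lim_transform_eventually[OF lim2])
    show "\<forall>\<^sub>F h in at_right 0. (1 / h) *\<^sub>R (T (s + h) f - T s f) = (1 / h) *\<^sub>R (T h (T s f) - T s f)"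
      using eventually_at_right_less[of 0]
      by eventually_elim (use scs_add[OF T _ s f] in \<open>simp add: add.commute\<close>)
  qed
  then show "(T s f, T s g) \<in> generator X T"
    using f g s T by (simp add: generator_def scs_in)
qed

text \<open>For \<open>f\<close> in the common domain the path \<open>s \<mapsto> T (t - s) (T' s f)\<close> joins \<open>T t f\<close> to \<open>T' t f\<close>; its right
  derivative vanishes because both semigroups have the same generator at \<open>T' s f\<close>. Density of the
  domain and the local bounds extend the equality to \<open>X\<close>.\<close>

lemma semigroup_eq_if_generator_eq:
  fixes X :: "'x::banach set"
  assumes X: "closed X" "subspace X"
    and T: "strongly_continuous_semigroup X T" and T': "strongly_continuous_semigroup X T'"
    and gen: "generator X T' = generator X T"
    and dense: "\<And>f e. f \<in> X \<Longrightarrow> e > 0 \<Longrightarrow> \<exists>(f', g')\<in>generator X T. dist f' f < e"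
    and t: "t \<ge> 0" and f: "f \<in> X"
  shows "T' t f = T t f"
proof -
  obtain M where M: "M \<ge> 1" "\<And>s f. 0 \<le> s \<Longrightarrow> s \<le> t \<Longrightarrow> f \<in> X \<Longrightarrow> norm (T s f) \<le> M * norm f"
    using scs_locally_bounded[OF X T] by metis
  obtain M' where M': "M' \<ge> 1" "\<And>s f. 0 \<le> s \<Longrightarrow> s \<le> t \<Longrightarrow> f \<in> X \<Longrightarrow> norm (T' s f) \<le> M' * norm f"
    using scs_locally_bounded[OF X T'] by metis
  have on_dom: "T' t f = T t f" if fg: "(f, g) \<in> generator X T" for f g
  proof -
    have f: "f \<in> X" using fg by (simp add: generator_def)
    define \<phi> where "\<phi> s = T (t - s) (T' s f)" for s
    have "\<phi> t = \<phi> 0"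
    proof (rule zero_right_derivative_imp_constant[OF t])
      show "continuous_on {0..t} \<phi>"
        unfolding continuous_on_def
      proof
        fix s assume s: "s \<in> {0..t}"
        have c1: "((\<lambda>r. T (t - r) (T' s f)) \<longlongrightarrow> T (t - s) (T' s f)) (at s within {0..t})"
        proof -
          have "continuous_on {0..t} (\<lambda>r. T (t - r) (T' s f))"
            using s f T' by (intro continuous_on_compose2[OF scs_continuous_on[OF X T]] continuous_intros)
               (auto simp: scs_in)
          then show ?thesis using s by (simp add: continuous_on_def)
        qed
        have "((\<lambda>r. T (t - r) (T' r f) - T (t - r) (T' s f)) \<longlongrightarrow> 0) (at s within {0..t})"
        proof (rule Lim_null_comparison)
          show "((\<lambda>r. M * norm (T' r f - T' s f)) \<longlongrightarrow> 0) (at s within {0..t})"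
          proof (intro tendsto_mult_right_zero tendsto_norm_zero LIM_zero)
            have "continuous_on {0..t} (\<lambda>r. T' r f)"
              by (rule continuous_on_subset[OF scs_continuous_on[OF X T' f]]) auto
            then show "((\<lambda>r. T' r f) \<longlongrightarrow> T' s f) (at s within {0..t})"
              using s by (simp add: continuous_on_def)
          qed
          show "\<forall>\<^sub>F r in at s within {0..t}. norm (T (t - r) (T' r f) - T (t - r) (T' s f)) \<le> M * norm (T' r f - T' s f)"
            unfolding eventually_at_filter
          proof (intro always_eventually allI impI)
            fix r assume r: "r \<noteq> s" "r \<in> {0..t}"
            have "T (t - r) (T' r f) - T (t - r) (T' s f) = T (t - r) (T' r f - T' s f)"
              using r s f T T' by (simp add: scs_diff scs_in)
            then show "norm (T (t - r) (T' r f) - T (t - r) (T' s f)) \<le> M * norm (T' r f - T' s f)"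
              using M(2)[of "t - r" "T' r f - T' s f"] r s f T' X by (simp add: subspace_diff scs_in)
          qed
        qed
        from tendsto_add[OF this c1] show "(\<phi> \<longlongrightarrow> \<phi> s) (at s within {0..t})"
          by (simp add: \<phi>_def[abs_def])
      qed
    next
      fix s assume s: "0 \<le> s" "s < t"
      have u: "(T' s f, T' s g) \<in> generator X T"
        using generator_orbit(1)[OF X T', of f g s] fg gen s by simp
      have uX: "T' s f \<in> X" using f T' s by (simp add: scs_in)
      have l1: "((\<lambda>h. (1 / h) *\<^sub>R (T' (s + h) f - T' s f)) \<longlongrightarrow> T' s g) (at_right 0)"
        using generator_orbit(2)[OF X T', of f g s] fg gen s by simp
      have l2: "((\<lambda>h. (1 / h) *\<^sub>R (T h (T' s f) - T' s f)) \<longlongrightarrow> T' s g) (at_right 0)"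
        using u by (simp add: generator_def)
      have l3: "((\<lambda>h. M * norm ((1 / h) *\<^sub>R (T' (s + h) f - T' s f) - (1 / h) *\<^sub>R (T h (T' s f) - T' s f))) \<longlongrightarrow> 0) (at_right 0)"
        using tendsto_diff[OF l1 l2] by (intro tendsto_mult_right_zero tendsto_norm_zero) simp
      show "((\<lambda>h. (1 / h) *\<^sub>R (\<phi> (s + h) - \<phi> s)) \<longlongrightarrow> 0) (at_right 0)"
      proof (rule Lim_null_comparison[OF _ l3])
        have "\<forall>\<^sub>F h in at_right 0. h \<in> {0<..<t - s}" using s by (intro eventually_at_right_real) simp
        then show "\<forall>\<^sub>F h in at_right 0. norm ((1 / h) *\<^sub>R (\<phi> (s + h) - \<phi> s)) \<le>
          M * norm ((1 / h) *\<^sub>R (T' (s + h) f - T' s f) - (1 / h) *\<^sub>R (T h (T' s f) - T' s f))"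
        proof eventually_elim
          case (elim h)
          have "\<phi> s = T (t - s - h) (T h (T' s f))"
            unfolding \<phi>_def using scs_add[OF T, of "t - s - h" h "T' s f"] uX elim s by simp
          moreover have "\<phi> (s + h) = T (t - s - h) (T' (s + h) f)" by (simp add: \<phi>_def algebra_simps)
          moreover have hX: "T h (T' s f) \<in> X" "T' (s + h) f \<in> X" using elim s f uX T T' by (auto simp: scs_in)
          ultimately have "(1 / h) *\<^sub>R (\<phi> (s + h) - \<phi> s) = T (t - s - h) ((1 / h) *\<^sub>R (T' (s + h) f - T h (T' s f)))"
            using elim s T X by (simp add: scs_diff scs_scale subspace_diff)
          also have "norm \<dots> \<le> M * norm ((1 / h) *\<^sub>R (T' (s + h) f - T h (T' s f)))"
            using elim s hX X by (intro M) (auto simp: subspace_diff subspace_scale)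
          also have "(1 / h) *\<^sub>R (T' (s + h) f - T h (T' s f)) =
             (1 / h) *\<^sub>R (T' (s + h) f - T' s f) - (1 / h) *\<^sub>R (T h (T' s f) - T' s f)"
            by (simp add: algebra_simps)
          finally show ?case .
        qed
      qed
    qed
    then show ?thesis using f t T T' by (simp add: \<phi>_def scs_0 scs_in)
  qed
  have "norm (T' t f - T t f) \<le> 0"
  proof (rule field_le_epsilon)
    fix e :: real assume e: "e > 0"
    obtain f' g' where f': "(f', g') \<in> generator X T" "dist f' f < e / (M + M')"
      using dense[OF f, of "e / (M + M')"] e M(1) M'(1) by auto
    have f'X: "f' \<in> X" using f' by (simp add: generator_def)
    have "T' t f - T t f = T' t (f - f') - T t (f - f')"
      using on_dom[OF f'(1)] t f f'X T T' by (simp add: scs_diff)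
    also have "norm \<dots> \<le> M' * norm (f - f') + M * norm (f - f')"
      using M(2)[of t "f - f'"] M'(2)[of t "f - f'"] t f f'X X
      by (intro order_trans[OF norm_triangle_ineq4] add_mono) (auto simp: subspace_diff)
    also have "\<dots> = (M + M') * norm (f - f')" by (simp add: algebra_simps)
    also have "\<dots> \<le> (M + M') * (e / (M + M'))"
      using f'(2) M(1) M'(1) by (intro mult_left_mono) (auto simp: dist_norm norm_minus_commute)
    also have "\<dots> = e" using M(1) M'(1) by simp
    finally show "norm (T' t f - T t f) \<le> 0 + e" by simp
  qed
  then show ?thesis by simp
qed

section \<open>Bounded perturbations and the product formula\<close>

text \<open>The integrand may depend on the length of the interval, which covers averages of orbits as well
  as convolution integrals.\<close>

lemma average_tendsto:
  fixes F :: "real \<Rightarrow> real \<Rightarrow> 'x::banach"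
  assumes int: "\<And>h. h > 0 \<Longrightarrow> F h integrable_on {0..h}"
    and close: "\<And>e. e > 0 \<Longrightarrow> \<exists>d>0. \<forall>h s. 0 \<le> s \<and> s \<le> h \<and> h < d \<longrightarrow> norm (F h s - l) \<le> e"
  shows "((\<lambda>h. (1 / h) *\<^sub>R integral {0..h} (F h)) \<longlongrightarrow> l) (at_right 0)"
proof (rule tendstoI)
  fix e :: real assume e: "e > 0"
  obtain d where d: "d > 0" "\<And>h s. 0 \<le> s \<Longrightarrow> s \<le> h \<Longrightarrow> h < d \<Longrightarrow> norm (F h s - l) \<le> e / 2"
    using close[of "e / 2"] e by auto
  have "\<forall>\<^sub>F h in at_right 0. h \<in> {0<..<d}" using d(1) by (intro eventually_at_right_real)
  then show "\<forall>\<^sub>F h in at_right 0. dist ((1 / h) *\<^sub>R integral {0..h} (F h)) l < e"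
  proof eventually_elim
    case (elim h)
    then have h: "h > 0" "h < d" by auto
    have "((\<lambda>s. F h s - l) has_integral integral {0..h} (F h) - h *\<^sub>R l) {0..h}"
      using h int[OF h(1)] has_integral_const_real[of l 0 h] by (intro has_integral_diff) auto
    then have "norm (integral {0..h} (F h) - h *\<^sub>R l) \<le> e / 2 * measure lborel {0..h}"
      using e h d(2) by (intro has_integral_bound_real[where B = "e / 2"]) auto
    then have "norm (integral {0..h} (F h) - h *\<^sub>R l) \<le> e / 2 * h" using h by simp
    moreover have "norm ((1 / h) *\<^sub>R integral {0..h} (F h) - l) = norm (integral {0..h} (F h) - h *\<^sub>R l) / h"
    proof -
      have "(1 / h) *\<^sub>R integral {0..h} (F h) - l = (1 / h) *\<^sub>R (integral {0..h} (F h) - h *\<^sub>R l)"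
        using h by (simp add: scaleR_diff_right)
      then show ?thesis using h by simp
    qed
    ultimately have "norm ((1 / h) *\<^sub>R integral {0..h} (F h) - l) \<le> e / 2"
      using h by (simp only: pos_divide_le_eq)
    then show ?case using e by (simp add: dist_norm)
  qed
qed

lemma integral_split_grid:
  fixes F :: "real \<Rightarrow> 'x::banach"
  assumes "F integrable_on {0..real m * h}" "h \<ge> 0"
  shows "integral {0..real m * h} F = (\<Sum>j<m. integral {real j * h..real j * h + h} F)"
  using assms(1)
proof (induction m)
  case (Suc m)
  have le: "real m * h \<le> real (Suc m) * h" using assms(2) by (intro mult_right_mono) auto
  have "F integrable_on {0..real m * h}"
    by (rule integrable_subinterval_real[OF Suc.prems]) (use le in auto)
  then have "integral {0..real m * h} F = (\<Sum>j<m. integral {real j * h..real j * h + h} F)"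
    by (rule Suc.IH)
  moreover have "integral {0..real m * h} F + integral {real m * h..real (Suc m) * h} F = integral {0..real (Suc m) * h} F"
    using assms(2) le by (intro Henstock_Kurzweil_Integration.integral_combine Suc.prems) auto
  moreover have "real (Suc m) * h = real m * h + h" by (simp add: algebra_simps)
  ultimately show ?case by simp
qed simp

text \<open>Operators that are uniformly Lipschitz and tend to \<open>0\<close> pointwise do so uniformly on compact sets:
  it is enough to control them on a finite net.\<close>

lemma uniformly_small_on_compact:
  fixes P :: "'i \<Rightarrow> 'x::real_normed_vector \<Rightarrow> 'x"
  assumes K: "compact K" "K \<subseteq> X"
    and lip: "\<And>i d f g. i \<in> I d \<Longrightarrow> norm (P i f - P i g) \<le> 2 * norm (f - g)"
    and mono: "\<And>d d'. d \<le> d' \<Longrightarrow> I d \<subseteq> I d'"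
    and small: "\<And>f e. f \<in> X \<Longrightarrow> e > 0 \<Longrightarrow> \<exists>d>(0::real). \<forall>i\<in>I d. norm (P i f) \<le> e"
    and e: "e > 0"
  obtains d where "d > 0" "\<And>f i. f \<in> K \<Longrightarrow> i \<in> I d \<Longrightarrow> norm (P i f) \<le> e"
proof -
  have "K \<subseteq> (\<Union>c\<in>K. ball c (e / 4))" using e by auto
  then obtain D where D: "D \<subseteq> K" "finite D" "K \<subseteq> (\<Union>c\<in>D. ball c (e / 4))"
    using compactE_image[OF K(1), of K "\<lambda>c. ball c (e / 4)"] by blast
  have "\<forall>c\<in>D. \<exists>d>0. \<forall>i\<in>I d. norm (P i c) \<le> e / 2"
    using small[of _ "e / 2"] D(1) K(2) e by auto
  then obtain \<delta> where \<delta>: "\<And>c. c \<in> D \<Longrightarrow> \<delta> c > (0::real)" "\<And>c i. c \<in> D \<Longrightarrow> i \<in> I (\<delta> c) \<Longrightarrow> norm (P i c) \<le> e / 2"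
    by metis
  define d where "d = Min (insert 1 (\<delta> ` D))"
  have "d > 0" unfolding d_def using D(2) \<delta>(1) by (subst Min_gr_iff) auto
  moreover have "norm (P i f) \<le> e" if f: "f \<in> K" and i: "i \<in> I d" for f i
  proof -
    obtain c where c: "c \<in> D" "dist c f < e / 4" using D(3) f by auto
    have "d \<le> \<delta> c" unfolding d_def using D(2) c(1) by (intro Min_le) auto
    then have "norm (P i c) \<le> e / 2" using \<delta>(2)[OF c(1)] mono i by blast
    moreover have "norm (P i f - P i c) \<le> 2 * norm (f - c)" using lip[OF i] .
    moreover have "norm (f - c) < e / 4" using c(2) by (simp add: dist_norm norm_minus_commute)
    moreover have "norm (P i f) \<le> norm (P i f - P i c) + norm (P i c)" by (metis diff_add_cancel norm_triangle_ineq)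
    ultimately show ?thesis by simp
  qed
  ultimately show ?thesis using that by blast
qed

lemma discrete_gronwall:
  fixes a :: "nat \<Rightarrow> real"
  assumes "\<And>j. j \<le> m \<Longrightarrow> a j \<le> E + x * (\<Sum>i<j. a i)" "x \<ge> 0" "E \<ge> 0"
  shows "a m \<le> E * exp (x * real m)"
proof -
  have "E + x * (\<Sum>i<j. a i) \<le> E * (1 + x) ^ j" if "j \<le> m" for j
    using that
  proof (induction j)
    case (Suc j)
    have "x * a j \<le> x * (E + x * (\<Sum>i<j. a i))" using assms Suc.prems by (intro mult_left_mono) auto
    then have "E + x * (\<Sum>i<Suc j. a i) \<le> (1 + x) * (E + x * (\<Sum>i<j. a i))" by (simp add: algebra_simps)
    also have "\<dots> \<le> (1 + x) * (E * (1 + x) ^ j)" using Suc assms(2) by (intro mult_left_mono) auto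
    finally show ?case by (simp add: algebra_simps)
  qed simp
  from this[of m] have "a m \<le> E * (1 + x) ^ m" using assms(1)[of m] by simp
  also have "\<dots> \<le> E * exp x ^ m"
    using assms(2,3) by (intro mult_left_mono power_mono) auto
  also have "\<dots> = E * exp (x * real m)" by (simp add: exp_of_nat_mult[symmetric] mult.commute)
  finally show ?thesis .
qed

text \<open>The step length \<open>h\<close> and the number \<open>m\<close> of steps vary independently subject to \<open>m * h \<le> \<tau>\<close>: the
  products that occur in a discrete Duhamel formula are shorter than the full one.\<close>

definition approximates ::
  "real \<Rightarrow> (real \<Rightarrow> 'x::real_normed_vector \<Rightarrow> 'x) \<Rightarrow> (real \<Rightarrow> 'x \<Rightarrow> 'x) \<Rightarrow> 'x \<Rightarrow> bool" where
  "approximates \<tau> S T f \<longleftrightarrow> (\<forall>e>0. \<exists>d>0. \<forall>h m. 0 \<le> h \<and> h < d \<and> real m * h \<le> \<tau> \<longrightarrow>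
     norm ((S h ^^ m) f - T (real m * h) f) \<le> e)"

lemma approximatesE:
  assumes "approximates \<tau> S T f" "e > 0"
  obtains d where "d > 0"
    "\<And>h m. 0 \<le> h \<Longrightarrow> h < d \<Longrightarrow> real m * h \<le> \<tau> \<Longrightarrow> norm ((S h ^^ m) f - T (real m * h) f) \<le> e"
  using assms unfolding approximates_def by meson

text \<open>\<open>V\<close> is strongly continuous on \<open>X\<close> only, but \<open>V t\<close> and \<open>C\<close> are bounded linear maps of the whole Banach
  space. This lets them be moved through gauge integrals, which take values in the whole space.\<close>

locale bounded_perturbation =
  fixes X :: "'x::banach set" and V :: "real \<Rightarrow> 'x \<Rightarrow> 'x" and C :: "'x \<Rightarrow> 'x" and K :: real
  assumes closed_X: "closed X" and subspace_X: "subspace X"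
    and V_lin: "\<And>t. t \<ge> 0 \<Longrightarrow> bounded_linear (V t)"
    and V_contr: "\<And>t f. t \<ge> 0 \<Longrightarrow> norm (V t f) \<le> norm f"
    and V_scs: "strongly_continuous_semigroup X V"
    and C_lin: "bounded_linear C"
    and C_in: "\<And>f. f \<in> X \<Longrightarrow> C f \<in> X"
    and C_bound: "\<And>f. norm (C f) \<le> K * norm f"
    and K_nonneg: "K \<ge> 0"
begin

lemmas V_in = scs_in[OF V_scs] and V_add = scs_add[OF V_scs] and V_0 = scs_0[OF V_scs]
lemmas C_diff = linear_diff[OF bounded_linear.linear[OF C_lin]]
lemmas X_diff = subspace_diff[OF subspace_X] and X_add = subspace_add[OF subspace_X]
  and X_scale = subspace_scale[OF subspace_X]

lemma V_diff: "t \<ge> 0 \<Longrightarrow> V t (f - g) = V t f - V t g"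
  using V_lin by (simp add: bounded_linear.linear linear_diff)

lemma V_continuous:
  assumes a: "continuous_on S a" "\<And>s. s \<in> S \<Longrightarrow> a s \<ge> 0"
    and g: "continuous_on S g" "\<And>s. s \<in> S \<Longrightarrow> g s \<in> X"
  shows "continuous_on S (\<lambda>s. V (a s) (g s))"
  unfolding continuous_on_def
proof
  fix s assume s: "s \<in> S"
  have "continuous_on S (\<lambda>r. V (a r) (g s))"
    by (rule continuous_on_compose2[OF scs_continuous_on[OF closed_X subspace_X V_scs g(2)[OF s]] a(1)])
       (use a(2) in auto)
  then have 1: "((\<lambda>r. V (a r) (g s)) \<longlongrightarrow> V (a s) (g s)) (at s within S)"
    using s by (simp add: continuous_on_def)
  have "((\<lambda>r. g r - g s) \<longlongrightarrow> 0) (at s within S)"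
    using g(1) s by (simp add: continuous_on_def LIM_zero)
  then have "((\<lambda>r. V (a r) (g r) - V (a r) (g s)) \<longlongrightarrow> 0) (at s within S)"
  proof (rule Lim_null_comparison[rotated, OF tendsto_norm_zero])
    show "\<forall>\<^sub>F r in at s within S. norm (V (a r) (g r) - V (a r) (g s)) \<le> norm (g r - g s)"
      unfolding eventually_at_filter
      by (intro always_eventually allI impI) (metis V_diff V_contr a(2))
  qed
  from tendsto_add[OF this 1] show "((\<lambda>s. V (a s) (g s)) \<longlongrightarrow> V (a s) (g s)) (at s within S)" by simp
qed

text \<open>The convolution integral of Duhamel's formula.\<close>

definition J :: "real \<Rightarrow> (real \<Rightarrow> 'x) \<Rightarrow> 'x" where
  "J t g = integral {0..t} (\<lambda>s. V (t - s) (g s))"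

lemma J_integrable:
  assumes "continuous_on {0..t} g" "\<And>s. s \<in> {0..t} \<Longrightarrow> g s \<in> X"
  shows "(\<lambda>s. V (t - s) (g s)) integrable_on {0..t}"
  using assms by (intro integrable_continuous_real V_continuous continuous_intros) auto

lemma J_in: "(\<And>s. s \<in> {0..t} \<Longrightarrow> g s \<in> X) \<Longrightarrow> J t g \<in> X"
  unfolding J_def by (intro integral_in_closed_subspace closed_X subspace_X V_in) auto

lemma J_0 [simp]: "J 0 g = 0"
  by (simp add: J_def)

lemma J_cong: "(\<And>s. s \<in> {0..t} \<Longrightarrow> g s = g' s) \<Longrightarrow> J t g = J t g'"
  unfolding J_def by (intro integral_cong) auto

lemma J_lincomb:
  assumes "continuous_on {0..t} g" "\<And>s. s \<in> {0..t} \<Longrightarrow> g s \<in> X"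
    and "continuous_on {0..t} g'" "\<And>s. s \<in> {0..t} \<Longrightarrow> g' s \<in> X"
  shows "J t (\<lambda>s. a *\<^sub>R g s + b *\<^sub>R g' s) = a *\<^sub>R J t g + b *\<^sub>R J t g'"
proof -
  have "J t (\<lambda>s. a *\<^sub>R g s + b *\<^sub>R g' s) = integral {0..t} (\<lambda>s. a *\<^sub>R V (t - s) (g s) + b *\<^sub>R V (t - s) (g' s))"
    unfolding J_def
    by (intro integral_cong) (auto simp: linear_add linear_scale bounded_linear.linear[OF V_lin])
  also have "\<dots> = a *\<^sub>R J t g + b *\<^sub>R J t g'"
    unfolding J_def using J_integrable assms
    by (subst integral_add) (auto intro!: integrable_cmul)
  finally show ?thesis .
qed

text \<open>With exponential weights the norm of the convolution gains a factor \<open>1 / \<mu>\<close>, which can be made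
  small; this is what makes the Duhamel map a contraction on the whole half-line.\<close>

lemma J_bound:
  assumes t: "t \<ge> 0" and g: "continuous_on {0..t} g" "\<And>s. s \<in> {0..t} \<Longrightarrow> g s \<in> X"
    and b: "\<And>s. s \<in> {0..t} \<Longrightarrow> norm (g s) \<le> N * exp (\<mu> * s)" and \<mu>: "\<mu> > 0" and N: "N \<ge> 0"
  shows "norm (J t g) \<le> N * exp (\<mu> * t) / \<mu>"
proof -
  have e: "((\<lambda>s. N * exp (\<mu> * s)) has_integral (N * exp (\<mu> * t) / \<mu> - N * exp (\<mu> * 0) / \<mu>)) {0..t}"
    using \<mu> t
    by (intro fundamental_theorem_of_calculus)
       (auto intro!: derivative_eq_intros simp: has_real_derivative_iff_has_vector_derivative[symmetric])
  have "norm (J t g) \<le> integral {0..t} (\<lambda>s. N * exp (\<mu> * s))"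
    unfolding J_def using e
    by (intro integral_norm_bound_integral J_integrable g) (auto intro: order_trans[OF V_contr b])
  also have "\<dots> = N * exp (\<mu> * t) / \<mu> - N * exp (\<mu> * 0) / \<mu>" using e by (rule integral_unique)
  also have "\<dots> \<le> N * exp (\<mu> * t) / \<mu>" using N \<mu> by simp
  finally show ?thesis .
qed

text \<open>After rescaling \<open>[0, t]\<close> to \<open>[0, 1]\<close> the integrand is jointly continuous in \<open>t\<close> and the new
  variable.\<close>

lemma J_continuous:
  assumes g: "continuous_on {0..} g" "\<And>s. s \<ge> 0 \<Longrightarrow> g s \<in> X"
  shows "continuous_on {0..} (\<lambda>t. J t g)"
proof -
  have eq: "J t g = t *\<^sub>R integral (cbox 0 1) (\<lambda>u. V (t * (1 - u)) (g (t * u)))" if "t \<ge> 0" for t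
  proof (cases "t = 0")
    case False
    with that have t: "t > 0" by simp
    have "(\<lambda>x. x / t) ` {0..t} = {0..1}"
      using t image_divide_atLeastAtMost[of t 0 t] by simp
    then have "integral {0..1} (\<lambda>u. V (t - t * u) (g (t * u))) = (1 / t) *\<^sub>R J t g"
      using integral_stretch_real[of t 0 t "\<lambda>s. V (t - s) (g s)"] t unfolding J_def by simp
    then show ?thesis using t by (simp add: algebra_simps)
  qed simp
  have "continuous_on ({0..} \<times> cbox 0 (1::real)) (\<lambda>p. V (fst p * (1 - snd p)) (g (fst p * snd p)))"
    by (intro V_continuous continuous_intros continuous_on_compose2[OF g(1)]) (auto simp: g(2))
  then have "continuous_on ({0..} \<times> cbox 0 (1::real)) (\<lambda>(t, u). V (t * (1 - u)) (g (t * u)))"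
    by (simp add: case_prod_unfold)
  then have "continuous_on {0..} (\<lambda>t. t *\<^sub>R integral (cbox 0 1) (\<lambda>u. V (t * (1 - u)) (g (t * u))))"
    by (intro continuous_intros integral_continuous_on_param)
  then show ?thesis by (rule continuous_on_eq) (simp add: eq)
qed

lemma J_split:
  assumes st: "s \<ge> 0" "t \<ge> 0" and g: "continuous_on {0..s + t} g" "\<And>r. r \<in> {0..s + t} \<Longrightarrow> g r \<in> X"
  shows "J (s + t) g = V t (J s g) + J t (\<lambda>r. g (s + r))"
proof -
  have gs: "continuous_on {0..s} g" by (rule continuous_on_subset[OF g(1)]) (use st in auto)
  have "J (s + t) g = integral {0..s} (\<lambda>r. V (s + t - r) (g r)) + integral {s..s + t} (\<lambda>r. V (s + t - r) (g r))"
    unfolding J_def using st J_integrable[OF g]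
    by (intro Henstock_Kurzweil_Integration.integral_combine[symmetric]) auto
  also have "integral {0..s} (\<lambda>r. V (s + t - r) (g r)) = integral {0..s} (V t \<circ> (\<lambda>r. V (s - r) (g r)))"
  proof (intro integral_cong)
    fix r assume r: "r \<in> {0..s}"
    then show "V (s + t - r) (g r) = (V t \<circ> (\<lambda>r. V (s - r) (g r))) r"
      using V_add[of t "s - r" "g r"] g(2)[of r] st by (simp add: algebra_simps)
  qed
  also have "\<dots> = V t (J s g)"
    unfolding J_def using gs g(2) st V_lin
    by (intro integral_linear J_integrable) auto
  also have "integral {s..s + t} (\<lambda>r. V (s + t - r) (g r)) = J t (\<lambda>r. g (s + r))"
    unfolding J_def using integral_shift_real_ivl[of s s "s + t" "\<lambda>r. V (s + t - r) (g r)"]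
    by (simp add: algebra_simps)
  finally show ?thesis .
qed

text \<open>The exponential weight for which the Duhamel map is Lipschitz with constant \<open>1 / 2\<close>.\<close>

definition lam :: real where "lam = 2 * K + 1"

lemma lam: "lam > 0" "K / lam \<le> 1 / 2"
  using K_nonneg by (auto simp: lam_def field_simps)

definition duhamel :: "'x \<Rightarrow> (real \<Rightarrow> 'x) \<Rightarrow> bool" where
  "duhamel f w \<longleftrightarrow> continuous_on {0..} w \<and> (\<forall>t\<ge>0. w t \<in> X) \<and> (\<forall>t\<ge>0. w t = V t f + J t (\<lambda>s. C (w s)))"

lemma duhamel_D:
  assumes "duhamel f w"
  shows "continuous_on {0..} w" "\<And>t. t \<ge> 0 \<Longrightarrow> w t \<in> X" "\<And>t. t \<ge> 0 \<Longrightarrow> w t = V t f + J t (\<lambda>s. C (w s))"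
    "continuous_on {0..} (\<lambda>s. C (w s))" "\<And>\<tau>. continuous_on {0..\<tau>} (\<lambda>s. C (w s))"
proof -
  show 1: "continuous_on {0..} w" and "\<And>t. t \<ge> 0 \<Longrightarrow> w t \<in> X" "\<And>t. t \<ge> 0 \<Longrightarrow> w t = V t f + J t (\<lambda>s. C (w s))"
    using assms by (auto simp: duhamel_def)
  show 2: "continuous_on {0..} (\<lambda>s. C (w s))"
    using 1 by (intro bounded_linear.continuous_on[OF C_lin])
  show "continuous_on {0..\<tau>} (\<lambda>s. C (w s))" for \<tau>
    by (rule continuous_on_subset[OF 2]) auto
qed

text \<open>The weighted norm of the difference of two solutions attains its maximum on \<open>[0, t]\<close>, and the
  Duhamel equation bounds this maximum by half of itself.\<close>

lemma duhamel_unique: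
  assumes w: "duhamel f w" and w': "duhamel f w'" and t: "t \<ge> 0"
  shows "w t = w' t"
proof -
  define e where "e s = w s - w' s" for s
  have e_cont: "continuous_on {0..t} e"
    unfolding e_def using duhamel_D(1)[OF w] duhamel_D(1)[OF w']
    by (intro continuous_intros) (auto intro: continuous_on_subset)
  have eX: "e s \<in> X" if "s \<ge> 0" for s
    using that duhamel_D(2)[OF w] duhamel_D(2)[OF w'] by (simp add: e_def X_diff)
  have "continuous_on {0..t} (\<lambda>s. exp (- lam * s) * norm (e s))"
    using e_cont by (intro continuous_intros)
  then obtain t0 where t0: "t0 \<in> {0..t}" "\<And>s. s \<in> {0..t} \<Longrightarrow> exp (- lam * s) * norm (e s) \<le> exp (- lam * t0) * norm (e t0)"
    using continuous_attains_sup[of "{0..t}" "\<lambda>s. exp (- lam * s) * norm (e s)"] t by auto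
  define N where "N = exp (- lam * t0) * norm (e t0)"
  have N: "norm (e s) \<le> N * exp (lam * s)" if "s \<in> {0..t}" for s
  proof -
    have "exp (- lam * s) * norm (e s) \<le> N" using t0(2)[OF that] by (simp add: N_def)
    then show ?thesis by (simp add: exp_minus field_simps)
  qed
  have N0: "N \<ge> 0" by (simp add: N_def)
  have "e t0 = J t0 (\<lambda>s. C (w s)) - J t0 (\<lambda>s. C (w' s))"
    using duhamel_D(3)[OF w, of t0] duhamel_D(3)[OF w', of t0] t0(1) by (simp add: e_def)
  also have "\<dots> = J t0 (\<lambda>s. 1 *\<^sub>R C (w s) + (- 1) *\<^sub>R C (w' s))"
    using duhamel_D(2,5)[OF w] duhamel_D(2,5)[OF w'] by (subst J_lincomb) (auto intro!: C_in)
  also have "\<dots> = J t0 (\<lambda>s. C (e s))"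
    by (intro J_cong) (simp add: e_def C_diff)
  finally have "norm (e t0) = norm (J t0 (\<lambda>s. C (e s)))" by simp
  also have "\<dots> \<le> (K * N) * exp (lam * t0) / lam"
  proof (intro J_bound lam)
    show "continuous_on {0..t0} (\<lambda>s. C (e s))"
      by (intro bounded_linear.continuous_on[OF C_lin] continuous_on_subset[OF e_cont]) (use t0 in auto)
    show "norm (C (e s)) \<le> K * N * exp (lam * s)" if s: "s \<in> {0..t0}" for s
    proof -
      have "norm (C (e s)) \<le> K * norm (e s)" by (rule C_bound)
      also have "\<dots> \<le> K * (N * exp (lam * s))" using N[of s] s t0 K_nonneg by (intro mult_left_mono) auto
      finally show ?thesis by (simp add: mult.assoc)
    qed
  qed (use t0 eX C_in N0 K_nonneg in auto)
  finally have "norm (e t0) \<le> (K / lam) * N * exp (lam * t0)" by simp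
  then have "N \<le> (K / lam) * N"
    by (simp add: N_def exp_minus field_simps)
  also have "\<dots> \<le> 1 / 2 * N" using lam(2) N0 by (rule mult_right_mono)
  finally have "N = 0" using N0 by simp
  then have "norm (e t) \<le> 0" using N[of t] t by simp
  then show ?thesis by (simp add: e_def)
qed

text \<open>Solutions are \<open>u t = exp (lam * t) w t\<close>, where \<open>w\<close> is the fixed point of a contraction of the
  complete space of bounded continuous functions on the line with values in \<open>X\<close>. These functions are
  frozen at negative times, hence the \<open>max 0 t\<close>.\<close>

lemma duhamel_exists:
  assumes f: "f \<in> X"
  shows "\<exists>w. duhamel f w \<and> (\<forall>t\<ge>0. norm (w t) \<le> 2 * exp (lam * t) * norm f)"
proof -
  define W :: "(real \<Rightarrow>\<^sub>C 'x) set" where "W = {w. \<forall>t. apply_bcontfun w t \<in> X}"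
  define G where "G w s = C (exp (lam * s) *\<^sub>R apply_bcontfun w s)" for w :: "real \<Rightarrow>\<^sub>C 'x" and s
  define \<phi> where "\<phi> w t = exp (- lam * max 0 t) *\<^sub>R (V (max 0 t) f + J (max 0 t) (G w))" for w t
  define \<Phi> where "\<Phi> w = Bcontfun (\<phi> w)" for w
  have GX: "G w s \<in> X" if "w \<in> W" for w s
    using that unfolding G_def W_def by (intro C_in X_scale) auto
  have G_cont: "continuous_on S (G w)" for w S
    unfolding G_def
    by (intro bounded_linear.continuous_on[OF C_lin] continuous_intros continuous_on_apply_bcontfun)
  have G_bound: "norm (G w s) \<le> (K * norm w) * exp (lam * s)" for w s
  proof -
    have "norm (G w s) \<le> K * norm (exp (lam * s) *\<^sub>R apply_bcontfun w s)" unfolding G_def by (rule C_bound)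
    also have "\<dots> = K * (norm (w s) * exp (lam * s))" by simp
    also have "\<dots> \<le> K * (norm w * exp (lam * s))"
      using K_nonneg by (intro mult_left_mono mult_right_mono norm_bounded) auto
    finally show ?thesis by (simp add: mult.assoc)
  qed
  have J_half: "exp (- lam * r) * norm (J r (G w)) \<le> norm w / 2" if "w \<in> W" "r \<ge> 0" for w r
  proof -
    have "norm (J r (G w)) \<le> (K * norm w) * exp (lam * r) / lam"
      using that K_nonneg by (intro J_bound G_cont GX G_bound lam) auto
    then have "exp (- lam * r) * norm (J r (G w)) \<le> K / lam * norm w"
      by (simp add: exp_minus field_simps)
    also have "\<dots> \<le> 1 / 2 * norm w" using lam(2) by (intro mult_right_mono) auto
    finally show ?thesis by simp
  qed
  have \<phi>_bound: "norm (\<phi> w t) \<le> norm f + norm w / 2" if "w \<in> W" for w t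
  proof -
    define r where "r = max 0 t"
    have r: "r \<ge> 0" by (simp add: r_def)
    have "norm (\<phi> w t) = exp (- lam * r) * norm (V r f + J r (G w))" by (simp add: \<phi>_def r_def)
    also have "\<dots> \<le> exp (- lam * r) * norm (V r f) + exp (- lam * r) * norm (J r (G w))"
      by (metis exp_ge_zero mult_left_mono norm_triangle_ineq distrib_left)
    also have "\<dots> \<le> 1 * norm f + norm w / 2"
      using J_half[OF that r] r lam(1) by (intro add_mono mult_mono V_contr) auto
    finally show ?thesis by simp
  qed
  have \<phi>_cont: "continuous_on UNIV (\<phi> w)" if "w \<in> W" for w
    unfolding \<phi>_def
    by (intro continuous_intros continuous_on_compose2[OF J_continuous[OF G_cont GX[OF that]]]
        continuous_on_compose2[OF scs_continuous_on[OF closed_X subspace_X V_scs f]]) auto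
  have \<Phi>_app: "apply_bcontfun (\<Phi> w) = \<phi> w" if "w \<in> W" for w
    unfolding \<Phi>_def by (intro Bcontfun_inverse bcontfun_normI[OF \<phi>_cont \<phi>_bound] that)
  have \<Phi>_W: "\<Phi> w \<in> W" if "w \<in> W" for w
    unfolding W_def using f that
    by (auto simp: \<Phi>_app \<phi>_def intro!: X_scale X_add V_in J_in GX)
  have "closed W"
    unfolding closed_sequential_limits
  proof (intro allI impI)
    fix u w assume u: "(\<forall>n. u n \<in> W) \<and> u \<longlonglongrightarrow> w"
    have "w t \<in> X" for t
    proof (rule closed_sequentially[OF closed_X])
      show "\<And>n. u n t \<in> X" using u by (auto simp: W_def)
      show "(\<lambda>n. u n t) \<longlonglongrightarrow> w t"
        using tendsto_bcontfun_uniform_limit[OF conjunct2[OF u]] by (rule tendsto_uniform_limitI) simp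
    qed
    then show "w \<in> W" by (simp add: W_def)
  qed
  have "\<exists>!w\<in>W. \<Phi> w = w"
  proof (rule Banach_fix[OF complete_eq_closed[THEN iffD2, OF \<open>closed W\<close>]])
    show "W \<noteq> {}" using subspace_0[OF subspace_X] by (auto simp: W_def intro!: exI[of _ 0])
    show "\<Phi> ` W \<subseteq> W" using \<Phi>_W by auto
    fix w w' assume w: "w \<in> W" "w' \<in> W"
    have d: "w - w' \<in> W" using w by (simp add: W_def X_diff)
    have "norm (\<Phi> w - \<Phi> w') \<le> norm (w - w') / 2"
    proof (rule norm_bound)
      fix t :: real
      define r where "r = max 0 t"
      have r: "r \<ge> 0" by (simp add: r_def)
      have "J r (G w) - J r (G w') = J r (\<lambda>s. 1 *\<^sub>R G w s + (- 1) *\<^sub>R G w' s)"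
        using w by (subst J_lincomb) (auto intro: G_cont GX)
      also have "\<dots> = J r (G (w - w'))"
        by (intro J_cong) (simp add: G_def C_diff[symmetric] scaleR_diff_right)
      finally have "\<phi> w t - \<phi> w' t = exp (- lam * r) *\<^sub>R J r (G (w - w'))"
        by (simp add: \<phi>_def r_def scaleR_diff_right[symmetric])
      then have "norm (\<phi> w t - \<phi> w' t) = exp (- lam * r) * norm (J r (G (w - w')))" by simp
      then show "norm (apply_bcontfun (\<Phi> w - \<Phi> w') t) \<le> norm (w - w') / 2"
        using J_half[OF d r] w by (simp add: \<Phi>_app)
    qed
    then show "dist (\<Phi> w) (\<Phi> w') \<le> 1 / 2 * dist w w'" by (simp add: dist_norm)
  qed auto
  then obtain w where w: "w \<in> W" "\<Phi> w = w" by blast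
  have fix_eq: "w t = \<phi> w t" for t using \<Phi>_app[OF w(1)] w(2) by simp
  have "norm w \<le> norm f + norm w / 2"
    by (rule norm_bound) (use \<phi>_bound[OF w(1)] fix_eq in simp)
  then have w_norm: "norm w \<le> 2 * norm f" by simp
  define u where "u t = exp (lam * t) *\<^sub>R w t" for t
  have "duhamel f u"
    unfolding duhamel_def
  proof (intro conjI allI impI)
    show "continuous_on {0..} u" unfolding u_def by (intro continuous_intros continuous_on_apply_bcontfun)
    show "u t \<in> X" for t using w(1) by (auto simp: u_def W_def intro: X_scale)
    show "u t = V t f + J t (\<lambda>s. C (u s))" if "t \<ge> 0" for t
      using that unfolding u_def by (subst fix_eq) (simp add: \<phi>_def G_def[abs_def] exp_minus)
  qed
  moreover have "norm (u t) \<le> 2 * exp (lam * t) * norm f" for t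
  proof -
    have "norm (u t) = exp (lam * t) * norm (w t)" by (simp add: u_def)
    also have "\<dots> \<le> exp (lam * t) * (2 * norm f)"
      by (intro mult_left_mono order_trans[OF norm_bounded w_norm]) auto
    finally show ?thesis by simp
  qed
  ultimately show ?thesis by blast
qed

definition T :: "real \<Rightarrow> 'x \<Rightarrow> 'x" where
  "T t f = (SOME w. duhamel f w \<and> (\<forall>t\<ge>0. norm (w t) \<le> 2 * exp (lam * t) * norm f)) t"

lemma
  assumes "f \<in> X"
  shows duhamel_T: "duhamel f (\<lambda>t. T t f)"
    and T_bound: "\<And>t. t \<ge> 0 \<Longrightarrow> norm (T t f) \<le> 2 * exp (lam * t) * norm f"
  using someI_ex[OF duhamel_exists[OF assms]] by (auto simp: T_def[abs_def])

lemma T_eqI: "f \<in> X \<Longrightarrow> duhamel f w \<Longrightarrow> t \<ge> 0 \<Longrightarrow> T t f = w t"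
  by (rule duhamel_unique[OF duhamel_T])

text \<open>Linearity and the semigroup law follow from uniqueness: linear combinations of solutions and
  shifted solutions solve the Duhamel equation with the corresponding initial value.\<close>

lemma T_scs: "strongly_continuous_semigroup X T"
  unfolding strongly_continuous_semigroup_def
proof (intro conjI allI impI ballI)
  fix t :: real and f assume "t \<ge> 0" "f \<in> X"
  then show "T t f \<in> X" using duhamel_D(2)[OF duhamel_T] by blast
next
  fix t :: real and f g a b assume t: "t \<ge> 0" and f: "f \<in> X" and g: "g \<in> X"
  note Tf = duhamel_D[OF duhamel_T[OF f]] and Tg = duhamel_D[OF duhamel_T[OF g]]
  have "duhamel (a *\<^sub>R f + b *\<^sub>R g) (\<lambda>t. a *\<^sub>R T t f + b *\<^sub>R T t g)"
    unfolding duhamel_def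
  proof (intro conjI allI impI)
    show "continuous_on {0..} (\<lambda>t. a *\<^sub>R T t f + b *\<^sub>R T t g)"
      using Tf(1) Tg(1) by (intro continuous_intros)
    fix t :: real assume t: "t \<ge> 0"
    show "a *\<^sub>R T t f + b *\<^sub>R T t g \<in> X" using Tf(2) Tg(2) t by (intro X_add X_scale) auto
    have "J t (\<lambda>s. C (a *\<^sub>R T s f + b *\<^sub>R T s g)) = J t (\<lambda>s. a *\<^sub>R C (T s f) + b *\<^sub>R C (T s g))"
      by (simp add: linear_add linear_scale bounded_linear.linear[OF C_lin])
    also have "\<dots> = a *\<^sub>R J t (\<lambda>s. C (T s f)) + b *\<^sub>R J t (\<lambda>s. C (T s g))"
      using Tf(2,5) Tg(2,5) by (intro J_lincomb C_in) auto
    finally show "a *\<^sub>R T t f + b *\<^sub>R T t g = V t (a *\<^sub>R f + b *\<^sub>R g) + J t (\<lambda>s. C (a *\<^sub>R T s f + b *\<^sub>R T s g))"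
      using Tf(3)[OF t] Tg(3)[OF t] V_lin[OF t]
      by (simp add: linear_add linear_scale bounded_linear.linear scaleR_add_right)
  qed
  then show "T t (a *\<^sub>R f + b *\<^sub>R g) = a *\<^sub>R T t f + b *\<^sub>R T t g"
    using f g t by (intro T_eqI X_add X_scale)
next
  fix t :: real assume "t \<ge> 0"
  then show "\<exists>K. \<forall>f\<in>X. norm (T t f) \<le> K * norm f"
    using T_bound by blast
next
  fix f assume f: "f \<in> X"
  show T0: "T 0 f = f" using duhamel_D(3)[OF duhamel_T[OF f], of 0] f by (simp add: V_0)
  have "continuous_on {0..} (\<lambda>t. T t f)" by (rule duhamel_D(1)[OF duhamel_T[OF f]])
  then have "((\<lambda>t. T t f) \<longlongrightarrow> T 0 f) (at 0 within {0..})"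
    by (simp add: continuous_on_def)
  then show "((\<lambda>t. T t f) \<longlongrightarrow> f) (at_right 0)"
    unfolding T0 by (rule tendsto_mono[rotated]) (simp add: at_le subset_iff)
next
  fix s t :: real and f assume s: "s \<ge> 0" and t: "t \<ge> 0" and f: "f \<in> X"
  note Tf = duhamel_D[OF duhamel_T[OF f]]
  have "duhamel (T t f) (\<lambda>s. T (t + s) f)"
    unfolding duhamel_def
  proof (intro conjI allI impI)
    show "continuous_on {0..} (\<lambda>s. T (t + s) f)"
      by (rule continuous_on_compose2[OF Tf(1)]) (use t in \<open>auto intro!: continuous_intros\<close>)
    fix s :: real assume s: "s \<ge> 0"
    show "T (t + s) f \<in> X" using Tf(2) s t by simp
    have "T (t + s) f = V (t + s) f + J (t + s) (\<lambda>r. C (T r f))" using Tf(3)[of "t + s"] s t by simp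
    also have "J (t + s) (\<lambda>r. C (T r f)) = V s (J t (\<lambda>r. C (T r f))) + J s (\<lambda>r. C (T (t + r) f))"
      using s t Tf by (intro J_split C_in) auto
    also have "V (t + s) f = V s (V t f)" using V_add[OF s t f] by (simp add: add.commute)
    also have "V s (V t f) + (V s (J t (\<lambda>r. C (T r f))) + J s (\<lambda>r. C (T (t + r) f)))
      = V s (V t f + J t (\<lambda>r. C (T r f))) + J s (\<lambda>r. C (T (t + r) f))"
      using V_lin[OF s] by (simp add: linear_add bounded_linear.linear)
    finally show "T (t + s) f = V s (T t f) + J s (\<lambda>r. C (T (t + r) f))"
      using Tf(3)[OF t] by simp
  qed
  then show "T (s + t) f = T s (T t f)"
    using T_eqI[of "T t f" _ s] Tf(2)[OF t] s by (simp add: add.commute)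
qed

lemma J_derivative_0:
  assumes g: "continuous_on {0..} g" "\<And>s. s \<ge> 0 \<Longrightarrow> g s \<in> X"
  shows "((\<lambda>h. (1 / h) *\<^sub>R J h g) \<longlongrightarrow> g 0) (at_right 0)"
  unfolding J_def
proof (rule average_tendsto)
  show "(\<lambda>s. V (h - s) (g s)) integrable_on {0..h}" for h
    using g by (intro J_integrable) (auto intro: continuous_on_subset)
  fix e :: real assume e: "e > 0"
  have "continuous_on {0..} (\<lambda>r. V r (g 0))" by (rule scs_continuous_on[OF closed_X subspace_X V_scs g(2)]) simp
  then obtain d1 where d1: "d1 > 0" "\<And>r. 0 \<le> r \<Longrightarrow> r < d1 \<Longrightarrow> dist (V r (g 0)) (V 0 (g 0)) < e / 2"
    unfolding continuous_on_iff using e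
    by (metis atLeast_iff dist_0_norm dist_commute abs_of_nonneg half_gt_zero order_refl real_norm_def)
  obtain d2 where d2: "d2 > 0" "\<And>r. 0 \<le> r \<Longrightarrow> r < d2 \<Longrightarrow> dist (g r) (g 0) < e / 2"
    using g(1) unfolding continuous_on_iff using e
    by (metis atLeast_iff dist_0_norm dist_commute abs_of_nonneg half_gt_zero order_refl real_norm_def)
  have "norm (V (h - s) (g s) - g 0) \<le> e" if "0 \<le> s" "s \<le> h" "h < min d1 d2" for h s
  proof -
    have "V (h - s) (g s) - g 0 = V (h - s) (g s - g 0) + (V (h - s) (g 0) - g 0)"
      using that by (simp add: V_diff)
    then have "norm (V (h - s) (g s) - g 0) \<le> norm (V (h - s) (g s - g 0)) + norm (V (h - s) (g 0) - g 0)"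
      by (metis norm_triangle_ineq)
    also have "\<dots> \<le> norm (g s - g 0) + norm (V (h - s) (g 0) - g 0)"
      using that by (intro add_right_mono V_contr) auto
    also have "\<dots> \<le> e / 2 + e / 2"
      using d1(2)[of "h - s"] d2(2)[of s] that g(2)[of 0] by (intro add_mono) (auto simp: dist_norm V_0)
    finally show ?thesis by simp
  qed
  then show "\<exists>d>0. \<forall>h s. 0 \<le> s \<and> s \<le> h \<and> h < d \<longrightarrow> norm (V (h - s) (g s) - g 0) \<le> e"
    using d1(1) d2(1) by (intro exI[of _ "min d1 d2"]) auto
qed

text \<open>By Duhamel's formula the difference quotients of \<open>T\<close> and \<open>V\<close> differ by \<open>J t (\<lambda>s. C (T s f)) / t\<close>, which tends to
  \<open>C f\<close> for every \<open>f \<in> X\<close>. So both generators have the same domain.\<close>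

lemma generator_T: "generator X T = {(f, h). \<exists>g. (f, g) \<in> generator X V \<and> h = g + C f}"
proof -
  have quot: "(1 / t) *\<^sub>R (T t f - f) = (1 / t) *\<^sub>R (V t f - f) + (1 / t) *\<^sub>R J t (\<lambda>s. C (T s f))"
    if "f \<in> X" "t \<ge> 0" for f t
    using duhamel_D(3)[OF duhamel_T[OF that(1)] that(2)] by (simp add: algebra_simps)
  have Jlim: "((\<lambda>t. (1 / t) *\<^sub>R J t (\<lambda>s. C (T s f))) \<longlongrightarrow> C f) (at_right 0)" if f: "f \<in> X" for f
    using J_derivative_0[of "\<lambda>s. C (T s f)"] duhamel_D[OF duhamel_T[OF f]] scs_0[OF T_scs f] C_in by auto
  have ev: "\<forall>\<^sub>F t in at_right 0. (1 / t) *\<^sub>R (T t f - f) = (1 / t) *\<^sub>R (V t f - f) + (1 / t) *\<^sub>R J t (\<lambda>s. C (T s f))"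
    if "f \<in> X" for f
    using eventually_at_right_less[of 0] by eventually_elim (use quot[OF that] in auto)
  show ?thesis
  proof (intro equalityI subsetI)
    fix p assume "p \<in> generator X T"
    then obtain f h where p: "p = (f, h)" "f \<in> X" "h \<in> X" and l: "((\<lambda>t. (1 / t) *\<^sub>R (T t f - f)) \<longlongrightarrow> h) (at_right 0)"
      by (auto simp: generator_def)
    have "((\<lambda>t. (1 / t) *\<^sub>R (V t f - f)) \<longlongrightarrow> h - C f) (at_right 0)"
    proof (rule Lim_transform_eventually[OF tendsto_diff[OF l Jlim[OF p(2)]]])
      show "\<forall>\<^sub>F t in at_right 0. (1 / t) *\<^sub>R (T t f - f) - (1 / t) *\<^sub>R J t (\<lambda>s. C (T s f)) = (1 / t) *\<^sub>R (V t f - f)"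
        using ev[OF p(2)] by eventually_elim simp
    qed
    then have "(f, h - C f) \<in> generator X V" using p C_in by (simp add: generator_def X_diff)
    then show "p \<in> {(f, h). \<exists>g. (f, g) \<in> generator X V \<and> h = g + C f}"
      by (auto simp: p intro!: exI[of _ "h - C f"])
  next
    fix p assume "p \<in> {(f, h). \<exists>g. (f, g) \<in> generator X V \<and> h = g + C f}"
    then obtain f g where p: "p = (f, g + C f)" "f \<in> X" "g \<in> X" and l: "((\<lambda>t. (1 / t) *\<^sub>R (V t f - f)) \<longlongrightarrow> g) (at_right 0)"
      by (auto simp: generator_def)
    have "((\<lambda>t. (1 / t) *\<^sub>R (T t f - f)) \<longlongrightarrow> g + C f) (at_right 0)"
    proof (rule Lim_transform_eventually[OF tendsto_add[OF l Jlim[OF p(2)]]])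
      show "\<forall>\<^sub>F t in at_right 0. (1 / t) *\<^sub>R (V t f - f) + (1 / t) *\<^sub>R J t (\<lambda>s. C (T s f)) = (1 / t) *\<^sub>R (T t f - f)"
        using ev[OF p(2)] by eventually_elim simp
    qed
    then show "p \<in> generator X T" using p C_in by (simp add: generator_def X_add)
  qed
qed

text \<open>Time averages of orbits lie in the domain of the generator, since \<open>V h\<close> shifts the interval of
  integration and only its ends contribute to the difference quotient.\<close>

lemma V_average_in_generator:
  assumes f: "f \<in> X" and t: "t > 0"
  shows "((1 / t) *\<^sub>R integral {0..t} (\<lambda>s. V s f), (1 / t) *\<^sub>R (V t f - f)) \<in> generator X V"
proof -
  define I where "I a b = integral {a..b} (\<lambda>s. V s f)" for a b
  have c: "continuous_on {0..} (\<lambda>s. V s f)" by (rule scs_continuous_on[OF closed_X subspace_X V_scs f])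
  have int: "(\<lambda>s. V s f) integrable_on {a..b}" if "a \<ge> 0" for a b
    using that by (intro integrable_continuous_real continuous_on_subset[OF c]) auto
  have IX: "I 0 t \<in> X"
    unfolding I_def using f by (intro integral_in_closed_subspace closed_X subspace_X V_in) auto
  have avg: "((\<lambda>h. (1 / h) *\<^sub>R I a (a + h)) \<longlongrightarrow> V a f) (at_right 0)" if a: "a \<ge> 0" for a
  proof -
    have "((\<lambda>h. (1 / h) *\<^sub>R integral {0..h} (\<lambda>s. V (s + a) f)) \<longlongrightarrow> V a f) (at_right 0)"
    proof (rule average_tendsto)
      show "(\<lambda>s. V (s + a) f) integrable_on {0..h}" for h
        using a by (intro integrable_continuous_real continuous_on_compose2[OF c] continuous_intros) auto
      fix e :: real assume "e > 0"
      then obtain d where "d > 0" "\<And>r. r \<ge> 0 \<Longrightarrow> dist r a < d \<Longrightarrow> dist (V r f) (V a f) < e"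
        using c a unfolding continuous_on_iff by (metis atLeast_iff)
      then show "\<exists>d>0. \<forall>h s. 0 \<le> s \<and> s \<le> h \<and> h < d \<longrightarrow> norm (V (s + a) f - V a f) \<le> e"
        using a by (intro exI[of _ d]) (auto simp: dist_norm intro!: less_imp_le)
    qed
    moreover have "integral {0..h} (\<lambda>s. V (s + a) f) = I a (a + h)" for h
      unfolding I_def using integral_shift_real_ivl[of a a "a + h" "\<lambda>s. V s f"] by simp
    ultimately show ?thesis by simp
  qed
  have "((\<lambda>h. (1 / t) *\<^sub>R ((1 / h) *\<^sub>R I t (t + h) - (1 / h) *\<^sub>R I 0 (0 + h))) \<longlongrightarrow> (1 / t) *\<^sub>R (V t f - V 0 f)) (at_right 0)"
    using t by (intro tendsto_intros avg) auto
  moreover have "\<forall>\<^sub>F h in at_right 0. (1 / t) *\<^sub>R ((1 / h) *\<^sub>R I t (t + h) - (1 / h) *\<^sub>R I 0 (0 + h))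
      = (1 / h) *\<^sub>R (V h ((1 / t) *\<^sub>R I 0 t) - (1 / t) *\<^sub>R I 0 t)"
    using eventually_at_right_less[of 0]
  proof eventually_elim
    case (elim h)
    have "V h (I 0 t) = integral {0..t} (V h \<circ> (\<lambda>s. V s f))"
      unfolding I_def using elim by (intro integral_linear[symmetric] int V_lin) auto
    also have "\<dots> = integral {0..t} (\<lambda>s. V (s + h) f)"
      using elim f by (intro integral_cong) (simp add: V_add[symmetric] add.commute)
    also have "\<dots> = I h (t + h)"
      unfolding I_def using integral_shift_real_ivl[of h h "t + h" "\<lambda>s. V s f"] by simp
    finally have "V h (I 0 t) = I h (t + h)" .
    moreover have "I 0 h + I h (t + h) = I 0 (t + h)" "I 0 t + I t (t + h) = I 0 (t + h)"
      unfolding I_def using elim t by (auto intro!: Henstock_Kurzweil_Integration.integral_combine int)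
    ultimately have "V h (I 0 t) - I 0 t = I t (t + h) - I 0 h" by (simp add: algebra_simps)
    moreover have "V h ((1 / t) *\<^sub>R I 0 t) = (1 / t) *\<^sub>R V h (I 0 t)"
      using V_lin[of h] elim by (simp add: linear_scale bounded_linear.linear)
    ultimately have "V h ((1 / t) *\<^sub>R I 0 t) - (1 / t) *\<^sub>R I 0 t = (1 / t) *\<^sub>R (I t (t + h) - I 0 h)"
      by (simp add: scaleR_diff_right[symmetric])
    then show ?case by (simp add: scaleR_diff_right[symmetric])
  qed
  ultimately have "((\<lambda>h. (1 / h) *\<^sub>R (V h ((1 / t) *\<^sub>R I 0 t) - (1 / t) *\<^sub>R I 0 t)) \<longlongrightarrow> (1 / t) *\<^sub>R (V t f - V 0 f)) (at_right 0)"
    by (rule Lim_transform_eventually)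
  then show ?thesis
    using IX f t by (auto simp: generator_def I_def[symmetric] V_0 intro!: X_scale X_diff V_in)
qed

lemma generator_T_dense:
  assumes f: "f \<in> X" and e: "e > 0"
  shows "\<exists>(f', g')\<in>generator X T. dist f' f < e"
proof -
  have c: "continuous_on {0..} (\<lambda>s. V s f)" by (rule scs_continuous_on[OF closed_X subspace_X V_scs f])
  have "((\<lambda>h. (1 / h) *\<^sub>R integral {0..h} (\<lambda>s. V s f)) \<longlongrightarrow> V 0 f) (at_right 0)"
  proof (rule average_tendsto)
    show "(\<lambda>s. V s f) integrable_on {0..h}" for h
      by (intro integrable_continuous_real continuous_on_subset[OF c]) auto
    fix e :: real assume "e > 0"
    then obtain d where "d > 0" "\<And>r. r \<ge> 0 \<Longrightarrow> dist r 0 < d \<Longrightarrow> dist (V r f) (V 0 f) < e"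
      using c unfolding continuous_on_iff by (metis atLeast_iff order_refl)
    then show "\<exists>d>0. \<forall>h s. 0 \<le> s \<and> s \<le> h \<and> h < d \<longrightarrow> norm (V s f - V 0 f) \<le> e"
      by (intro exI[of _ d]) (auto simp: dist_norm intro!: less_imp_le)
  qed
  then have "\<forall>\<^sub>F h in at_right 0. dist ((1 / h) *\<^sub>R integral {0..h} (\<lambda>s. V s f)) f < e"
    using e f by (auto simp: V_0 dest: tendstoD)
  then have "\<forall>\<^sub>F h in at_right 0. h > 0 \<and> dist ((1 / h) *\<^sub>R integral {0..h} (\<lambda>s. V s f)) f < e"
    using eventually_at_right_less[of 0] by eventually_elim auto
  then obtain h where "h > 0" "dist ((1 / h) *\<^sub>R integral {0..h} (\<lambda>s. V s f)) f < e"
    using eventually_happens'[OF trivial_limit_at_right_real] by blast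
  then show ?thesis
    using V_average_in_generator[OF f] unfolding generator_T by blast
qed

text \<open>The choice operator picks some semigroup with the given generator; existence is provided by \<open>T\<close> and
  uniqueness by the density of the domain.\<close>

lemma semigroup_of_eq:
  assumes "G = {(f, h). \<exists>g. (f, g) \<in> generator X V \<and> h = g + C f}" "t \<ge> 0" "f \<in> X"
  shows "semigroup_of X G t f = T t f"
proof -
  have "strongly_continuous_semigroup X (semigroup_of X G) \<and> generator X (semigroup_of X G) = G"
    unfolding semigroup_of_def by (rule someI[of _ T]) (use T_scs generator_T assms(1) in auto)
  then show ?thesis
    using assms by (intro semigroup_eq_if_generator_eq[OF closed_X subspace_X T_scs] generator_T_dense)
      (auto simp: generator_T)
qed

text \<open>Both sides satisfy a Duhamel formula, a discrete one for the powers of \<open>S h = S0 h + h C\<close> and a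
  continuous one for \<open>T\<close>. The difference of the two convolutions splits into a part that is linear in
  the errors at earlier grid points, to which the discrete Gronwall inequality applies, and the error
  of a Riemann sum for the convolution with the fixed continuous function \<open>g s = C (T s f)\<close>. The range of
  \<open>g\<close> is compact, so \<open>S0\<close>-products approximate \<open>V\<close> uniformly on it and the Riemann sum error is uniformly
  small.\<close>

lemma product_formula:
  assumes S0_lin: "\<And>h. h \<ge> 0 \<Longrightarrow> bounded_linear (S0 h)"
    and S0_contr: "\<And>h f. h \<ge> 0 \<Longrightarrow> norm (S0 h f) \<le> norm f"
    and S0_conv: "\<And>f. f \<in> X \<Longrightarrow> approximates \<tau> S0 V f"
    and f: "f \<in> X" and \<tau>: "\<tau> \<ge> 0"
  shows "approximates \<tau> (\<lambda>h g. S0 h g + h *\<^sub>R C g) T f"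
  unfolding approximates_def
proof (intro allI impI)
  fix e :: real assume e: "e > 0"
  have pow_lin: "bounded_linear (S0 h ^^ m)" if "h \<ge> 0" for h m
    using S0_lin[OF that]
    by (induction m) (auto intro: bounded_linear_ident[unfolded id_def[symmetric]] bounded_linear_compose simp: o_def[symmetric] id_def
        simp del: funpow.simps(2) simp: funpow_Suc_right intro!: bounded_linear_compose[unfolded o_def[symmetric]])
  have pow_contr: "norm ((S0 h ^^ m) g) \<le> norm g" if "h \<ge> 0" for h m g
    by (induction m) (auto intro: order_trans[OF S0_contr[OF that]])
  define g where "g s = C (T s f)" for s
  note Tf = duhamel_D[OF duhamel_T[OF f]]
  have g_cont: "continuous_on {0..\<tau>} g" and gX: "\<And>s. s \<ge> 0 \<Longrightarrow> g s \<in> X"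
    using Tf(2,5) C_in by (auto simp: g_def)
  define K' where "K' = g ` {0..\<tau>}"
  have K': "compact K'" "K' \<subseteq> X"
    using g_cont gX by (auto simp: K'_def intro: compact_continuous_image)
  \<comment> \<open>The initial error is at most \<open>e'\<close> and the Riemann sum error \<open>3 * e'\<close> per unit of time; the
    exponential is the Gronwall factor.\<close>
  define e' where "e' = e / ((1 + 3 * \<tau>) * exp (K * \<tau>))"
  have e': "e' > 0" using e \<tau> by (simp add: e'_def)
  obtain d1 where d1: "d1 > 0" "\<And>h m. 0 \<le> h \<Longrightarrow> h < d1 \<Longrightarrow> real m * h \<le> \<tau> \<Longrightarrow> norm ((S0 h ^^ m) f - V (real m * h) f) \<le> e'"
    using approximatesE[OF S0_conv[OF f] e'] by blast
  define I2 where "I2 d = {(h, m :: nat). 0 \<le> h \<and> h < d \<and> real m * h \<le> \<tau>}" for d :: real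
  let ?P = "\<lambda>(h, m) u. (S0 h ^^ m) u - V (real m * h) u"
  obtain d2 where d2: "d2 > 0" "\<And>u i. u \<in> K' \<Longrightarrow> i \<in> I2 d2 \<Longrightarrow> norm (?P i u) \<le> e'"
  proof (rule uniformly_small_on_compact[OF K', where I = I2 and P = ?P and e = e'])
    fix i d u v assume i: "i \<in> I2 d"
    obtain h m where hm: "i = (h, m)" "h \<ge> 0" using i by (auto simp: I2_def)
    have "(S0 h ^^ m) u - V (real m * h) u - ((S0 h ^^ m) v - V (real m * h) v)
        = (S0 h ^^ m) (u - v) - V (real m * h) (u - v)"
      using hm pow_lin[OF hm(2)] by (simp add: V_diff linear_diff bounded_linear.linear)
    also have "norm \<dots> \<le> norm (u - v) + norm (u - v)"
      using hm by (intro order_trans[OF norm_triangle_ineq4] add_mono pow_contr V_contr) auto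
    finally show "norm (?P i u - ?P i v) \<le> 2 * norm (u - v)"
      by (simp add: hm)
  next
    show "I2 d \<subseteq> I2 d'" if "d \<le> d'" for d d' using that by (auto simp: I2_def)
    show "\<exists>d>0. \<forall>i\<in>I2 d. norm (?P i u) \<le> e" if "u \<in> X" "e > 0" for u e
      using approximatesE[OF S0_conv[OF that(1)] that(2)] by (auto simp: I2_def) metis
  qed (use e' in auto)
  obtain d3 where d3: "d3 > 0" "\<And>u r. u \<in> K' \<Longrightarrow> r \<in> {0..<d3} \<Longrightarrow> norm (V r u - u) \<le> e'"
  proof (rule uniformly_small_on_compact[OF K', where I = "\<lambda>d. {0..<d}" and P = "\<lambda>r u. V r u - u" and e = e'])
    fix r d u v assume r: "r \<in> {0..<d::real}"
    have "V r u - u - (V r v - v) = V r (u - v) - (u - v)" using r by (simp add: V_diff)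
    also have "norm \<dots> \<le> norm (u - v) + norm (u - v)"
      using r by (intro order_trans[OF norm_triangle_ineq4] add_right_mono V_contr) auto
    finally show "norm (V r u - u - (V r v - v)) \<le> 2 * norm (u - v)" by simp
  next
    fix u and e :: real assume u: "u \<in> X" and e: "e > 0"
    have "continuous_on {0..} (\<lambda>s. V s u)" by (rule scs_continuous_on[OF closed_X subspace_X V_scs u])
    then obtain d where "d > 0" "\<And>r. r \<ge> 0 \<Longrightarrow> dist r 0 < d \<Longrightarrow> dist (V r u) (V 0 u) < e"
      using e unfolding continuous_on_iff by (metis atLeast_iff order_refl)
    then show "\<exists>d>0. \<forall>r\<in>{0..<d}. norm (V r u - u) \<le> e"
      using u by (intro exI[of _ d]) (auto simp: dist_norm V_0 intro!: less_imp_le)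
  qed (use e' in auto)
  have "uniformly_continuous_on {0..\<tau>} g" using g_cont by (intro compact_uniformly_continuous) auto
  then obtain d4 where d4: "d4 > 0" "\<And>s r. s \<in> {0..\<tau>} \<Longrightarrow> r \<in> {0..\<tau>} \<Longrightarrow> dist s r < d4 \<Longrightarrow> dist (g s) (g r) < e'"
    using e' unfolding uniformly_continuous_on_def by (metis dist_commute)
  define d where "d = min (min d1 d2) (min d3 d4)"
  have "norm (((\<lambda>g. S0 h g + h *\<^sub>R C g) ^^ m) f - T (real m * h) f) \<le> e"
    if h: "0 \<le> h" "h < d" and m: "real m * h \<le> \<tau>" for h m
  proof -
    define S where "S = (\<lambda>g. S0 h g + h *\<^sub>R C g)"
    have lin: "linear (S0 h)" using S0_lin[OF h(1)] by (rule bounded_linear.linear)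
    have discrete_duhamel: "(S ^^ m) f = (S0 h ^^ m) f + h *\<^sub>R (\<Sum>j<m. (S0 h ^^ (m - 1 - j)) (C ((S ^^ j) f)))" for m
    proof (induction m)
      case (Suc m)
      have "(S ^^ Suc m) f = S0 h ((S ^^ m) f) + h *\<^sub>R C ((S ^^ m) f)" by (simp add: S_def)
      also have "S0 h ((S ^^ m) f) = (S0 h ^^ Suc m) f + h *\<^sub>R (\<Sum>j<m. S0 h ((S0 h ^^ (m - 1 - j)) (C ((S ^^ j) f))))"
        by (subst Suc.IH) (simp add: linear_add[OF lin] linear_scale[OF lin] linear_sum[OF lin])
      also have "(\<Sum>j<m. S0 h ((S0 h ^^ (m - 1 - j)) (C ((S ^^ j) f)))) = (\<Sum>j<m. (S0 h ^^ (Suc m - 1 - j)) (C ((S ^^ j) f)))"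
      proof (intro sum.cong refl)
        fix j assume "j \<in> {..<m}"
        then have "Suc m - 1 - j = Suc (m - 1 - j)" by auto
        then show "S0 h ((S0 h ^^ (m - 1 - j)) (C ((S ^^ j) f))) = (S0 h ^^ (Suc m - 1 - j)) (C ((S ^^ j) f))" by simp
      qed
      finally show ?case by (simp add: scaleR_add_right)
    qed simp
    define a where "a j = norm ((S ^^ j) f - T (real j * h) f)" for j
    define E where "E = (1 + 3 * \<tau>) * e'"
    have "a k \<le> E + (h * K) * (\<Sum>j<k. a j)" if k: "k \<le> m" for k
    proof -
      have kh: "real k * h \<le> \<tau>" using m k h(1) by (meson mult_right_mono of_nat_mono order_trans)
      have kh0: "real k * h \<ge> 0" using h by simp
      have jh: "real j * h + h \<le> real k * h" if "j < k" for j
      proof -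
        have "real j + 1 \<le> real k" using that by linarith
        then have "(real j + 1) * h \<le> real k * h" using h(1) by (rule mult_right_mono)
        then show ?thesis by (simp add: algebra_simps)
      qed
      define Z where "Z j = (S0 h ^^ (k - 1 - j)) (g (real j * h))" for j
      define F where "F s = V (real k * h - s) (g s)" for s
      have F_int: "F integrable_on {0..real k * h}"
        unfolding F_def using kh gX by (intro J_integrable continuous_on_subset[OF g_cont]) auto
      have point: "norm (Z j - F s) \<le> 3 * e'" if j: "j < k" and s: "s \<in> {real j * h..real j * h + h}" for j s
      proof -
        define i where "i = k - 1 - j"
        define r where "r = real j * h + h - s"
        have r: "0 \<le> r" "r \<le> h" using s by (auto simp: r_def)
        have "real k = real i + real j + 1" using j by (simp add: i_def)
        then have ks: "real k * h - s = real i * h + r" by (simp only: r_def) (simp add: algebra_simps)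
        have jh0: "real j * h \<ge> 0" using h by simp
        have ih: "real i * h \<le> \<tau>" using kh ks r(1) s jh0 unfolding atLeastAtMost_iff by linarith
        have ih0: "real i * h \<ge> 0" using h by simp
        have s0: "s \<in> {0..\<tau>}" "real j * h \<in> {0..\<tau>}" 
          using s h(1) jh[OF j] kh jh0 unfolding atLeastAtMost_iff by linarith+
        have "F s = V (real i * h) (V r (g s))" unfolding F_def ks using ih0 r s0 gX by (intro V_add) auto
        then have "Z j - F s = ((S0 h ^^ i) (g (real j * h)) - V (real i * h) (g (real j * h)))
           + V (real i * h) ((g (real j * h) - g s) - (V r (g s) - g s))"
          using ih0 by (simp add: V_diff Z_def i_def)
        also have "norm \<dots> \<le> norm ((S0 h ^^ i) (g (real j * h)) - V (real i * h) (g (real j * h)))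
           + norm ((g (real j * h) - g s) - (V r (g s) - g s))"
          by (rule order_trans[OF norm_triangle_ineq add_left_mono[OF V_contr[OF ih0]]])
        also have "\<dots> \<le> e' + (e' + e')"
        proof (rule add_mono[OF _ order_trans[OF norm_triangle_ineq4 add_mono]])
          show "norm ((S0 h ^^ i) (g (real j * h)) - V (real i * h) (g (real j * h))) \<le> e'"
            using d2(2)[of "g (real j * h)" "(h, i)"] s0 h ih by (auto simp: I2_def K'_def d_def)
          show "norm (g (real j * h) - g s) \<le> e'"
            using d4(2)[of "real j * h" s] s0 s h r by (auto simp: dist_norm d_def r_def abs_le_iff)
          show "norm (V r (g s) - g s) \<le> e'"
            using d3(2)[of "g s" r] s0 h r by (auto simp: K'_def d_def)
        qed
        finally show ?thesis by simp
      qed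
      have piece: "norm (h *\<^sub>R Z j - integral {real j * h..real j * h + h} F) \<le> 3 * e' * h" if j: "j < k" for j
      proof -
        have "F integrable_on {real j * h..real j * h + h}"
          by (rule integrable_subinterval_real[OF F_int]) (use jh[OF j] h in auto)
        then have "((\<lambda>s. Z j - F s) has_integral h *\<^sub>R Z j - integral {real j * h..real j * h + h} F) {real j * h..real j * h + h}"
          using has_integral_const_real[of "Z j" "real j * h" "real j * h + h"] h(1) by (intro has_integral_diff) auto
        then have "norm (h *\<^sub>R Z j - integral {real j * h..real j * h + h} F) \<le> 3 * e' * measure lborel {real j * h..real j * h + h}"
          using e' point[OF j] by (intro has_integral_bound_real[where B = "3 * e'"]) auto
        then show ?thesis using h by simp
      qed
      have "(S ^^ k) f - T (real k * h) f = ((S0 h ^^ k) f - V (real k * h) f)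
          + (h *\<^sub>R (\<Sum>j<k. (S0 h ^^ (k - 1 - j)) (C ((S ^^ j) f))) - J (real k * h) g)"
        using discrete_duhamel[of k] Tf(3)[OF kh0] by (simp add: g_def[abs_def])
      also have "J (real k * h) g = (\<Sum>j<k. integral {real j * h..real j * h + h} F)"
        using integral_split_grid[OF F_int h(1)] by (simp add: J_def F_def[abs_def])
      also have "h *\<^sub>R (\<Sum>j<k. (S0 h ^^ (k - 1 - j)) (C ((S ^^ j) f))) - (\<Sum>j<k. integral {real j * h..real j * h + h} F)
         = (\<Sum>j<k. h *\<^sub>R (S0 h ^^ (k - 1 - j)) (C ((S ^^ j) f - T (real j * h) f)) + (h *\<^sub>R Z j - integral {real j * h..real j * h + h} F))"
        using pow_lin[OF h(1)]
        by (simp add: scaleR_sum_right sum_subtractf[symmetric] sum.distrib[symmetric] Z_def g_def C_diff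
            linear_diff bounded_linear.linear scaleR_diff_right)
      finally have "a k \<le> norm ((S0 h ^^ k) f - V (real k * h) f) + norm (\<Sum>j<k. h *\<^sub>R (S0 h ^^ (k - 1 - j)) (C ((S ^^ j) f - T (real j * h) f)) + (h *\<^sub>R Z j - integral {real j * h..real j * h + h} F))"
        by (simp only: a_def norm_triangle_ineq)
      also have "\<dots> \<le> e' + (\<Sum>j<k. h * (K * a j) + 3 * e' * h)"
      proof (rule add_mono[OF _ order_trans[OF norm_sum sum_mono[OF order_trans[OF norm_triangle_ineq add_mono]]]])
        show "norm ((S0 h ^^ k) f - V (real k * h) f) \<le> e'"
          using d1(2)[of h k] h kh by (simp add: d_def)
        show "norm (h *\<^sub>R Z j - integral {real j * h..real j * h + h} F) \<le> 3 * e' * h" if "j \<in> {..<k}" for j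
          using piece that by simp
        fix j assume "j \<in> {..<k}"
        have "norm ((S0 h ^^ (k - 1 - j)) (C ((S ^^ j) f - T (real j * h) f))) \<le> K * a j"
          unfolding a_def by (rule order_trans[OF pow_contr[OF h(1)] C_bound])
        then show "norm (h *\<^sub>R (S0 h ^^ (k - 1 - j)) (C ((S ^^ j) f - T (real j * h) f))) \<le> h * (K * a j)"
          using h(1) by (simp add: mult_left_mono)
      qed
      also have "\<dots> = e' + 3 * e' * (real k * h) + (h * K) * (\<Sum>j<k. a j)"
        by (simp add: sum.distrib sum_distrib_left mult.assoc)
      also have "\<dots> \<le> E + (h * K) * (\<Sum>j<k. a j)"
        using kh e' by (simp add: E_def algebra_simps)
      finally show ?thesis .
    qed
    then have "a m \<le> E * exp (h * K * real m)"
      using h K_nonneg e' \<tau> by (intro discrete_gronwall) (auto simp: E_def)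
    also have "\<dots> \<le> E * exp (K * \<tau>)"
    proof (intro mult_left_mono)
      have "K * (real m * h) \<le> K * \<tau>" using m K_nonneg by (rule mult_left_mono)
      then show "exp (h * K * real m) \<le> exp (K * \<tau>)" by (simp add: algebra_simps)
      show "0 \<le> E" using e' \<tau> by (simp add: E_def)
    qed
    also have "\<dots> = e" using \<tau> by (simp add: E_def e'_def)
    finally show ?thesis by (simp add: a_def S_def)
  qed
  moreover have "d > 0" using d1 d2 d3 d4 by (simp add: d_def)
  ultimately show "\<exists>d>0. \<forall>h m. 0 \<le> h \<and> h < d \<and> real m * h \<le> \<tau> \<longrightarrow>
      norm (((\<lambda>g. S0 h g + h *\<^sub>R C g) ^^ m) f - T (real m * h) f) \<le> e" by blast
qed

end

section \<open>Averages over right translations of the Heisenberg group\<close>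

instance bcontfun :: (metric_space, banach) banach ..

lemma symp_zero [simp]: "symp 0 z = 0" "symp z 0 = 0"
  by (auto simp: symp_def zero_prod_def split: prod.splits)

lemma symp_add_left: "symp (z + w) u = symp z u + symp w u"
  and symp_add_right: "symp u (z + w) = symp u z + symp u w"
  by (cases z; cases w; cases u; simp add: symp_def inner_add_left inner_add_right algebra_simps)+

lemma symp_uminus_right: "symp u (- z) = - symp u z"
  by (cases z; cases u; simp add: symp_def)

lemma symp_scaleR_right: "symp u (a *\<^sub>R z) = a * symp u z"
  by (cases z; cases u; simp add: symp_def algebra_simps)

lemma symp_self [simp]: "symp z z = 0"
  by (cases z; simp add: symp_def inner_commute)

lemma abs_symp_le: "\<bar>symp z w\<bar> \<le> 2 * norm z * norm w"
proof -
  obtain x y x' y' where zw: "z = (x, y)" "w = (x', y')" by (cases z; cases w) auto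
  have "\<bar>symp z w\<bar> \<le> \<bar>x' \<bullet> y\<bar> + \<bar>x \<bullet> y'\<bar>" by (simp add: symp_def zw)
  also have "\<dots> \<le> norm x' * norm y + norm x * norm y'"
    by (intro add_mono Cauchy_Schwarz_ineq2)
  also have "\<dots> \<le> norm w * norm z + norm z * norm w"
    using norm_fst_le[of x y] norm_snd_le[of y x] norm_fst_le[of x' y'] norm_snd_le[of y' x']
    by (intro add_mono mult_mono) (auto simp: zw)
  finally show ?thesis by (simp add: mult.commute)
qed

lemma symp_continuous: "continuous_on S (\<lambda>p. symp (fst p) (snd p))"
  unfolding symp_def case_prod_unfold by (intro continuous_intros)

lemma symp_measurable [measurable]:
  "f \<in> borel_measurable M \<Longrightarrow> g \<in> borel_measurable M \<Longrightarrow> (\<lambda>\<omega>. symp (f \<omega>) (g \<omega>)) \<in> borel_measurable M"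
  by (rule borel_measurable_continuous_Pair[OF _ _ symp_continuous])

lemma heis_mult_assoc: "heis_mult (heis_mult a b) c = heis_mult a (heis_mult b c)"
  by (simp add: heis_mult_def symp_add_left symp_add_right)

lemma heis_mult_0_right [simp]: "heis_mult a 0 = a"
  by (simp add: heis_mult_def)

lemma heis_mult_right_inverse: "heis_mult (heis_mult a b) (- b) = a"
  by (simp add: heis_mult_assoc) (simp add: heis_mult_def symp_uminus_right)

lemma heis_mult_vertical: "heis_mult (z, s) (0, r) = (z, s + r)"
  by (simp add: heis_mult_def)

lemma heis_mult_continuous:
  "continuous_on S f \<Longrightarrow> continuous_on S g \<Longrightarrow> continuous_on S (\<lambda>x. heis_mult (f x) (g x))"
  unfolding heis_mult_def symp_def case_prod_unfold by (intro continuous_intros)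

lemma heis_mult_measurable [measurable]:
  fixes f g :: "'w \<Rightarrow> 'd::finite heis"
  shows "f \<in> borel_measurable M \<Longrightarrow> g \<in> borel_measurable M \<Longrightarrow> (\<lambda>\<omega>. heis_mult (f \<omega>) (g \<omega>)) \<in> borel_measurable M"
  by (rule borel_measurable_continuous_Pair) (auto intro!: heis_mult_continuous continuous_intros)

text \<open>Right translations are not uniformly close to the identity, since the central component moves by
  \<open>symp\<close>; the displacement grows linearly with the base point.\<close>

lemma norm_heis_mult_diff: "norm (heis_mult a b - a) \<le> norm b + 2 * norm a * norm b"
proof -
  have "heis_mult a b - a = b + (0, symp (fst a) (fst b))"
    by (cases a; cases b) (simp add: heis_mult_def)
  then have "norm (heis_mult a b - a) \<le> norm b + \<bar>symp (fst a) (fst b)\<bar>"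
    using norm_triangle_ineq[of b "(0, symp (fst a) (fst b))"] by (simp add: norm_prod_def)
  also have "\<bar>symp (fst a) (fst b)\<bar> \<le> 2 * norm (fst a) * norm (fst b)" by (rule abs_symp_le)
  also have "\<dots> \<le> 2 * norm a * norm b"
    using norm_fst_le[of "fst a" "snd a"] norm_fst_le[of "fst b" "snd b"] by (intro mult_mono) auto
  finally show ?thesis by simp
qed

lemma norm_heis_mult: "norm (heis_mult a b) \<le> norm a + norm b + 2 * norm a * norm b"
  using norm_heis_mult_diff[of a b] norm_triangle_sub[of "heis_mult a b" a] by linarith

lemma norm_le_heis_mult: "norm a \<le> norm (heis_mult a b) * (1 + 2 * norm b) + norm b"
  using norm_heis_mult[of "heis_mult a b" "- b"] by (simp add: heis_mult_right_inverse algebra_simps)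

lemma heis_mult_at_infinity:
  fixes b :: "'d::finite heis"
  shows "filterlim (\<lambda>a. heis_mult a b) at_infinity at_infinity"
  unfolding filterlim_at_infinity[OF order_refl]
proof (intro allI impI)
  fix r :: real
  show "\<forall>\<^sub>F a in at_infinity. r \<le> norm (heis_mult a b)"
    unfolding eventually_at_infinity
  proof (intro exI allI impI)
    fix a :: "'d heis" assume a: "r * (1 + 2 * norm b) + norm b \<le> norm a"
    then have "r * (1 + 2 * norm b) \<le> norm (heis_mult a b) * (1 + 2 * norm b)"
      using norm_le_heis_mult[of a b] by linarith
    moreover have "1 + 2 * norm b > 0" by (simp add: add_pos_nonneg)
    ultimately show "r \<le> norm (heis_mult a b)" by (rule mult_right_le_imp_le)
  qed
qed

lemma subspace_C0: "subspace (C0 :: ('a::real_normed_vector \<Rightarrow>\<^sub>C 'v::real_normed_vector) set)"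
  unfolding subspace_def C0_def
  by (auto intro!: tendsto_eq_intros)

lemma C0_iff: "f \<in> C0 \<longleftrightarrow> (\<forall>e>0. \<exists>b. \<forall>x. norm x \<ge> b \<longrightarrow> norm (apply_bcontfun f x) < e)"
  by (simp add: C0_def tendsto_iff eventually_at_infinity)

lemma closed_C0: "closed (C0 :: ('a::real_normed_vector \<Rightarrow>\<^sub>C 'v::real_normed_vector) set)"
  unfolding closed_sequential_limits
proof (intro allI impI)
  fix u and f :: "'a \<Rightarrow>\<^sub>C 'v" assume u: "(\<forall>n. u n \<in> C0) \<and> u \<longlonglongrightarrow> f"
  show "f \<in> C0"
    unfolding C0_iff
  proof (intro allI impI)
    fix e :: real assume e: "e > 0"
    obtain n where n: "dist (u n) f < e / 2"
      using u e metric_LIMSEQ_D[of u f "e / 2"] by auto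
    obtain b where b: "\<And>x. norm x \<ge> b \<Longrightarrow> norm (u n x) < e / 2"
      using u e C0_iff half_gt_zero by metis
    have "norm (f x) < e" if "norm x \<ge> b" for x
    proof -
      have "norm (f x) \<le> norm (u n x) + dist (u n x) (f x)"
        by (metis dist_norm dist_commute norm_triangle_sub)
      also have "\<dots> < e / 2 + e / 2"
        using b[OF that] n dist_bounded[of "u n" x f] by linarith
      finally show ?thesis by simp
    qed
    then show "\<exists>b. \<forall>x. norm x \<ge> b \<longrightarrow> norm (f x) < e" by blast
  qed
qed

text \<open>Near infinity both values are small, because a small right translation cannot bring a far point
  back; on the remaining ball the displacement is bounded and uniform continuity applies.\<close>

lemma C0_right_translation:
  fixes f :: "'d::finite heis \<Rightarrow>\<^sub>C 'v::real_normed_vector"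
  assumes f: "f \<in> C0" and e: "e > 0"
  obtains d where "d > 0" "\<And>\<xi> \<kappa>. norm \<kappa> < d \<Longrightarrow> norm (f (heis_mult \<xi> \<kappa>) - f \<xi>) < e"
proof -
  obtain b0 where b0: "\<And>x. norm x \<ge> b0 \<Longrightarrow> norm (f x) < e / 2"
    using f e C0_iff half_gt_zero by metis
  define b where "b = max b0 0"
  have b: "b \<ge> 0" "\<And>x. norm x \<ge> b \<Longrightarrow> norm (f x) < e / 2" using b0 by (auto simp: b_def)
  define R where "R = 3 * b + 1"
  have "uniformly_continuous_on (cball 0 (3 * R + 1)) f"
    by (intro compact_uniformly_continuous) auto
  then obtain d where d: "d > 0" "\<And>x x'. x \<in> cball 0 (3 * R + 1) \<Longrightarrow> x' \<in> cball 0 (3 * R + 1) \<Longrightarrow>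
      dist x' x < d \<Longrightarrow> dist (f x') (f x) < e"
    using e unfolding uniformly_continuous_on_def by meson
  define d' where "d' = min 1 (d / (1 + 2 * R))"
  have R: "R \<ge> 1" using b by (simp add: R_def)
  have d': "d' > 0" "d' \<le> 1" using d(1) R by (auto simp: d'_def)
  have "d' * (1 + 2 * R) \<le> d / (1 + 2 * R) * (1 + 2 * R)" using R by (intro mult_right_mono) (auto simp: d'_def)
  then have d'_d: "d' * (1 + 2 * R) \<le> d" using R by simp
  have "norm (f (heis_mult \<xi> \<kappa>) - f \<xi>) < e" if \<kappa>: "norm \<kappa> < d'" for \<xi> \<kappa>
  proof (cases "norm \<xi> \<ge> R")
    case True
    have "R \<le> norm (heis_mult \<xi> \<kappa>) * (1 + 2 * norm \<kappa>) + norm \<kappa>"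
      using True norm_le_heis_mult[of \<xi> \<kappa>] by linarith
    also have "\<dots> \<le> norm (heis_mult \<xi> \<kappa>) * (1 + 2 * 1) + 1"
      using \<kappa> d' by (intro add_mono mult_mono) auto
    finally have "norm (heis_mult \<xi> \<kappa>) \<ge> b" by (simp add: R_def)
    moreover have "norm \<xi> \<ge> b" using True b by (simp add: R_def)
    ultimately have "norm (f (heis_mult \<xi> \<kappa>)) + norm (f \<xi>) < e / 2 + e / 2"
      using b(2) by (intro add_strict_mono) auto
    then show ?thesis using norm_triangle_ineq4[of "f (heis_mult \<xi> \<kappa>)" "f \<xi>"] by linarith
  next
    case False
    have "norm \<kappa> * (1 + 2 * norm \<xi>) < d' * (1 + 2 * R)"
      using \<kappa> False R d' by (intro mult_strict_mono) (auto simp: add_pos_nonneg)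
    then have "dist (heis_mult \<xi> \<kappa>) \<xi> < d"
      using norm_heis_mult_diff[of \<xi> \<kappa>] d'_d by (simp add: dist_norm algebra_simps)
    moreover have "norm (heis_mult \<xi> \<kappa>) \<le> R + 1 + 2 * R * 1"
      using False \<kappa> d' R by (intro order_trans[OF norm_heis_mult] add_mono mult_mono) auto
    ultimately show ?thesis using d(2)[of \<xi> "heis_mult \<xi> \<kappa>"] False R by (simp add: dist_norm)
  qed
  then show ?thesis using that d'(1) by blast
qed

text \<open>Convolution from the right with the law of \<open>Y\<close>. The semigroup of horizontal Brownian motion and the
  Gaussian part of \<open>S(\<tau>)\<close> are both of this form.\<close>

definition right_average ::
  "'w measure \<Rightarrow> ('w \<Rightarrow> 'd::finite heis) \<Rightarrow> ('d heis \<Rightarrow>\<^sub>C 'v::euclidean_space) \<Rightarrow> ('d heis \<Rightarrow>\<^sub>C 'v)" where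
  "right_average N Y f = Bcontfun (\<lambda>\<xi>. \<integral>\<omega>. f (heis_mult \<xi> (Y \<omega>)) \<partial>N)"

lemma bcontfun_measurable [measurable]:
  fixes f :: "'a::topological_space \<Rightarrow>\<^sub>C 'v::real_normed_vector"
  assumes "g \<in> borel_measurable M"
  shows "(\<lambda>\<omega>. apply_bcontfun f (g \<omega>)) \<in> borel_measurable M"
  by (rule measurable_compose[OF assms borel_measurable_continuous_onI]) simp

lemma bcontfun_integrable:
  fixes f :: "'a::topological_space \<Rightarrow>\<^sub>C 'v::euclidean_space"
  assumes "prob_space N" "g \<in> borel_measurable N"
  shows "integrable N (\<lambda>\<omega>. f (g \<omega>))"
proof -
  interpret prob_space N by fact
  show ?thesis
    using assms(2) by (intro integrable_const_bound[of _ "norm f"]) (auto intro: norm_bounded)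
qed

lemma norm_prob_integral_le:
  fixes g :: "'w \<Rightarrow> 'v::euclidean_space"
  assumes "prob_space N" "\<And>\<omega>. \<omega> \<in> space N \<Longrightarrow> norm (g \<omega>) \<le> B" "B \<ge> 0"
  shows "norm (\<integral>\<omega>. g \<omega> \<partial>N) \<le> B"
proof -
  interpret prob_space N by fact
  have "norm (\<integral>\<omega>. g \<omega> \<partial>N) \<le> B * measure N (space N)"
    by (cases "integrable N g")
       (use assms in \<open>auto intro!: integral_norm_bound[THEN order_trans] integral_le_const simp: not_integrable_integral_eq prob_space\<close>)
  then show ?thesis by (simp add: prob_space)
qed

lemma apply_right_average:
  fixes f :: "'d::finite heis \<Rightarrow>\<^sub>C 'v::euclidean_space"
  assumes N: "prob_space N" and Y: "Y \<in> borel_measurable N"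
  shows "apply_bcontfun (right_average N Y f) = (\<lambda>\<xi>. \<integral>\<omega>. f (heis_mult \<xi> (Y \<omega>)) \<partial>N)"
  unfolding right_average_def
proof (intro Bcontfun_inverse bcontfun_normI)
  interpret prob_space N by fact
  note Y [measurable]
  show "continuous_on UNIV (\<lambda>\<xi>. \<integral>\<omega>. f (heis_mult \<xi> (Y \<omega>)) \<partial>N)"
  proof (rule continuous_on_sequentiallyI)
    fix u and a :: "'d heis" assume u: "u \<longlonglongrightarrow> a"
    have c: "continuous_on UNIV (\<lambda>\<xi>. f (heis_mult \<xi> y))" for y
      by (intro continuous_on_compose2[OF continuous_on_apply_bcontfun[of UNIV f]] heis_mult_continuous continuous_intros) auto
    show "(\<lambda>n. \<integral>\<omega>. f (heis_mult (u n) (Y \<omega>)) \<partial>N) \<longlonglongrightarrow> (\<integral>\<omega>. f (heis_mult a (Y \<omega>)) \<partial>N)"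
    proof (rule integral_dominated_convergence[where w = "\<lambda>_. norm f"])
      show "AE \<omega> in N. (\<lambda>n. f (heis_mult (u n) (Y \<omega>))) \<longlonglongrightarrow> f (heis_mult a (Y \<omega>))"
        using continuous_on_tendsto_compose[OF c u] by auto
    qed (auto intro: norm_bounded)
  qed
  show "norm (\<integral>\<omega>. f (heis_mult \<xi> (Y \<omega>)) \<partial>N) \<le> norm f" for \<xi>
    by (intro norm_prob_integral_le N norm_bounded) auto
qed

lemma right_average_bounded_linear:
  fixes Y :: "'w \<Rightarrow> 'd::finite heis"
  assumes N: "prob_space N" and Y: "Y \<in> borel_measurable N"
  shows "bounded_linear (right_average N Y :: ('d heis \<Rightarrow>\<^sub>C 'v::euclidean_space) \<Rightarrow> _)"
    and "norm (right_average N Y f) \<le> norm (f :: 'd heis \<Rightarrow>\<^sub>C 'v)"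
proof -
  note Y [measurable]
  show 1: "norm (right_average N Y f) \<le> norm f" for f :: "'d heis \<Rightarrow>\<^sub>C 'v"
    by (rule norm_bound) (auto simp: apply_right_average[OF N Y] intro: norm_prob_integral_le[OF N] norm_bounded)
  have int: "integrable N (\<lambda>\<omega>. f (heis_mult \<xi> (Y \<omega>)))" for f :: "'d heis \<Rightarrow>\<^sub>C 'v" and \<xi>
    by (intro bcontfun_integrable N) auto
  show "bounded_linear (right_average N Y :: ('d heis \<Rightarrow>\<^sub>C 'v) \<Rightarrow> _)"
    by (rule bounded_linear_intro[where K = 1])
       (auto intro!: bcontfun_eqI simp: apply_right_average[OF N Y] int 1)
qed

lemma right_average_C0:
  fixes Y :: "'w \<Rightarrow> 'd::finite heis" and f :: "'d heis \<Rightarrow>\<^sub>C 'v::euclidean_space"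
  assumes N: "prob_space N" and Y: "Y \<in> borel_measurable N" and f: "f \<in> C0"
  shows "right_average N Y f \<in> C0"
  unfolding C0_iff
proof (rule ccontr)
  interpret prob_space N by fact
  note Y [measurable]
  assume "\<not> (\<forall>e>0. \<exists>b. \<forall>x. b \<le> norm x \<longrightarrow> norm (right_average N Y f x) < e)"
  then obtain e where e: "e > 0" "\<And>b. \<exists>x. b \<le> norm x \<and> norm (right_average N Y f x) \<ge> e"
    by (auto simp: not_less)
  then have "\<forall>n. \<exists>x. real n \<le> norm x \<and> norm (right_average N Y f x) \<ge> e" by blast
  then obtain u where u: "\<And>n. real n \<le> norm (u n)" "\<And>n. norm (right_average N Y f (u n)) \<ge> e" by metis
  have u_inf: "filterlim u at_infinity sequentially"
    by (rule filterlim_norm_at_top_imp_at_infinity,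
        rule filterlim_at_top_mono[OF filterlim_real_sequentially]) (use u(1) in auto)
  have "(\<lambda>n. \<integral>\<omega>. f (heis_mult (u n) (Y \<omega>)) \<partial>N) \<longlonglongrightarrow> (\<integral>\<omega>. 0 \<partial>N)"
  proof (rule integral_dominated_convergence[where w = "\<lambda>_. norm f"])
    have "(\<lambda>n. f (heis_mult (u n) y)) \<longlonglongrightarrow> 0" for y
      using f filterlim_compose[OF filterlim_compose[OF _ heis_mult_at_infinity] u_inf, of f "nhds 0" y]
      by (simp add: C0_def)
    then show "AE \<omega> in N. (\<lambda>n. f (heis_mult (u n) (Y \<omega>))) \<longlonglongrightarrow> 0" by auto
  qed (auto intro: norm_bounded)
  then have "(\<lambda>n. norm (right_average N Y f (u n))) \<longlonglongrightarrow> 0"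
    by (intro tendsto_norm_zero) (simp add: apply_right_average[OF N Y])
  then have "\<forall>\<^sub>F n in sequentially. norm (right_average N Y f (u n)) < e"
    using e(1) by (rule order_tendstoD(2))
  then show False using u(2) by (auto simp: not_less[symmetric] eventually_sequentially)
qed

definition multop :: "('a::topological_space \<Rightarrow>\<^sub>C real) \<Rightarrow> ('a \<Rightarrow>\<^sub>C 'v::real_normed_vector) \<Rightarrow> ('a \<Rightarrow>\<^sub>C 'v)" where
  "multop c f = Bcontfun (\<lambda>x. c x *\<^sub>R f x)"

lemma apply_multop: "apply_bcontfun (multop c f) = (\<lambda>x. c x *\<^sub>R f x)"
  unfolding multop_def
  by (intro Bcontfun_inverse bcontfun_normI[where b = "norm c * norm f"])
     (auto intro!: continuous_intros mult_mono norm_bounded norm_bounded[of c, unfolded real_norm_def])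

lemma norm_multop: "norm (multop c f) \<le> norm c * norm f"
  by (rule norm_bound) (auto simp: apply_multop intro!: mult_mono norm_bounded norm_bounded[of c, unfolded real_norm_def])

lemma multop_bounded_linear: "bounded_linear (multop c)"
  by (rule bounded_linear_intro[where K = "norm c"])
     (auto intro!: bcontfun_eqI simp: apply_multop scaleR_add_right norm_multop mult.commute[of "norm _" "norm c"])

lemma multop_C0:
  assumes "f \<in> C0" shows "multop c f \<in> C0"
proof -
  have "((\<lambda>x. norm c * norm (f x)) \<longlongrightarrow> 0) at_infinity"
    using assms by (intro tendsto_mult_right_zero tendsto_norm_zero) (simp add: C0_def)
  then have "((\<lambda>x. c x *\<^sub>R f x) \<longlongrightarrow> 0) at_infinity"
    by (rule Lim_null_comparison[rotated])
       (auto intro!: always_eventually mult_right_mono norm_bounded[of c, unfolded real_norm_def])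
  then show ?thesis by (simp add: C0_def apply_multop)
qed

section \<open>Increments of the driving Brownian motion\<close>

lemma space_natural_filtration [simp]: "space (natural_filtration M X t) = space M"
  by (simp add: natural_filtration_def space_measure_of_conv)

lemma sets_natural_filtration:
  "sets (natural_filtration M X t) =
    sigma_sets (space M) {X r -` U \<inter> space M | r U. 0 \<le> r \<and> r \<le> t \<and> U \<in> sets borel}"
  unfolding natural_filtration_def by (rule sets_measure_of) auto

lemma natural_filtration_subset:
  fixes X :: "real \<Rightarrow> 'w \<Rightarrow> 'b::topological_space"
  assumes "space N = space M" "\<And>r. 0 \<le> r \<Longrightarrow> r \<le> t \<Longrightarrow> X r \<in> borel_measurable N"
  shows "sets (natural_filtration M X t) \<subseteq> sets N"
  unfolding sets_natural_filtration assms(1)[symmetric]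
proof (rule sets.sigma_sets_subset, clarify)
  fix r and U :: "'b set" assume "0 \<le> r" "r \<le> t" "U \<in> sets borel"
  then show "X r -` U \<inter> space N \<in> sets N" using measurable_sets[OF assms(2)] by blast
qed

lemma natural_filtration_adapted:
  assumes "0 \<le> r" "r \<le> t"
  shows "X r \<in> borel_measurable (natural_filtration M X t)"
  by (rule measurableI) (use assms in \<open>auto simp: sets_natural_filtration intro!: sigma_sets.Basic\<close>)

lemma natural_filtration_mono:
  "s \<le> t \<Longrightarrow> sets (natural_filtration M X s) \<subseteq> sets (natural_filtration M X t)"
  by (rule natural_filtration_subset) (auto intro: natural_filtration_adapted)

lemma sets_mono_measurable:
  assumes "f \<in> borel_measurable N" "sets N \<subseteq> sets N'" "space N = space N'"
  shows "f \<in> borel_measurable N'"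
  using assms measurable_mono[of borel borel N N'] by auto

lemma (in prob_space) indep_set_mono:
  assumes "indep_set A B" "A' \<subseteq> A" "B' \<subseteq> B"
  shows "indep_set A' B'"
proof (rule indep_setI)
  show "A' \<subseteq> events" "B' \<subseteq> events"
    using indep_setD_ev1[OF assms(1)] indep_setD_ev2[OF assms(1)] assms(2,3) by auto
  show "prob (a \<inter> b) = prob a * prob b" if "a \<in> A'" "b \<in> B'" for a b
    using that assms(2,3) by (intro indep_setD[OF assms(1)]) auto
qed

locale two_brownian_motions = prob_space M for M :: "'w measure" +
  fixes B1 B2 :: "real \<Rightarrow> 'w \<Rightarrow> real^'d::finite"
  assumes bm1: "standard_brownian_motion M B1" and bm2: "standard_brownian_motion M B2"
    and indep: "indep_var (\<Pi>\<^sub>M t\<in>{0..}. borel) (\<lambda>\<omega>. \<lambda>t\<in>{0..}. B1 t \<omega>)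
                          (\<Pi>\<^sub>M t\<in>{0..}. borel) (\<lambda>\<omega>. \<lambda>t\<in>{0..}. B2 t \<omega>)"
begin

definition Z :: "real \<Rightarrow> 'w \<Rightarrow> 'd phase" where "Z t \<omega> = (B1 t \<omega>, B2 t \<omega>)"

definition F :: "real \<Rightarrow> 'w measure" where "F = natural_filtration M Z"

lemma B_measurable: "t \<ge> 0 \<Longrightarrow> B1 t \<in> borel_measurable M" "t \<ge> 0 \<Longrightarrow> B2 t \<in> borel_measurable M"
  using bm1 bm2 by (auto simp: standard_brownian_motion_def)

lemma Z_measurable: "t \<ge> 0 \<Longrightarrow> Z t \<in> borel_measurable M"
  unfolding Z_def[abs_def] by (intro borel_measurable_Pair B_measurable)

lemma AE_Z_0: "AE \<omega> in M. Z 0 \<omega> = 0"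
proof -
  have "AE \<omega> in M. B1 0 \<omega> = 0" "AE \<omega> in M. B2 0 \<omega> = 0"
    using bm1 bm2 by (auto simp: standard_brownian_motion_def)
  then show ?thesis by eventually_elim (simp add: Z_def zero_prod_def)
qed

lemma space_F [simp]: "space (F t) = space M"
  by (simp add: F_def)

lemma sets_F: "sets (F t) \<subseteq> events"
  unfolding F_def by (rule natural_filtration_subset) (auto intro: Z_measurable)

lemma F_mono: "s \<le> t \<Longrightarrow> f \<in> borel_measurable (F s) \<Longrightarrow> f \<in> borel_measurable (F t)"
  by (rule sets_mono_measurable[where N = "F s"]) (auto simp: F_def natural_filtration_mono)

lemma F_measurable: "f \<in> borel_measurable (F s) \<Longrightarrow> f \<in> borel_measurable M"
  by (rule sets_mono_measurable[OF _ sets_F]) auto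

lemma Z_adapted: "0 \<le> s \<Longrightarrow> s \<le> t \<Longrightarrow> Z s \<in> borel_measurable (F t)"
  unfolding F_def by (rule natural_filtration_adapted)

text \<open>The \<open>\<sigma>\<close>-algebra generated by a whole path; the independence assumption is about these two
  \<open>\<sigma>\<close>-algebras.\<close>

abbreviation (input) paths :: "(real \<Rightarrow> 'w \<Rightarrow> real^'d) \<Rightarrow> 'w measure" where
  "paths B \<equiv> vimage_algebra (space M) (\<lambda>\<omega>. \<lambda>t\<in>{0..}. B t \<omega>) (\<Pi>\<^sub>M t\<in>{0..}. borel)"

lemma path_in_space: "(\<lambda>\<omega>. \<lambda>t\<in>{0..}. B t \<omega>) \<in> S \<rightarrow> space (\<Pi>\<^sub>M t\<in>{0..}. borel)"
  by (simp add: space_PiM PiE_def)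

lemma paths_measurable:
  fixes B :: "real \<Rightarrow> 'w \<Rightarrow> real^'d"
  shows "t \<ge> 0 \<Longrightarrow> B t \<in> borel_measurable (paths B)"
proof -
  assume t: "t \<ge> 0"
  have "(\<lambda>\<omega>. (\<lambda>t\<in>{0..}. B t \<omega>) t) \<in> borel_measurable (paths B)"
    by (rule measurable_compose[OF measurable_vimage_algebra1[OF path_in_space] measurable_component_singleton])
       (use t in simp)
  then show ?thesis using t by simp
qed

lemma paths_indep:
  assumes "E1 \<in> sets (paths B1)" "E2 \<in> sets (paths B2)"
  shows "prob (E1 \<inter> E2) = prob E1 * prob E2"
proof -
  obtain A1 A2 where A: "A1 \<in> sets (\<Pi>\<^sub>M t\<in>{0..}. borel)" "A2 \<in> sets (\<Pi>\<^sub>M t\<in>{0..}. borel)"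
    "E1 = (\<lambda>\<omega>. \<lambda>t\<in>{0..}. B1 t \<omega>) -` A1 \<inter> space M" "E2 = (\<lambda>\<omega>. \<lambda>t\<in>{0..}. B2 t \<omega>) -` A2 \<inter> space M"
    using assms unfolding sets_vimage_algebra2[OF path_in_space] by blast
  have "E1 \<inter> E2 = (\<lambda>\<omega>. (\<lambda>t\<in>{0..}. B1 t \<omega>, \<lambda>t\<in>{0..}. B2 t \<omega>)) -` (A1 \<times> A2) \<inter> space M"
    unfolding A by auto
  then show ?thesis using indep_varD[OF indep A(1,2)] A(3,4) by simp
qed

lemma paths_events: "sets (paths B1) \<subseteq> events" "sets (paths B2) \<subseteq> events"
proof -
  have *: "sets (paths B) \<subseteq> events"
    if rv: "random_variable (\<Pi>\<^sub>M t\<in>{0..}. borel) (\<lambda>\<omega>. \<lambda>t\<in>{0..}. B t \<omega>)" for B :: "real \<Rightarrow> 'w \<Rightarrow> real^'d"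
    unfolding sets_vimage_algebra2[OF path_in_space] using measurable_sets[OF rv] by blast
  show "sets (paths B1) \<subseteq> events" "sets (paths B2) \<subseteq> events"
    using * indep_var_rv1[OF indep] indep_var_rv2[OF indep] by auto
qed

text \<open>The joint filtration is generated by the intersections \<open>E1 \<inter> E2\<close> of past events of the two motions,
  and increments of the pair by intersections \<open>G1 \<inter> G2\<close>. Events of different motions are independent,
  events \<open>Ei\<close> and \<open>Gi\<close> of the same motion are too, so all four probabilities multiply; both generating
  systems are stable under intersection.\<close>

lemma increment_indep_set:
  assumes st: "0 \<le> s" "s < t"
  shows "indep_set (sets (F s)) {(\<lambda>\<omega>. Z t \<omega> - Z s \<omega>) -` U \<inter> space M | U. U \<in> sets borel}"
proof -
  define N1 where "N1 = natural_filtration M B1 s"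
  define N2 where "N2 = natural_filtration M B2 s"
  define D1 where "D1 = (\<lambda>\<omega>. B1 t \<omega> - B1 s \<omega>)"
  define D2 where "D2 = (\<lambda>\<omega>. B2 t \<omega> - B2 s \<omega>)"
  have sp: "space N1 = space M" "space N2 = space M" by (auto simp: N1_def N2_def)
  have N: "sets N1 \<subseteq> sets (paths B1)" "sets N2 \<subseteq> sets (paths B2)"
    unfolding N1_def N2_def by (rule natural_filtration_subset; auto intro: paths_measurable)+
  have D: "D1 \<in> borel_measurable (paths B1)" "D2 \<in> borel_measurable (paths B2)"
    unfolding D1_def D2_def using st by (intro borel_measurable_diff paths_measurable; simp)+
  have DM: "D1 \<in> borel_measurable M" "D2 \<in> borel_measurable M"
    unfolding D1_def D2_def using st by (intro borel_measurable_diff B_measurable; simp)+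
  have i1: "prob (E \<inter> (D1 -` U \<inter> space M)) = prob E * prob (D1 -` U \<inter> space M)"
    if "E \<in> sets N1" "U \<in> sets borel" for E U
    using bm1 st that unfolding standard_brownian_motion_def N1_def D1_def
    by (intro indep_setD[of "sets (natural_filtration M B1 s)" "{(\<lambda>\<omega>. B1 t \<omega> - B1 s \<omega>) -` U \<inter> space M | U. U \<in> sets borel}"]) auto
  have i2: "prob (E \<inter> (D2 -` U \<inter> space M)) = prob E * prob (D2 -` U \<inter> space M)"
    if "E \<in> sets N2" "U \<in> sets borel" for E U
    using bm2 st that unfolding standard_brownian_motion_def N2_def D2_def
    by (intro indep_setD[of "sets (natural_filtration M B2 s)" "{(\<lambda>\<omega>. B2 t \<omega> - B2 s \<omega>) -` U \<inter> space M | U. U \<in> sets borel}"]) auto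
  define G where "G = {E1 \<inter> E2 | E1 E2. E1 \<in> sets N1 \<and> E2 \<in> sets N2}"
  define H where "H = {(D1 -` U1 \<inter> space M) \<inter> (D2 -` U2 \<inter> space M) | U1 U2. U1 \<in> sets borel \<and> U2 \<in> sets borel}"
  have H_I: "(D1 -` U1 \<inter> space M) \<inter> (D2 -` U2 \<inter> space M) \<in> H" if "U1 \<in> sets borel" "U2 \<in> sets borel" for U1 U2
    unfolding H_def using that by blast
  have G_ev: "G \<subseteq> events"
    unfolding G_def using order_trans[OF N(1) paths_events(1)] order_trans[OF N(2) paths_events(2)] by blast
  have H_ev: "H \<subseteq> events"
    using DM by (auto simp: H_def intro!: sets.Int measurable_sets)
  have "indep_set G H"
  proof (rule indep_setI[OF G_ev H_ev])
    fix a b assume "a \<in> G" "b \<in> H"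
    then obtain E1 E2 U1 U2 where ab: "a = E1 \<inter> E2" "b = (D1 -` U1 \<inter> space M) \<inter> (D2 -` U2 \<inter> space M)"
      and E: "E1 \<in> sets N1" "E2 \<in> sets N2" and U: "U1 \<in> sets borel" "U2 \<in> sets borel"
      by (auto simp: G_def H_def)
    define G1 where "G1 = D1 -` U1 \<inter> space M"
    define G2 where "G2 = D2 -` U2 \<inter> space M"
    have G: "G1 \<in> sets (paths B1)" "G2 \<in> sets (paths B2)"
      using measurable_sets[OF D(1) U(1)] measurable_sets[OF D(2) U(2)] by (auto simp: G1_def G2_def)
    have E': "E1 \<in> sets (paths B1)" "E2 \<in> sets (paths B2)" using E N by auto
    have "prob (a \<inter> b) = prob ((E1 \<inter> G1) \<inter> (E2 \<inter> G2))"
      unfolding ab G1_def G2_def by (rule arg_cong[where f = prob]) auto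
    also have "\<dots> = prob (E1 \<inter> G1) * prob (E2 \<inter> G2)" using G E' by (intro paths_indep) auto
    also have "\<dots> = (prob E1 * prob E2) * (prob G1 * prob G2)"
      using i1[OF E(1) U(1)] i2[OF E(2) U(2)] by (simp add: G1_def G2_def)
    also have "\<dots> = prob a * prob b"
      using paths_indep[OF E'] paths_indep[OF G] by (simp add: ab G1_def G2_def)
    finally show "prob (a \<inter> b) = prob a * prob b" .
  qed
  moreover have "Int_stable G"
  proof (rule Int_stableI)
    fix a b assume "a \<in> G" "b \<in> G"
    then obtain E1 E2 E1' E2' where "a = E1 \<inter> E2" "b = E1' \<inter> E2'"
      "E1 \<in> sets N1" "E2 \<in> sets N2" "E1' \<in> sets N1" "E2' \<in> sets N2" by (auto simp: G_def)
    then show "a \<inter> b \<in> G"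
      unfolding G_def by (intro CollectI exI[of _ "E1 \<inter> E1'"] exI[of _ "E2 \<inter> E2'"]) auto
  qed
  moreover have "Int_stable H"
  proof (rule Int_stableI)
    fix a b assume "a \<in> H" "b \<in> H"
    then obtain U1 U2 U1' U2' where ab: "a = (D1 -` U1 \<inter> space M) \<inter> (D2 -` U2 \<inter> space M)"
      "b = (D1 -` U1' \<inter> space M) \<inter> (D2 -` U2' \<inter> space M)"
      and U: "U1 \<in> sets borel" "U2 \<in> sets borel" "U1' \<in> sets borel" "U2' \<in> sets borel" by (auto simp: H_def)
    have "a \<inter> b = (D1 -` (U1 \<inter> U1') \<inter> space M) \<inter> (D2 -` (U2 \<inter> U2') \<inter> space M)" unfolding ab by auto
    then show "a \<inter> b \<in> H" using H_I[of "U1 \<inter> U1'" "U2 \<inter> U2'"] U by simp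
  qed
  ultimately have *: "indep_set (sigma_sets (space M) G) (sigma_sets (space M) H)"
    by (rule indep_set_sigma_sets)
  have G_pow: "G \<subseteq> Pow (space M)" and H_pow: "H \<subseteq> Pow (space M)"
    using G_ev H_ev sets.sets_into_space by blast+
  have sG: "space (sigma (space M) G) = space M" and sH: "space (sigma (space M) H) = space M"
    by (simp_all add: space_measure_of_conv)
  have top: "space M \<in> sets N1" "space M \<in> sets N2" using sets.top[of N1] sets.top[of N2] sp by auto
  have "E \<in> G" if "E \<in> sets N1" for E
    using that top(2) sets.sets_into_space[OF that] sp unfolding G_def by blast
  then have N1_G: "sets N1 \<subseteq> sets (sigma (space M) G)" using G_pow by (auto intro: sigma_sets.Basic)
  have "E \<in> G" if "E \<in> sets N2" for E
    using that top(1) sets.sets_into_space[OF that] sp unfolding G_def by blast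
  then have N2_G: "sets N2 \<subseteq> sets (sigma (space M) G)" using G_pow by (auto intro: sigma_sets.Basic)
  have "Z r \<in> borel_measurable (sigma (space M) G)" if r: "0 \<le> r" "r \<le> s" for r
    unfolding Z_def[abs_def]
    by (intro borel_measurable_Pair sets_mono_measurable[OF _ N1_G] sets_mono_measurable[OF _ N2_G])
       (auto simp: N1_def N2_def sG intro: natural_filtration_adapted r)
  then have "sets (F s) \<subseteq> sets (sigma (space M) G)"
    unfolding F_def by (intro natural_filtration_subset) (auto simp: space_measure_of_conv)
  then have FG: "sets (F s) \<subseteq> sigma_sets (space M) G" using G_pow by simp
  have "(\<lambda>\<omega>. Z t \<omega> - Z s \<omega>) \<in> borel_measurable (sigma (space M) H)"
  proof -
    have "D1 -` U \<inter> space M \<in> H" "D2 -` U \<inter> space M \<in> H" if "U \<in> sets borel" for U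
      using H_I[OF that, of UNIV] H_I[OF _ that, of UNIV] by (simp_all add: Int_absorb2 Int_commute Int_left_absorb)
    then have "D1 \<in> borel_measurable (sigma (space M) H)" "D2 \<in> borel_measurable (sigma (space M) H)"
      using H_pow by (auto intro!: measurableI sigma_sets.Basic simp: sH)
    then have "(\<lambda>\<omega>. (D1 \<omega>, D2 \<omega>)) \<in> borel_measurable (sigma (space M) H)" by (intro borel_measurable_Pair)
    then show ?thesis by (simp add: Z_def D1_def D2_def)
  qed
  then have HH: "{(\<lambda>\<omega>. Z t \<omega> - Z s \<omega>) -` U \<inter> space M | U. U \<in> sets borel} \<subseteq> sigma_sets (space M) H"
    using H_pow by (auto simp: space_measure_of_conv dest!: measurable_sets)
  show ?thesis by (rule indep_set_mono[OF * FG HH])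
qed

lemma increment_indep_var:
  fixes X :: "'w \<Rightarrow> 'b::topological_space" and \<phi> :: "'d phase \<Rightarrow> 'b"
  assumes st: "0 \<le> s" "s < t" and X: "X \<in> borel_measurable (F s)" and \<phi>: "\<phi> \<in> borel_measurable borel"
  shows "indep_var borel X borel (\<lambda>\<omega>. \<phi> (Z t \<omega> - Z s \<omega>))"
  unfolding indep_var_eq
proof (intro conjI)
  define D where "D \<omega> = Z t \<omega> - Z s \<omega>" for \<omega>
  define H where "H = {D -` U \<inter> space M | U. U \<in> sets borel}"
  show "X \<in> borel_measurable M" using X by (rule F_measurable)
  have D: "D \<in> borel_measurable M"
    unfolding D_def using st by (intro borel_measurable_diff Z_measurable) auto
  then show "(\<lambda>\<omega>. \<phi> (Z t \<omega> - Z s \<omega>)) \<in> borel_measurable M"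
    using measurable_compose[OF D \<phi>] by (simp add: D_def)
  have "Int_stable H"
  proof (rule Int_stableI)
    fix a b assume "a \<in> H" "b \<in> H"
    then obtain U U' where "a = D -` U \<inter> space M" "b = D -` U' \<inter> space M" "U \<in> sets borel" "U' \<in> sets borel"
      unfolding H_def by blast
    then show "a \<inter> b \<in> H" unfolding H_def by (intro CollectI exI[of _ "U \<inter> U'"]) auto
  qed
  then have "indep_set (sigma_sets (space M) (sets (F s))) (sigma_sets (space M) H)"
    using increment_indep_set[OF st] unfolding H_def D_def
    by (intro indep_set_sigma_sets) (auto intro!: Int_stableI)
  moreover have "sigma_sets (space M) {X -` A \<inter> space M | A. A \<in> sets borel} \<subseteq> sigma_sets (space M) (sets (F s))"
    using measurable_sets[OF X] by (intro sigma_sets_mono') auto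
  moreover have "sigma_sets (space M) {(\<lambda>\<omega>. \<phi> (Z t \<omega> - Z s \<omega>)) -` A \<inter> space M | A. A \<in> sets borel} \<subseteq> sigma_sets (space M) H"
  proof (rule sigma_sets_mono', safe)
    fix A :: "'b set" assume "A \<in> sets borel"
    then have "\<phi> -` A \<in> sets borel" using measurable_sets[OF \<phi>] by simp
    moreover have "(\<lambda>\<omega>. \<phi> (Z t \<omega> - Z s \<omega>)) -` A \<inter> space M = D -` (\<phi> -` A) \<inter> space M" by (auto simp: D_def)
    ultimately show "(\<lambda>\<omega>. \<phi> (Z t \<omega> - Z s \<omega>)) -` A \<inter> space M \<in> H" unfolding H_def by blast
  qed
  ultimately show "indep_set (sigma_sets (space M) {X -` A \<inter> space M | A. A \<in> sets borel})
      (sigma_sets (space M) {(\<lambda>\<omega>. \<phi> (Z t \<omega> - Z s \<omega>)) -` A \<inter> space M | A. A \<in> sets borel})"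
    by (rule indep_set_mono)
qed

end

subsection \<open>The Gaussian law of the increments\<close>

lemma prod_normal_density:
  fixes x :: "real^'d::finite"
  assumes "h > 0"
  shows "(\<Prod>i\<in>UNIV. ennreal (normal_density 0 (sqrt h) (x $ i)))
    = ennreal (exp (- (norm x)\<^sup>2 / (2 * h)) / sqrt (2 * pi * h) ^ CARD('d))"
proof -
  have "(\<Prod>i\<in>UNIV. ennreal (normal_density 0 (sqrt h) (x $ i)))
      = ennreal (\<Prod>i\<in>UNIV. normal_density 0 (sqrt h) (x $ i))"
    by (intro prod_ennreal) simp
  also have "(\<Prod>i\<in>UNIV. normal_density 0 (sqrt h) (x $ i))
      = (\<Prod>i\<in>(UNIV::'d set). 1 / sqrt (2 * pi * h)) * (\<Prod>i\<in>UNIV. exp (- (x $ i)\<^sup>2 / (2 * h)))"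
    unfolding prod.distrib[symmetric] using assms by (intro prod.cong) (simp_all add: normal_density_def)
  also have "(\<Prod>i\<in>UNIV. exp (- (x $ i)\<^sup>2 / (2 * h))) = exp (\<Sum>i\<in>UNIV. - (x $ i)\<^sup>2 / (2 * h))"
    by (simp add: exp_sum)
  also have "(\<Sum>i\<in>UNIV. - (x $ i)\<^sup>2 / (2 * h)) = - (norm x)\<^sup>2 / (2 * h)"
    by (simp add: sum_divide_distrib[symmetric] sum_negf norm_vec_def L2_set_def sum_nonneg)
  finally show ?thesis by (simp add: power_one_over)
qed

lemma gauss_scaled:
  fixes h :: real
  assumes h: "h > 0"
  shows "distr gauss borel (\<lambda>\<zeta>. sqrt h *\<^sub>R \<zeta>) =
    density lborel (\<lambda>\<zeta> :: 'd::finite phase. ennreal (exp (- (norm \<zeta>)\<^sup>2 / (2 * h)) / (2 * pi * h) ^ CARD('d)))"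
proof (rule measure_eqI)
  fix A assume "A \<in> sets (distr (gauss :: 'd phase measure) borel (\<lambda>\<zeta>. sqrt h *\<^sub>R \<zeta>))"
  then have A [measurable]: "A \<in> sets borel" by simp
  define p where "p c \<zeta> = ennreal (exp (- (norm \<zeta>)\<^sup>2 / (2 * c)) / (2 * pi * c) ^ CARD('d))" for c and \<zeta> :: "'d phase"
  have [measurable]: "p c \<in> borel_measurable borel" for c
    unfolding p_def by measurable
  have gauss: "gauss = density lborel (p 1)" by (simp add: gauss_def p_def[abs_def])
  have dim: "DIM('d phase) = 2 * CARD('d)" by simp
  have "emeasure (density lborel (p h)) A = (\<integral>\<^sup>+ \<zeta>. p h \<zeta> * indicator A \<zeta> \<partial>lborel)"
    by (simp add: emeasure_density)
  also have "\<dots> = (\<integral>\<^sup>+ \<zeta>. p h \<zeta> * indicator A \<zeta>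
      \<partial>(density (distr lborel borel (\<lambda>x. 0 + sqrt h *\<^sub>R x)) (\<lambda>_. \<bar>sqrt h\<bar> ^ DIM('d phase))))"
    using h by (subst lborel_affine[symmetric]) auto
  also have "\<dots> = (\<integral>\<^sup>+ \<zeta>. ennreal (\<bar>sqrt h\<bar> ^ DIM('d phase)) * (p h (sqrt h *\<^sub>R \<zeta>) * indicator A (sqrt h *\<^sub>R \<zeta>)) \<partial>lborel)"
    by (subst nn_integral_density) (auto simp: nn_integral_distr)
  also have "\<dots> = (\<integral>\<^sup>+ \<zeta>. p 1 \<zeta> * indicator A (sqrt h *\<^sub>R \<zeta>) \<partial>lborel)"
  proof (intro nn_integral_cong)
    fix \<zeta> :: "'d phase"
    have "ennreal (\<bar>sqrt h\<bar> ^ DIM('d phase)) * p h (sqrt h *\<^sub>R \<zeta>) = p 1 \<zeta>"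
      unfolding p_def using h
      by (simp add: ennreal_mult'[symmetric] dim power_mult power_mult_distrib del: DIM_prod)
    then show "ennreal (\<bar>sqrt h\<bar> ^ DIM('d phase)) * (p h (sqrt h *\<^sub>R \<zeta>) * indicator A (sqrt h *\<^sub>R \<zeta>)) =
      p 1 \<zeta> * indicator A (sqrt h *\<^sub>R \<zeta>)" by (metis mult.assoc)
  qed
  also have "\<dots> = emeasure (distr gauss borel (\<lambda>\<zeta>. sqrt h *\<^sub>R \<zeta>)) A"
    unfolding gauss
    using measurable_sets_borel[of "\<lambda>\<zeta>. sqrt h *\<^sub>R \<zeta>" borel A]
    by (subst emeasure_distr, simp, simp, subst emeasure_density) (auto intro!: nn_integral_cong split: split_indicator)
  finally show "emeasure (distr gauss borel (\<lambda>\<zeta>. sqrt h *\<^sub>R \<zeta>)) A =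
    emeasure (density lborel (\<lambda>\<zeta>. ennreal (exp (- (norm \<zeta>)\<^sup>2 / (2 * h)) / (2 * pi * h) ^ CARD('d)))) A"
    by (simp add: p_def[abs_def])
qed simp

context two_brownian_motions
begin

lemma distr_increment:
  assumes st: "0 \<le> s" "s < t"
  shows "distr M borel (\<lambda>\<omega>. Z t \<omega> - Z s \<omega>) = distr gauss borel (\<lambda>\<zeta>. sqrt (t - s) *\<^sub>R \<zeta>)"
proof -
  define h where "h = t - s"
  have h: "h > 0" using st by (simp add: h_def)
  define g where "g x = (\<Prod>i\<in>UNIV. ennreal (normal_density 0 (sqrt h) (x $ i)))" for x :: "real^'d"
  have d: "distributed M lborel (\<lambda>\<omega>. B1 t \<omega> - B1 s \<omega>) g" "distributed M lborel (\<lambda>\<omega>. B2 t \<omega> - B2 s \<omega>) g"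
    using bm1 bm2 st unfolding standard_brownian_motion_def g_def[abs_def] h_def by auto
  have i: "indep_var lborel (\<lambda>\<omega>. B1 t \<omega> - B1 s \<omega>) lborel (\<lambda>\<omega>. B2 t \<omega> - B2 s \<omega>)"
  proof -
    have m: "(\<lambda>f. f t - f s) \<in> measurable (\<Pi>\<^sub>M t\<in>{0..}. borel) (lborel :: (real^'d) measure)"
      unfolding measurable_cong_sets[OF refl sets_lborel]
      using st by (intro borel_measurable_diff measurable_component_singleton) auto
    have "indep_var lborel ((\<lambda>f. f t - f s) \<circ> (\<lambda>\<omega>. \<lambda>t\<in>{0..}. B1 t \<omega>)) lborel ((\<lambda>f. f t - f s) \<circ> (\<lambda>\<omega>. \<lambda>t\<in>{0..}. B2 t \<omega>))"
      by (rule indep_var_compose[OF indep m m])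
    then show ?thesis using st by (simp add: o_def)
  qed
  have "distributed M (lborel \<Otimes>\<^sub>M lborel) (\<lambda>\<omega>. (B1 t \<omega> - B1 s \<omega>, B2 t \<omega> - B2 s \<omega>)) (\<lambda>(x, y). g x * g y)"
    by (rule distributed_joint_indep[OF _ _ d i]) unfold_locales
  then have "distr M lborel (\<lambda>\<omega>. Z t \<omega> - Z s \<omega>) = density lborel (\<lambda>(x, y). g x * g y)"
    unfolding distributed_def lborel_prod by (simp add: Z_def)
  moreover have "(\<lambda>(x, y). g x * g y) = (\<lambda>\<zeta>. ennreal (exp (- (norm \<zeta>)\<^sup>2 / (2 * h)) / (2 * pi * h) ^ CARD('d)))"
  proof (intro ext, clarify)
    fix x y :: "real^'d"
    have "g x * g y = ennreal (exp (- (norm x)\<^sup>2 / (2 * h)) / sqrt (2 * pi * h) ^ CARD('d) *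
       (exp (- (norm y)\<^sup>2 / (2 * h)) / sqrt (2 * pi * h) ^ CARD('d)))"
      unfolding g_def prod_normal_density[OF h] using h by (subst ennreal_mult) auto
    also have "exp (- (norm x)\<^sup>2 / (2 * h)) / sqrt (2 * pi * h) ^ CARD('d) *
       (exp (- (norm y)\<^sup>2 / (2 * h)) / sqrt (2 * pi * h) ^ CARD('d))
      = exp (- (norm x)\<^sup>2 / (2 * h) + - (norm y)\<^sup>2 / (2 * h)) / (sqrt (2 * pi * h) * sqrt (2 * pi * h)) ^ CARD('d)"
      by (simp only: exp_add power_mult_distrib times_divide_times_eq)
    also have "- (norm x)\<^sup>2 / (2 * h) + - (norm y)\<^sup>2 / (2 * h) = - (norm (x, y))\<^sup>2 / (2 * h)"
      by (simp add: norm_Pair diff_divide_distrib)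
    also have "sqrt (2 * pi * h) * sqrt (2 * pi * h) = 2 * pi * h" using h by simp
    finally show "g x * g y = ennreal (exp (- (norm (x, y))\<^sup>2 / (2 * h)) / (2 * pi * h) ^ CARD('d))" .
  qed
  moreover have "distr M borel (\<lambda>\<omega>. Z t \<omega> - Z s \<omega>) = distr M lborel (\<lambda>\<omega>. Z t \<omega> - Z s \<omega>)"
    by (rule distr_cong) auto
  ultimately show ?thesis using gauss_scaled[OF h, where 'd = 'd] by (simp add: h_def)
qed

text \<open>The total mass of the Gaussian density is read off from the law of \<open>Z 1 - Z 0\<close>.\<close>

lemma prob_space_gauss: "prob_space (gauss :: 'd phase measure)"
proof -
  have "prob_space (distr M borel (\<lambda>\<omega>. Z 1 \<omega> - Z 0 \<omega>))"
    by (rule prob_space_distr) (intro borel_measurable_diff Z_measurable; simp)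
  then have "prob_space (distr (gauss :: 'd phase measure) borel (\<lambda>\<zeta>. \<zeta>))"
    using distr_increment[of 0 1] by simp
  moreover have "distr (gauss :: 'd phase measure) borel (\<lambda>\<zeta>. \<zeta>) = distr gauss gauss (\<lambda>\<zeta>. \<zeta>)"
    by (rule distr_cong) (auto simp: gauss_def)
  ultimately show ?thesis by simp
qed

text \<open>Since \<open>u \<le> exp u\<close>, the density times \<open>(norm \<zeta>)\<^sup>2\<close> is dominated by a multiple of the density of variance
  \<open>2\<close>, which has mass one.\<close>

lemma gauss_second_moment: "integrable (gauss :: 'd phase measure) (\<lambda>\<zeta>. (norm \<zeta>)\<^sup>2)"
proof (rule integrableI_bounded)
  define p where "p c \<zeta> = exp (- (norm \<zeta>)\<^sup>2 / (2 * c)) / (2 * pi * c) ^ CARD('d)" for c and \<zeta> :: "'d phase"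
  have [measurable]: "p c \<in> borel_measurable borel" for c unfolding p_def by measurable
  have p_nonneg: "p 1 \<zeta> \<ge> 0" for \<zeta> by (simp add: p_def)
  have p1: "gauss = density lborel (\<lambda>\<zeta>. ennreal (p 1 \<zeta>))" by (simp add: gauss_def p_def)
  show "(\<lambda>\<zeta>. (norm \<zeta>)\<^sup>2) \<in> borel_measurable (gauss :: 'd phase measure)" by (simp add: gauss_def)
  have "(\<integral>\<^sup>+ \<zeta>. ennreal (p 2 \<zeta>) \<partial>lborel) = emeasure (density lborel (\<lambda>\<zeta>. ennreal (p 2 \<zeta>))) UNIV"
    by (subst emeasure_density) auto
  also have "\<dots> = emeasure (distr (gauss :: 'd phase measure) borel (\<lambda>\<zeta>. sqrt 2 *\<^sub>R \<zeta>)) UNIV"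
    unfolding p_def by (subst gauss_scaled[of 2, symmetric]) auto
  also have "\<dots> = emeasure (gauss :: 'd phase measure) (space gauss)"
    by (subst emeasure_distr) (auto simp: gauss_def)
  also have "\<dots> = 1" by (rule prob_space.emeasure_space_1[OF prob_space_gauss])
  finally have p2: "(\<integral>\<^sup>+ \<zeta>. ennreal (p 2 \<zeta>) \<partial>lborel) = 1" .
  have le: "p 1 \<zeta> * (norm \<zeta>)\<^sup>2 \<le> 4 * 2 ^ CARD('d) * p 2 \<zeta>" for \<zeta> :: "'d phase"
  proof -
    define u where "u = (norm \<zeta>)\<^sup>2 / 4"
    have "u \<le> exp u" using exp_ge_add_one_self[of u] by linarith
    then have "exp (- 2 * u) * (4 * u) \<le> exp (- 2 * u) * (4 * exp u)" by (intro mult_left_mono) auto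
    also have "\<dots> = 4 * exp (- u)" by (simp add: exp_minus field_simps flip: exp_add)
    finally have "exp (- 2 * u) * (4 * u) / (2 * pi) ^ CARD('d) \<le> 4 * exp (- u) / (2 * pi) ^ CARD('d)"
      by (intro divide_right_mono) auto
    moreover have "4 * exp (- u) / (2 * pi) ^ CARD('d) = 4 * 2 ^ CARD('d) * p 2 \<zeta>"
      using power_mult_distrib[of "2::real" 2 "CARD('d)"] by (simp add: p_def u_def power_mult_distrib)
    moreover have "exp (- 2 * u) * (4 * u) / (2 * pi) ^ CARD('d) = p 1 \<zeta> * (norm \<zeta>)\<^sup>2"
      by (simp add: p_def u_def)
    ultimately show ?thesis by simp
  qed
  have "(\<integral>\<^sup>+ \<zeta>. ennreal (norm ((norm \<zeta>)\<^sup>2)) \<partial>(gauss :: 'd phase measure)) = (\<integral>\<^sup>+ \<zeta>. ennreal (p 1 \<zeta> * (norm \<zeta>)\<^sup>2) \<partial>lborel)"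
    unfolding p1 by (subst nn_integral_density) (auto simp: ennreal_mult p_nonneg)
  also have "\<dots> \<le> (\<integral>\<^sup>+ \<zeta>. ennreal (4 * 2 ^ CARD('d)) * ennreal (p 2 \<zeta>) \<partial>lborel)"
    using le by (intro nn_integral_mono) (auto simp: p_def simp flip: ennreal_mult intro!: ennreal_leI)
  also have "\<dots> = ennreal (4 * 2 ^ CARD('d))" by (subst nn_integral_cmult) (auto simp: p2)
  also have "\<dots> < \<infinity>" by simp
  finally show "(\<integral>\<^sup>+ \<zeta>. ennreal (norm ((norm \<zeta>)\<^sup>2)) \<partial>(gauss :: 'd phase measure)) < \<infinity>" .
qed

end

section \<open>The Ito isometry\<close>

lemma integrable_mult_square:
  fixes f g :: "'w \<Rightarrow> real"
  assumes [measurable]: "f \<in> borel_measurable M" "g \<in> borel_measurable M"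
    and "integrable M (\<lambda>\<omega>. (f \<omega>)\<^sup>2)" "integrable M (\<lambda>\<omega>. (g \<omega>)\<^sup>2)"
  shows "integrable M (\<lambda>\<omega>. f \<omega> * g \<omega>)"
proof (rule Bochner_Integration.integrable_bound)
  show "integrable M (\<lambda>\<omega>. (f \<omega>)\<^sup>2 + (g \<omega>)\<^sup>2)" using assms by simp
  show "AE \<omega> in M. norm (f \<omega> * g \<omega>) \<le> norm ((f \<omega>)\<^sup>2 + (g \<omega>)\<^sup>2)"
  proof (rule AE_I2)
    fix \<omega>
    have "2 * (\<bar>f \<omega>\<bar> * \<bar>g \<omega>\<bar>) \<le> \<bar>f \<omega>\<bar>\<^sup>2 + \<bar>g \<omega>\<bar>\<^sup>2" using sum_squares_bound[of "\<bar>f \<omega>\<bar>" "\<bar>g \<omega>\<bar>"] by simp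
    moreover have "0 \<le> \<bar>f \<omega>\<bar> * \<bar>g \<omega>\<bar>" by simp
    ultimately have "\<bar>f \<omega>\<bar> * \<bar>g \<omega>\<bar> \<le> \<bar>f \<omega>\<bar>\<^sup>2 + \<bar>g \<omega>\<bar>\<^sup>2" by linarith
    then show "norm (f \<omega> * g \<omega>) \<le> norm ((f \<omega>)\<^sup>2 + (g \<omega>)\<^sup>2)" by (simp add: abs_mult)
  qed
qed simp

lemma gauss_odd_integral:
  fixes l :: "'d::finite phase \<Rightarrow> real"
  assumes [measurable]: "l \<in> borel_measurable borel" and odd: "\<And>\<zeta>. l (- \<zeta>) = - l \<zeta>"
  shows "(\<integral>\<zeta>. l \<zeta> \<partial>gauss) = 0"
proof -
  define p where "p \<zeta> = exp (- (norm \<zeta>)\<^sup>2 / 2) / (2 * pi) ^ CARD('d)" for \<zeta> :: "'d phase"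
  have [measurable]: "p \<in> borel_measurable borel" unfolding p_def by measurable
  have g: "gauss = density lborel (\<lambda>\<zeta>. ennreal (p \<zeta>))" by (simp add: gauss_def p_def)
  have "(\<integral>\<zeta>. l \<zeta> \<partial>gauss) = (\<integral>\<zeta>. p \<zeta> * l \<zeta> \<partial>lborel)"
    unfolding g by (subst integral_density) (auto simp: p_def)
  also have "\<dots> = (\<integral>\<zeta>. p \<zeta> * l \<zeta> \<partial>(distr lborel borel uminus))"
    using lborel_affine[of "-1" "0 :: 'd phase"] by (simp add: density_1)
  also have "\<dots> = (\<integral>\<zeta>. - (p \<zeta> * l \<zeta>) \<partial>lborel)"
    by (subst integral_distr) (auto simp: p_def odd)
  also have "\<dots> = - (\<integral>\<zeta>. p \<zeta> * l \<zeta> \<partial>lborel)" by simp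
  also have "(\<integral>\<zeta>. p \<zeta> * l \<zeta> \<partial>lborel) = (\<integral>\<zeta>. l \<zeta> \<partial>gauss)"
    unfolding g by (subst integral_density) (auto simp: p_def)
  finally show ?thesis by simp
qed

definition gauss_variance :: "('d::finite phase \<Rightarrow> real) \<Rightarrow> real" where
  "gauss_variance l = (\<integral>\<zeta>. (l \<zeta>)\<^sup>2 \<partial>gauss)"

lemma gauss_variance_nonneg: "gauss_variance l \<ge> 0"
  unfolding gauss_variance_def by (rule Bochner_Integration.integral_nonneg) simp

context two_brownian_motions
begin

lemma gauss_square_integrable:
  fixes l :: "'d phase \<Rightarrow> real"
  assumes l: "bounded_linear l"
  shows "integrable gauss (\<lambda>\<zeta>. (l \<zeta>)\<^sup>2)" and "integrable gauss l"
proof -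
  interpret G: prob_space "gauss :: 'd phase measure" by (rule prob_space_gauss)
  have [measurable]: "l \<in> borel_measurable borel"
    by (intro borel_measurable_continuous_onI linear_continuous_on l)
  have [measurable]: "l \<in> borel_measurable gauss" by (simp add: gauss_def)
  obtain K where K: "\<And>\<zeta>. norm (l \<zeta>) \<le> norm \<zeta> * K" using bounded_linear.bounded[OF l] by blast
  show 1: "integrable gauss (\<lambda>\<zeta>. (l \<zeta>)\<^sup>2)"
  proof (rule Bochner_Integration.integrable_bound)
    show "integrable (gauss :: 'd phase measure) (\<lambda>\<zeta>. K\<^sup>2 * (norm \<zeta>)\<^sup>2)" using gauss_second_moment by simp
    show "AE \<zeta> in gauss. norm ((l \<zeta>)\<^sup>2) \<le> norm (K\<^sup>2 * (norm \<zeta>)\<^sup>2)"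
    proof (rule AE_I2)
      fix \<zeta> :: "'d phase"
      have "\<bar>l \<zeta>\<bar>\<^sup>2 \<le> (norm \<zeta> * K)\<^sup>2" using K[of \<zeta>] by (intro power_mono) auto
      then show "norm ((l \<zeta>)\<^sup>2) \<le> norm (K\<^sup>2 * (norm \<zeta>)\<^sup>2)" by (simp add: power_mult_distrib mult.commute)
    qed
  qed simp
  have "integrable gauss (\<lambda>\<zeta>. l \<zeta> * 1)" using 1 by (intro integrable_mult_square) auto
  then show "integrable gauss l" by simp
qed

lemma increment_moments:
  fixes l :: "'d phase \<Rightarrow> real"
  assumes l: "bounded_linear l" and st: "0 \<le> s" "s \<le> t"
  shows "integrable M (\<lambda>\<omega>. l (Z t \<omega> - Z s \<omega>))" "expectation (\<lambda>\<omega>. l (Z t \<omega> - Z s \<omega>)) = 0"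
    and "integrable M (\<lambda>\<omega>. (l (Z t \<omega> - Z s \<omega>))\<^sup>2)"
    and "expectation (\<lambda>\<omega>. (l (Z t \<omega> - Z s \<omega>))\<^sup>2) = gauss_variance l * (t - s)"
proof -
  have l0: "l 0 = 0" and lmu: "l (- \<zeta>) = - l \<zeta>" and ls: "l (a *\<^sub>R \<zeta>) = a * l \<zeta>" for a \<zeta>
    using bounded_linear.linear[OF l] by (simp_all add: linear_0 linear_neg linear_cmul)
  have [measurable]: "l \<in> borel_measurable borel"
    by (intro borel_measurable_continuous_onI linear_continuous_on l)
  have D [measurable]: "(\<lambda>\<omega>. Z t \<omega> - Z s \<omega>) \<in> borel_measurable M"
    using st by (intro borel_measurable_diff Z_measurable) auto
  have m [measurable]: "(\<lambda>\<zeta>. sqrt (t - s) *\<^sub>R \<zeta>) \<in> borel_measurable (gauss :: 'd phase measure)"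
    by (simp add: gauss_def)
  have tr: "integrable M (\<lambda>\<omega>. \<phi> (Z t \<omega> - Z s \<omega>)) \<longleftrightarrow> integrable gauss (\<lambda>\<zeta>. \<phi> (sqrt (t - s) *\<^sub>R \<zeta>))"
    "expectation (\<lambda>\<omega>. \<phi> (Z t \<omega> - Z s \<omega>)) = (\<integral>\<zeta>. \<phi> (sqrt (t - s) *\<^sub>R \<zeta>) \<partial>gauss)"
    if \<phi> [measurable]: "\<phi> \<in> borel_measurable borel" and st: "s < t" for \<phi> :: "'d phase \<Rightarrow> real"
    using integrable_distr_eq[OF D \<phi>] integrable_distr_eq[OF m \<phi>] integral_distr[OF D \<phi>] integral_distr[OF m \<phi>]
      distr_increment[OF assms(2) st] by auto
  note sq = gauss_square_integrable[OF l]
  show "integrable M (\<lambda>\<omega>. l (Z t \<omega> - Z s \<omega>))"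
    using tr(1)[of l] sq st by (cases "s = t") (auto simp: l0 ls)
  show "expectation (\<lambda>\<omega>. l (Z t \<omega> - Z s \<omega>)) = 0"
    using tr(2)[of l] gauss_odd_integral[of l] lmu st by (cases "s = t") (auto simp: l0 ls)
  show "integrable M (\<lambda>\<omega>. (l (Z t \<omega> - Z s \<omega>))\<^sup>2)"
    using tr(1)[of "\<lambda>\<zeta>. (l \<zeta>)\<^sup>2"] sq st by (cases "s = t") (auto simp: l0 ls power_mult_distrib)
  show "expectation (\<lambda>\<omega>. (l (Z t \<omega> - Z s \<omega>))\<^sup>2) = gauss_variance l * (t - s)"
    using tr(2)[of "\<lambda>\<zeta>. (l \<zeta>)\<^sup>2"] st
    by (cases "s = t") (auto simp: l0 ls power_mult_distrib gauss_variance_def)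
qed

text \<open>\<open>l (Z t - Z s)\<close> is independent of the past up to \<open>s\<close>, centred, and has variance proportional to
  \<open>t - s\<close>.\<close>

lemma expectation_times_increment:
  fixes X :: "'w \<Rightarrow> real"
  assumes l: "bounded_linear l" and st: "0 \<le> s" "s \<le> t"
    and X: "X \<in> borel_measurable (F s)" "integrable M X"
  shows "integrable M (\<lambda>\<omega>. X \<omega> * l (Z t \<omega> - Z s \<omega>))" "expectation (\<lambda>\<omega>. X \<omega> * l (Z t \<omega> - Z s \<omega>)) = 0"
    and "integrable M (\<lambda>\<omega>. X \<omega> * (l (Z t \<omega> - Z s \<omega>))\<^sup>2)"
    and "expectation (\<lambda>\<omega>. X \<omega> * (l (Z t \<omega> - Z s \<omega>))\<^sup>2) = gauss_variance l * expectation X * (t - s)"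
proof -
  have l0: "l 0 = 0" using bounded_linear.linear[OF l] by (rule linear_0)
  have lm [measurable]: "l \<in> borel_measurable borel"
    by (intro borel_measurable_continuous_onI linear_continuous_on l)
  note mom = increment_moments[OF l st]
  have i: "indep_var borel X borel (\<lambda>\<omega>. l (Z t \<omega> - Z s \<omega>))" if "s < t"
    by (rule increment_indep_var[OF st(1) that X(1) lm])
  have i2: "indep_var borel X borel (\<lambda>\<omega>. (l (Z t \<omega> - Z s \<omega>))\<^sup>2)" if "s < t"
    by (rule increment_indep_var[OF st(1) that X(1)]) measurable
  show "integrable M (\<lambda>\<omega>. X \<omega> * l (Z t \<omega> - Z s \<omega>))"
    using indep_var_integrable[OF i X(2) mom(1)] st by (cases "s = t") (auto simp: l0)
  show "expectation (\<lambda>\<omega>. X \<omega> * l (Z t \<omega> - Z s \<omega>)) = 0"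
    using indep_var_lebesgue_integral[OF i X(2) mom(1)] mom(2) st by (cases "s = t") (auto simp: l0)
  show "integrable M (\<lambda>\<omega>. X \<omega> * (l (Z t \<omega> - Z s \<omega>))\<^sup>2)"
    using indep_var_integrable[OF i2 X(2) mom(3)] st by (cases "s = t") (auto simp: l0)
  show "expectation (\<lambda>\<omega>. X \<omega> * (l (Z t \<omega> - Z s \<omega>))\<^sup>2) = gauss_variance l * expectation X * (t - s)"
    using indep_var_lebesgue_integral[OF i2 X(2) mom(3)] mom(4) st by (cases "s = t") (auto simp: l0)
qed

definition incr :: "('d phase \<Rightarrow> real) \<Rightarrow> real \<Rightarrow> real \<Rightarrow> 'w \<Rightarrow> real" where
  "incr l a b \<omega> = l (Z b \<omega>) - l (Z a \<omega>)"

lemma incr_alt: "bounded_linear l \<Longrightarrow> incr l a b \<omega> = l (Z b \<omega> - Z a \<omega>)"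
  by (simp add: incr_def linear_diff bounded_linear.linear)

lemma incr_same [simp]: "incr l a a \<omega> = 0"
  by (simp add: incr_def)

lemma functional_adapted:
  fixes l :: "'d phase \<Rightarrow> real"
  assumes "bounded_linear l" "0 \<le> s" "s \<le> t"
  shows "(\<lambda>\<omega>. l (Z s \<omega>)) \<in> borel_measurable (F t)"
  by (rule measurable_compose[OF Z_adapted[OF assms(2,3)]])
     (intro borel_measurable_continuous_onI linear_continuous_on assms)

lemma incr_adapted:
  fixes l :: "'d phase \<Rightarrow> real"
  assumes "bounded_linear l" "0 \<le> a" "a \<le> t" "0 \<le> b" "b \<le> t"
  shows "incr l a b \<in> borel_measurable (F t)"
  unfolding incr_def[abs_def] using assms by (intro borel_measurable_diff functional_adapted)

lemma simple_term_square_integrable: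
  assumes l: "bounded_linear l" and ab: "0 \<le> a" "a \<le> b"
    and \<eta>: "\<eta> \<in> borel_measurable (F a)" "integrable M (\<lambda>\<omega>. (\<eta> \<omega>)\<^sup>2)"
  shows "integrable M (\<lambda>\<omega>. (\<eta> \<omega> * incr l a b \<omega>)\<^sup>2)"
  using expectation_times_increment(3)[OF l ab, of "\<lambda>\<omega>. (\<eta> \<omega>)\<^sup>2"] \<eta>
  by (simp add: power_mult_distrib incr_alt[OF l])

text \<open>Both increments are cut at the end points of the common interval \<open>(a', c]\<close>. In each product of
  pieces over disjoint intervals the later piece is centred given the rest; only the square of the
  increment over the common interval survives.\<close>

lemma isometry_pair_ordered:
  assumes l: "bounded_linear l" and a: "0 \<le> a" "a \<le> b" "a \<le> a'" "a' \<le> b'"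
    and \<eta>: "\<eta> \<in> borel_measurable (F a)" "integrable M (\<lambda>\<omega>. (\<eta> \<omega>)\<^sup>2)"
    and \<eta>': "\<eta>' \<in> borel_measurable (F a')" "integrable M (\<lambda>\<omega>. (\<eta>' \<omega>)\<^sup>2)"
  shows "expectation (\<lambda>\<omega>. (\<eta> \<omega> * incr l a b \<omega>) * (\<eta>' \<omega> * incr l a' b' \<omega>))
    = gauss_variance l * expectation (\<lambda>\<omega>. \<eta> \<omega> * \<eta>' \<omega>) * measure lborel ({a<..b} \<inter> {a'<..b'})"
proof -
  note ex = expectation_times_increment[OF l, folded incr_alt[OF l]]
  have \<eta>_F: "\<eta> \<in> borel_measurable (F a')" using \<eta>(1) a by (blast intro: F_mono)
  have early: "integrable M (\<lambda>\<omega>. (\<eta> \<omega> * incr l a c \<omega>) * \<eta>' \<omega>)"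
    "(\<lambda>\<omega>. (\<eta> \<omega> * incr l a c \<omega>) * \<eta>' \<omega>) \<in> borel_measurable (F a')" if c: "a \<le> c" "c \<le> a'" for c
  proof -
    have m: "(\<lambda>\<omega>. \<eta> \<omega> * incr l a c \<omega>) \<in> borel_measurable (F a')"
      using c a by (intro borel_measurable_times \<eta>_F incr_adapted l) auto
    then show "(\<lambda>\<omega>. (\<eta> \<omega> * incr l a c \<omega>) * \<eta>' \<omega>) \<in> borel_measurable (F a')"
      by (rule borel_measurable_times[OF _ \<eta>'(1)])
    show "integrable M (\<lambda>\<omega>. (\<eta> \<omega> * incr l a c \<omega>) * \<eta>' \<omega>)"
      using c a \<eta> \<eta>' F_measurable[OF m]
      by (intro integrable_mult_square simple_term_square_integrable l) (auto intro: F_measurable)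
  qed
  show ?thesis
  proof (cases "b \<le> a'")
    case True
    then have "{a<..b} \<inter> {a'<..b'} = {}" by auto
    moreover have "expectation (\<lambda>\<omega>. (\<eta> \<omega> * incr l a b \<omega> * \<eta>' \<omega>) * incr l a' b' \<omega>) = 0"
      using a True by (intro ex(2) early) auto
    ultimately show ?thesis by (simp only: mult.assoc measure_empty mult_zero_right)
  next
    case False
    define c where "c = min b b'"
    have c: "a' \<le> c" "c \<le> b" "c \<le> b'" "c = b \<or> c = b'" using False a by (auto simp: c_def)
    have "{a<..b} \<inter> {a'<..b'} = {a'<..c}" using a by (auto simp: c_def)
    then have meas: "measure lborel ({a<..b} \<inter> {a'<..b'}) = c - a'" using c by simp
    have int: "integrable M (\<lambda>\<omega>. \<eta> \<omega> * \<eta>' \<omega>)"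
      using \<eta> \<eta>' by (intro integrable_mult_square) (auto intro: F_measurable)
    have m: "(\<lambda>\<omega>. \<eta> \<omega> * \<eta>' \<omega>) \<in> borel_measurable (F a')" by (intro borel_measurable_times \<eta>_F \<eta>')
    have T1: "integrable M (\<lambda>\<omega>. (\<eta> \<omega> * incr l a a' \<omega> * \<eta>' \<omega>) * incr l a' b' \<omega>)"
      "expectation (\<lambda>\<omega>. (\<eta> \<omega> * incr l a a' \<omega> * \<eta>' \<omega>) * incr l a' b' \<omega>) = 0"
      using a by (intro ex early; simp)+
    have T2: "integrable M (\<lambda>\<omega>. (\<eta> \<omega> * \<eta>' \<omega>) * (incr l a' c \<omega>)\<^sup>2)"
      "expectation (\<lambda>\<omega>. (\<eta> \<omega> * \<eta>' \<omega>) * (incr l a' c \<omega>)\<^sup>2) = gauss_variance l * expectation (\<lambda>\<omega>. \<eta> \<omega> * \<eta>' \<omega>) * (c - a')"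
      using a c by (intro ex int m; simp)+
    have mid: "integrable M (\<lambda>\<omega>. \<eta> \<omega> * (\<eta>' \<omega> * incr l a' c \<omega>))"
      "(\<lambda>\<omega>. \<eta> \<omega> * (\<eta>' \<omega> * incr l a' c \<omega>)) \<in> borel_measurable (F c)"
    proof -
      have m: "(\<lambda>\<omega>. \<eta>' \<omega> * incr l a' c \<omega>) \<in> borel_measurable (F c)"
        using c a by (intro borel_measurable_times incr_adapted l F_mono[OF _ \<eta>'(1)]) auto
      then show "(\<lambda>\<omega>. \<eta> \<omega> * (\<eta>' \<omega> * incr l a' c \<omega>)) \<in> borel_measurable (F c)"
        by (rule borel_measurable_times[OF F_mono[OF c(1) \<eta>_F]])
      show "integrable M (\<lambda>\<omega>. \<eta> \<omega> * (\<eta>' \<omega> * incr l a' c \<omega>))"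
        using c a \<eta> \<eta>' F_measurable[OF m]
        by (intro integrable_mult_square simple_term_square_integrable l) (auto intro: F_measurable)
    qed
    have T3: "integrable M (\<lambda>\<omega>. (\<eta> \<omega> * (\<eta>' \<omega> * incr l a' c \<omega>)) * incr l c d \<omega>)"
      "expectation (\<lambda>\<omega>. (\<eta> \<omega> * (\<eta>' \<omega> * incr l a' c \<omega>)) * incr l c d \<omega>) = 0" if "c \<le> d" for d
      using a c that by (intro ex mid; simp)+
    have "(\<eta> \<omega> * incr l a b \<omega>) * (\<eta>' \<omega> * incr l a' b' \<omega>) =
       (\<eta> \<omega> * incr l a a' \<omega> * \<eta>' \<omega>) * incr l a' b' \<omega> + (\<eta> \<omega> * \<eta>' \<omega>) * (incr l a' c \<omega>)\<^sup>2
       + (\<eta> \<omega> * (\<eta>' \<omega> * incr l a' c \<omega>)) * incr l c b \<omega> + (\<eta> \<omega> * (\<eta>' \<omega> * incr l a' c \<omega>)) * incr l c b' \<omega>" for \<omega>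
      using c(4) by (elim disjE) (simp_all add: incr_def algebra_simps power2_eq_square)
    then have "expectation (\<lambda>\<omega>. (\<eta> \<omega> * incr l a b \<omega>) * (\<eta>' \<omega> * incr l a' b' \<omega>)) =
       expectation (\<lambda>\<omega>. (\<eta> \<omega> * incr l a a' \<omega> * \<eta>' \<omega>) * incr l a' b' \<omega>) + expectation (\<lambda>\<omega>. (\<eta> \<omega> * \<eta>' \<omega>) * (incr l a' c \<omega>)\<^sup>2)
       + expectation (\<lambda>\<omega>. (\<eta> \<omega> * (\<eta>' \<omega> * incr l a' c \<omega>)) * incr l c b \<omega>) + expectation (\<lambda>\<omega>. (\<eta> \<omega> * (\<eta>' \<omega> * incr l a' c \<omega>)) * incr l c b' \<omega>)"
      using T1(1) T2(1) T3(1)[OF c(2)] T3(1)[OF c(3)] by (simp only: Bochner_Integration.integral_add Bochner_Integration.integrable_add)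
    then show ?thesis using T1(2) T2(2) T3(2)[OF c(2)] T3(2)[OF c(3)] by (simp only: meas add_0_left add_0_right)
  qed
qed

text \<open>The mean square as an extended number, since approximating integrals come without
  integrability statements.\<close>

definition msq :: "('w \<Rightarrow> real) \<Rightarrow> ennreal" where
  "msq Y = (\<integral>\<^sup>+ \<omega>. ennreal ((Y \<omega>)\<^sup>2) \<partial>M)"

lemma msq_diff_le:
  assumes [measurable]: "Y \<in> borel_measurable M" "Y' \<in> borel_measurable M"
  shows "msq (\<lambda>\<omega>. Y \<omega> - Y' \<omega>) \<le> 2 * msq Y + 2 * msq Y'"
proof -
  have "(Y \<omega> - Y' \<omega>)\<^sup>2 \<le> 2 * (Y \<omega>)\<^sup>2 + 2 * (Y' \<omega>)\<^sup>2" for \<omega>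
    using sum_squares_bound[of "Y \<omega>" "- Y' \<omega>"] by (simp add: power2_diff)
  then have "ennreal ((Y \<omega> - Y' \<omega>)\<^sup>2) \<le> 2 * ennreal ((Y \<omega>)\<^sup>2) + 2 * ennreal ((Y' \<omega>)\<^sup>2)" for \<omega>
    using ennreal_leI[of "(Y \<omega> - Y' \<omega>)\<^sup>2" "2 * (Y \<omega>)\<^sup>2 + 2 * (Y' \<omega>)\<^sup>2"] by (simp add: ennreal_mult)
  then have "msq (\<lambda>\<omega>. Y \<omega> - Y' \<omega>) \<le> (\<integral>\<^sup>+ \<omega>. 2 * ennreal ((Y \<omega>)\<^sup>2) + 2 * ennreal ((Y' \<omega>)\<^sup>2) \<partial>M)"
    unfolding msq_def by (intro nn_integral_mono) auto
  also have "\<dots> = 2 * msq Y + 2 * msq Y'"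
    unfolding msq_def by (subst nn_integral_add) (auto simp: nn_integral_cmult)
  finally show ?thesis .
qed

lemma msq_sum_le:
  assumes [measurable]: "\<And>j. j \<in> J \<Longrightarrow> Y j \<in> borel_measurable M"
  shows "msq (\<lambda>\<omega>. \<Sum>j\<in>J. Y j \<omega>) \<le> of_nat (card J) * (\<Sum>j\<in>J. msq (Y j))"
proof -
  have "ennreal ((\<Sum>j\<in>J. Y j \<omega>)\<^sup>2) \<le> of_nat (card J) * (\<Sum>j\<in>J. ennreal ((Y j \<omega>)\<^sup>2))" for \<omega>
    using ennreal_leI[OF sum_squared_le_sum_of_squares[of "\<lambda>j. Y j \<omega>" J]]
    by (simp add: ennreal_mult sum_nonneg ennreal_of_nat_eq_real_of_nat mult.commute)
  then have "msq (\<lambda>\<omega>. \<Sum>j\<in>J. Y j \<omega>) \<le> (\<integral>\<^sup>+ \<omega>. of_nat (card J) * (\<Sum>j\<in>J. ennreal ((Y j \<omega>)\<^sup>2)) \<partial>M)"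
    unfolding msq_def by (intro nn_integral_mono) auto
  also have "\<dots> = of_nat (card J) * (\<Sum>j\<in>J. msq (Y j))"
    unfolding msq_def by (simp add: nn_integral_cmult nn_integral_sum del: sum_ennreal)
  finally show ?thesis .
qed

text \<open>Truncating a simple integrand at a time \<open>t\<close> produces empty intervals whose coefficient is only
  known after \<open>t\<close>. Adaptedness is therefore required on nonempty intervals only.\<close>

definition admissible :: "real \<Rightarrow> real \<Rightarrow> ('w \<Rightarrow> real) \<Rightarrow> bool" where
  "admissible a b \<eta> \<longleftrightarrow> 0 \<le> a \<and> a \<le> b \<and> \<eta> \<in> borel_measurable M \<and> integrable M (\<lambda>\<omega>. (\<eta> \<omega>)\<^sup>2)
     \<and> (a < b \<longrightarrow> \<eta> \<in> borel_measurable (F a))"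

lemma admissible_square_integrable:
  assumes l: "bounded_linear l" and a: "admissible a b \<eta>"
  shows "integrable M (\<lambda>\<omega>. (\<eta> \<omega> * incr l a b \<omega>)\<^sup>2)" "(\<lambda>\<omega>. \<eta> \<omega> * incr l a b \<omega>) \<in> borel_measurable M"
proof -
  show "integrable M (\<lambda>\<omega>. (\<eta> \<omega> * incr l a b \<omega>)\<^sup>2)"
    using a l by (cases "a = b") (auto simp: admissible_def intro: simple_term_square_integrable)
  show "(\<lambda>\<omega>. \<eta> \<omega> * incr l a b \<omega>) \<in> borel_measurable M"
    using a l by (auto simp: admissible_def intro!: borel_measurable_times F_measurable[OF incr_adapted[of l a b b]])
qed

lemma isometry_pair:
  assumes l: "bounded_linear l" and 1: "admissible a b \<eta>" and 2: "admissible a' b' \<eta>'"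
  shows "expectation (\<lambda>\<omega>. (\<eta> \<omega> * incr l a b \<omega>) * (\<eta>' \<omega> * incr l a' b' \<omega>))
    = gauss_variance l * expectation (\<lambda>\<omega>. \<eta> \<omega> * \<eta>' \<omega>) * measure lborel ({a<..b} \<inter> {a'<..b'})"
proof -
  consider "a = b" | "a' = b'" | "a < b" "a' < b'" "a \<le> a'" | "a < b" "a' < b'" "a' \<le> a"
    using 1 2 by (auto simp: admissible_def) linarith
  then show ?thesis
  proof cases
    case 3
    then show ?thesis using 1 2 by (intro isometry_pair_ordered l) (auto simp: admissible_def)
  next
    case 4
    have "expectation (\<lambda>\<omega>. (\<eta>' \<omega> * incr l a' b' \<omega>) * (\<eta> \<omega> * incr l a b \<omega>))
      = gauss_variance l * expectation (\<lambda>\<omega>. \<eta>' \<omega> * \<eta> \<omega>) * measure lborel ({a'<..b'} \<inter> {a<..b})"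
      using 4 1 2 by (intro isometry_pair_ordered l) (auto simp: admissible_def)
    then show ?thesis by (simp add: mult.commute Int_commute)
  qed auto
qed

text \<open>The intervals may overlap, so the family can describe the difference of two simple integrals over
  different partitions.\<close>

lemma simple_isometry:
  assumes l: "bounded_linear l" and J: "finite J" and adm: "\<And>i. i \<in> J \<Longrightarrow> admissible (a i) (b i) (\<eta> i)"
  shows "(\<lambda>r. msq (\<lambda>\<omega>. \<Sum>i\<in>J. \<eta> i \<omega> * indicator {a i<..b i} r)) \<in> borel_measurable lborel"
    and "msq (\<lambda>\<omega>. \<Sum>i\<in>J. \<eta> i \<omega> * incr l (a i) (b i) \<omega>) =
      ennreal (gauss_variance l) * (\<integral>\<^sup>+ r. msq (\<lambda>\<omega>. \<Sum>i\<in>J. \<eta> i \<omega> * indicator {a i<..b i} r) \<partial>lborel)"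
proof -
  define C where "C i j = expectation (\<lambda>\<omega>. \<eta> i \<omega> * \<eta> j \<omega>)" for i j
  define q where "q r = (\<Sum>i\<in>J. \<Sum>j\<in>J. C i j * indicator ({a i<..b i} \<inter> {a j<..b j}) r)" for r :: real
  have \<eta>_int: "integrable M (\<lambda>\<omega>. \<eta> i \<omega> * \<eta> j \<omega>)" if "i \<in> J" "j \<in> J" for i j
    using adm[OF that(1)] adm[OF that(2)] by (intro integrable_mult_square) (auto simp: admissible_def)
  have term_int: "integrable M (\<lambda>\<omega>. (\<eta> i \<omega> * incr l (a i) (b i) \<omega>) * (\<eta> j \<omega> * incr l (a j) (b j) \<omega>))" if "i \<in> J" "j \<in> J" for i j
    using that by (intro integrable_mult_square admissible_square_integrable l adm)
  have q: "msq (\<lambda>\<omega>. \<Sum>i\<in>J. \<eta> i \<omega> * indicator {a i<..b i} r) = ennreal (q r)" and q_nonneg: "q r \<ge> 0" for r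
  proof -
    have eq: "(\<Sum>i\<in>J. \<eta> i \<omega> * indicator {a i<..b i} r)\<^sup>2 =
      (\<Sum>i\<in>J. \<Sum>j\<in>J. (\<eta> i \<omega> * \<eta> j \<omega>) * indicator ({a i<..b i} \<inter> {a j<..b j}) r)" for \<omega>
      unfolding power2_eq_square sum_product indicator_inter_arith by (simp add: mult_ac)
    have int: "integrable M (\<lambda>\<omega>. (\<Sum>i\<in>J. \<Sum>j\<in>J. (\<eta> i \<omega> * \<eta> j \<omega>) * indicator ({a i<..b i} \<inter> {a j<..b j}) r))"
      using \<eta>_int by (intro Bochner_Integration.integrable_sum integrable_mult_left) auto
    have e: "expectation (\<lambda>\<omega>. (\<Sum>i\<in>J. \<eta> i \<omega> * indicator {a i<..b i} r)\<^sup>2) = q r"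
      unfolding eq q_def C_def
      using \<eta>_int by (subst Bochner_Integration.integral_sum) (auto intro!: Bochner_Integration.integrable_sum sum.cong)
    show "msq (\<lambda>\<omega>. \<Sum>i\<in>J. \<eta> i \<omega> * indicator {a i<..b i} r) = ennreal (q r)"
      using int unfolding eq[symmetric] e[symmetric] msq_def by (intro nn_integral_eq_integral) auto
    show "q r \<ge> 0" unfolding e[symmetric] by simp
  qed
  show "(\<lambda>r. msq (\<lambda>\<omega>. \<Sum>i\<in>J. \<eta> i \<omega> * indicator {a i<..b i} r)) \<in> borel_measurable lborel"
    unfolding q q_def by measurable
  have ind: "integrable lborel (\<lambda>r. indicator ({a i<..b i} \<inter> {a j<..b j}) r :: real)" for i j
  proof (rule integrable_real_indicator)
    show "emeasure lborel ({a i<..b i} \<inter> {a j<..b j}) < \<infinity>"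
      by (rule emeasure_bounded_finite[OF bounded_subset[of "{a i..b i}"]]) auto
  qed simp
  have q_int: "integrable lborel q"
    unfolding q_def[abs_def] using ind by (intro Bochner_Integration.integrable_sum integrable_mult_right) auto
  have q_integral: "(\<integral>r. q r \<partial>lborel) = (\<Sum>i\<in>J. \<Sum>j\<in>J. C i j * measure lborel ({a i<..b i} \<inter> {a j<..b j}))"
    unfolding q_def using ind
    by (subst Bochner_Integration.integral_sum)
       (auto intro!: Bochner_Integration.integrable_sum sum.cong simp: Bochner_Integration.integral_sum)
  have "(\<Sum>i\<in>J. \<eta> i \<omega> * incr l (a i) (b i) \<omega>)\<^sup>2 =
      (\<Sum>i\<in>J. \<Sum>j\<in>J. (\<eta> i \<omega> * incr l (a i) (b i) \<omega>) * (\<eta> j \<omega> * incr l (a j) (b j) \<omega>))" for \<omega>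
    unfolding power2_eq_square sum_product ..
  note eq = this
  have int: "integrable M (\<lambda>\<omega>. (\<Sum>i\<in>J. \<eta> i \<omega> * incr l (a i) (b i) \<omega>)\<^sup>2)"
    unfolding eq using term_int by (intro Bochner_Integration.integrable_sum) auto
  have "expectation (\<lambda>\<omega>. (\<Sum>i\<in>J. \<eta> i \<omega> * incr l (a i) (b i) \<omega>)\<^sup>2) =
      (\<Sum>i\<in>J. \<Sum>j\<in>J. expectation (\<lambda>\<omega>. (\<eta> i \<omega> * incr l (a i) (b i) \<omega>) * (\<eta> j \<omega> * incr l (a j) (b j) \<omega>)))"
    unfolding eq using term_int
    by (subst Bochner_Integration.integral_sum) (auto intro!: Bochner_Integration.integrable_sum sum.cong Bochner_Integration.integral_sum)
  also have "\<dots> = (\<Sum>i\<in>J. \<Sum>j\<in>J. gauss_variance l * (C i j * measure lborel ({a i<..b i} \<inter> {a j<..b j})))"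
    using isometry_pair[OF l adm adm] by (intro sum.cong) (auto simp: C_def mult.assoc)
  also have "\<dots> = gauss_variance l * (\<integral>r. q r \<partial>lborel)"
    by (simp add: q_integral sum_distrib_left)
  finally have "msq (\<lambda>\<omega>. \<Sum>i\<in>J. \<eta> i \<omega> * incr l (a i) (b i) \<omega>) = ennreal (gauss_variance l * (\<integral>r. q r \<partial>lborel))"
    unfolding msq_def using int by (subst nn_integral_eq_integral) auto
  also have "\<dots> = ennreal (gauss_variance l) * (\<integral>\<^sup>+ r. ennreal (q r) \<partial>lborel)"
    using q_int q_nonneg by (subst nn_integral_eq_integral) (auto simp: ennreal_mult gauss_variance_nonneg Bochner_Integration.integral_nonneg)
  finally show "msq (\<lambda>\<omega>. \<Sum>i\<in>J. \<eta> i \<omega> * incr l (a i) (b i) \<omega>) =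
      ennreal (gauss_variance l) * (\<integral>\<^sup>+ r. msq (\<lambda>\<omega>. \<Sum>i\<in>J. \<eta> i \<omega> * indicator {a i<..b i} r) \<partial>lborel)"
    by (simp add: q)
qed

end

section \<open>Riemann sums of the Ito integral\<close>

lemma partition_nonneg:
  fixes q :: "nat \<Rightarrow> real"
  assumes "0 \<le> q 0" "\<And>i. i < n \<Longrightarrow> q i \<le> q (Suc i)" "i \<le> n"
  shows "0 \<le> q i" "q i \<le> q n"
proof -
  have "q j \<le> q k" if "j \<le> k" "k \<le> n" for j k
    using that
  proof (induction k rule: dec_induct)
    case (step m)
    then show ?case using assms(2)[of m] by simp
  qed simp
  then show "0 \<le> q i" "q i \<le> q n" using assms(1,3) by (auto intro: order_trans)
qed

lemma partition_cell:
  fixes q :: "nat \<Rightarrow> real"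
  assumes mono: "\<And>i. i < n \<Longrightarrow> q i \<le> q (Suc i)" and r: "q 0 < r" "r \<le> q n"
  obtains i where "i < n" "r \<in> {q i<..q (Suc i)}"
    "\<And>j. j < n \<Longrightarrow> indicator {q j<..q (Suc j)} r = (if j = i then 1 else 0 :: real)"
proof -
  have le: "q j \<le> q k" if "j \<le> k" "k \<le> n" for j k
    using that
  proof (induction k rule: dec_induct)
    case (step m)
    then show ?case using mono[of m] by simp
  qed simp
  define i where "i = (LEAST k. r \<le> q (Suc k))"
  have "n \<noteq> 0" using r by (cases n) auto
  then have n: "r \<le> q (Suc (n - 1))" using r by simp
  have 1: "r \<le> q (Suc i)" unfolding i_def by (rule LeastI[of _ "n - 1"]) (rule n)
  have 2: "i \<le> n - 1" unfolding i_def by (rule Least_le) (rule n)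
  have i_n: "i \<le> n" using 2 by linarith
  have 3: "q i < r"
  proof (cases i)
    case 0
    then show ?thesis using r by simp
  next
    case (Suc k)
    then show ?thesis using not_less_Least[of k "\<lambda>k. r \<le> q (Suc k)"] by (simp add: i_def[symmetric])
  qed
  have "indicator {q j<..q (Suc j)} r = (if j = i then 1 else 0 :: real)" if j: "j < n" for j
  proof -
    consider "j = i" | "Suc j \<le> i" | "Suc i \<le> j" by linarith
    then show ?thesis
    proof cases
      case 2
      then have "q (Suc j) < r" using le[of "Suc j" i] 3 i_n by simp
      then show ?thesis using 2 by (simp add: indicator_def)
    next
      case 3
      then have "r \<le> q j" using le[of "Suc i" j] 1 j by simp
      then show ?thesis using 3 by (simp add: indicator_def)
    qed (use 1 3 in simp)
  qed
  then show ?thesis using that[of i] 1 2 3 \<open>n \<noteq> 0\<close> by simp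
qed

context two_brownian_motions
begin

lemma functional_square_integrable:
  fixes k :: "'d phase \<Rightarrow> real"
  assumes k: "bounded_linear k" and s: "0 \<le> s"
  shows "integrable M (\<lambda>\<omega>. (k (Z s \<omega>))\<^sup>2)" "(\<lambda>\<omega>. k (Z s \<omega>)) \<in> borel_measurable M"
proof -
  show m: "(\<lambda>\<omega>. k (Z s \<omega>)) \<in> borel_measurable M"
    by (rule F_measurable[OF functional_adapted[OF k s order_refl]])
  have m2: "(\<lambda>\<omega>. k (Z s \<omega> - Z 0 \<omega>)) \<in> borel_measurable M"
    using increment_moments(1)[OF k order_refl s] by (rule borel_measurable_integrable)
  have "AE \<omega> in M. (k (Z s \<omega> - Z 0 \<omega>))\<^sup>2 = (k (Z s \<omega>))\<^sup>2"
    using AE_Z_0 by eventually_elim simp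
  then show "integrable M (\<lambda>\<omega>. (k (Z s \<omega>))\<^sup>2)"
    using increment_moments(3)[OF k order_refl s] m m2 by (subst integrable_cong_AE[symmetric]) auto
qed

lemma nn_increment_square:
  fixes k :: "'d phase \<Rightarrow> real"
  assumes k: "bounded_linear k" and s: "0 \<le> s" "s \<le> r"
  shows "msq (\<lambda>\<omega>. k (Z r \<omega>) - k (Z s \<omega>)) = ennreal (gauss_variance k * (r - s))"
proof -
  have "k (Z r \<omega>) - k (Z s \<omega>) = k (Z r \<omega> - Z s \<omega>)" for \<omega>
    using bounded_linear.linear[OF k] by (simp add: linear_diff)
  then show ?thesis
    using increment_moments(3,4)[OF k s] by (simp add: msq_def nn_integral_eq_integral)
qed

text \<open>The Riemann sum is the integral of the step process \<open>k (Z (q i))\<close>, whose mean square distance to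
  \<open>k (Z r)\<close> is at most the variance constant times the mesh. So the isometry bounds the distance of the
  two integrals by the distance of the given simple process to \<open>k (Z r)\<close> and the mesh.\<close>

lemma simple_vs_riemann:
  fixes k l :: "'d phase \<Rightarrow> real"
  assumes l: "bounded_linear l" and k: "bounded_linear k" and t: "0 \<le> t"
    and q: "q 0 = 0" "q n = t" "\<And>i. i < n \<Longrightarrow> q i \<le> q (Suc i)" "\<And>i. i < n \<Longrightarrow> q (Suc i) - q i \<le> \<delta>"
    and simple: "simple_integrand M F N p \<eta>"
  shows "msq (\<lambda>\<omega>. simple_ito N p \<eta> (\<lambda>r \<omega>. l (Z r \<omega>)) t \<omega>
      - (\<Sum>i<n. k (Z (q i) \<omega>) * incr l (q i) (q (Suc i)) \<omega>))
    \<le> ennreal (gauss_variance l) * (2 * (\<integral>\<^sup>+ r \<in> {0..t}. msq (\<lambda>\<omega>. simple_process N p \<eta> r \<omega> - k (Z r \<omega>)) \<partial>lborel)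
      + ennreal (2 * gauss_variance k * \<delta> * t))"
proof -
  have p: "0 \<le> p 0" "\<And>i. i < N \<Longrightarrow> p i \<le> p (Suc i)" "\<And>i. i < N \<Longrightarrow> \<eta> i \<in> borel_measurable (F (p i))"
    "\<And>i. i < N \<Longrightarrow> integrable M (\<lambda>\<omega>. (\<eta> i \<omega>)\<^sup>2)"
    using simple by (auto simp: simple_integrand_def)
  have \<eta>_meas: "\<eta> i \<in> borel_measurable M" if "i < N" for i using p(3)[OF that] by (rule F_measurable)
  have p0: "0 \<le> p i" if "i \<le> N" for i using partition_nonneg(1)[OF p(1,2) that] .
  have q0: "0 \<le> q i" "q i \<le> t" if "i \<le> n" for i
    using partition_nonneg[of q n i] q that by auto
  define J where "J = {..<N} <+> {..<n}"
  define a where "a = case_sum (\<lambda>i. min (p i) t) q"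
  define b where "b = case_sum (\<lambda>i. min (p (Suc i)) t) (\<lambda>i. q (Suc i))"
  define e where "e = case_sum \<eta> (\<lambda>i \<omega>. - k (Z (q i) \<omega>))"
  have J: "finite J" by (simp add: J_def)
  have sum_J: "(\<Sum>j\<in>J. f j) = (\<Sum>i<N. f (Inl i)) + (\<Sum>i<n. f (Inr i))" for f :: "nat + nat \<Rightarrow> real"
    unfolding J_def by (subst sum.Plus) (auto simp: o_def)
  have adm: "admissible (a j) (b j) (e j)" if "j \<in> J" for j
  proof (cases j)
    case (Inl i)
    then have i: "i < N" using that by (auto simp: J_def)
    have "\<eta> i \<in> borel_measurable (F (min (p i) t))" if "min (p i) t < min (p (Suc i)) t"
    proof -
      have "min (p i) t = p i" using that by (auto simp: min_def split: if_splits)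
      then show ?thesis using p(3)[OF i] by simp
    qed
    then show ?thesis
      using p(2,4)[OF i] p0[of i] i t \<eta>_meas[OF i]
      by (auto simp: admissible_def Inl a_def b_def e_def)
  next
    case (Inr i)
    then have i: "i < n" using that by (auto simp: J_def)
    have "(\<lambda>\<omega>. - k (Z (q i) \<omega>)) \<in> borel_measurable (F (q i))"
      by (intro borel_measurable_uminus functional_adapted k order_refl q0) (use i in simp)
    moreover have "(\<lambda>\<omega>. - k (Z (q i) \<omega>)) \<in> borel_measurable M" using calculation by (rule F_measurable)
    moreover have "integrable M (\<lambda>\<omega>. (k (Z (q i) \<omega>))\<^sup>2)"
      using q0[of i] i by (intro functional_square_integrable k) auto
    ultimately show ?thesis
      using q0[of i] q(3)[OF i] i by (auto simp: admissible_def Inr a_def b_def e_def)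
  qed
  have sum1: "(\<Sum>j\<in>J. e j \<omega> * incr l (a j) (b j) \<omega>) = simple_ito N p \<eta> (\<lambda>r \<omega>. l (Z r \<omega>)) t \<omega>
      - (\<Sum>i<n. k (Z (q i) \<omega>) * incr l (q i) (q (Suc i)) \<omega>)" for \<omega>
    unfolding sum_J by (simp add: a_def b_def e_def simple_ito_def incr_def[of l "min _ _"] sum_negf)
  define g where "g r = msq (\<lambda>\<omega>. \<Sum>j\<in>J. e j \<omega> * indicator {a j<..b j} r)" for r
  define f where "f r = msq (\<lambda>\<omega>. simple_process N p \<eta> r \<omega> - k (Z r \<omega>))" for r
  define c where "c = 2 * gauss_variance k * \<delta>"
  have g_meas [measurable]: "g \<in> borel_measurable lborel"
    unfolding g_def by (rule simple_isometry(1)[OF l J adm])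
  have g_le: "g r \<le> 2 * (f r * indicator {0..t} r) + ennreal c * indicator {0<..t} r" for r
  proof (cases "r \<in> {0<..t}")
    case False
    have "(\<Sum>j\<in>J. e j \<omega> * indicator {a j<..b j} r) = 0" for \<omega>
    proof (rule sum.neutral, rule ballI)
      fix j assume "j \<in> J"
      then have "0 \<le> a j" "b j \<le> t"
        using p0 t q0 by (auto simp: J_def a_def b_def)
      then have "r \<notin> {a j<..b j}" using False by auto
      then show "e j \<omega> * indicator {a j<..b j} r = 0" by simp
    qed
    then show ?thesis by (simp add: g_def msq_def)
  next
    case True
    then obtain i where i: "i < n" "r \<in> {q i<..q (Suc i)}"
      "\<And>j. j < n \<Longrightarrow> indicator {q j<..q (Suc j)} r = (if j = i then 1 else 0 :: real)"
      using partition_cell[of n q r] q by auto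
    have "(\<Sum>j<n. - k (Z (q j) \<omega>) * indicator {q j<..q (Suc j)} r) = (\<Sum>j<n. if j = i then - k (Z (q j) \<omega>) else 0)" for \<omega>
      by (rule sum.cong) (auto simp: i(3))
    then have r_sum: "(\<Sum>j<n. - k (Z (q j) \<omega>) * indicator {q j<..q (Suc j)} r) = - k (Z (q i) \<omega>)" for \<omega>
      using i(1) by simp
    have l_sum: "(\<Sum>j<N. \<eta> j \<omega> * indicator {min (p j) t<..min (p (Suc j)) t} r) = simple_process N p \<eta> r \<omega>" for \<omega>
      unfolding simple_process_def using True
      by (intro sum.cong) (auto simp: indicator_def)
    have sum2: "(\<Sum>j\<in>J. e j \<omega> * indicator {a j<..b j} r) = simple_process N p \<eta> r \<omega> - k (Z (q i) \<omega>)" for \<omega>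
      unfolding sum_J using l_sum r_sum by (simp add: a_def b_def e_def)
    have sp_meas [measurable]: "simple_process N p \<eta> r \<in> borel_measurable M"
      unfolding simple_process_def[abs_def] using \<eta>_meas by (intro borel_measurable_sum borel_measurable_times) auto
    have [measurable]: "(\<lambda>\<omega>. k (Z r \<omega>)) \<in> borel_measurable M" "(\<lambda>\<omega>. k (Z (q i) \<omega>)) \<in> borel_measurable M"
      using True q0(1)[of i] i(1) by (auto intro: functional_square_integrable k)
    have "g r = msq (\<lambda>\<omega>. (simple_process N p \<eta> r \<omega> - k (Z r \<omega>)) - (k (Z (q i) \<omega>) - k (Z r \<omega>)))"
      unfolding g_def sum2 by simp
    also have "\<dots> \<le> 2 * f r + 2 * msq (\<lambda>\<omega>. k (Z (q i) \<omega>) - k (Z r \<omega>))"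
      unfolding f_def by (intro msq_diff_le) measurable
    also have "msq (\<lambda>\<omega>. k (Z (q i) \<omega>) - k (Z r \<omega>)) = msq (\<lambda>\<omega>. k (Z r \<omega>) - k (Z (q i) \<omega>))"
      by (simp add: msq_def power2_commute)
    also have "\<dots> = ennreal (gauss_variance k * (r - q i))"
      using i(2) q0(1)[of i] i(1) by (intro nn_increment_square k) auto
    also have "2 * ennreal (gauss_variance k * (r - q i)) \<le> ennreal c"
    proof -
      have "r - q i \<le> \<delta>" using i(1,2) q(4)[of i] by simp
      then have "2 * (gauss_variance k * (r - q i)) \<le> c"
        unfolding c_def using gauss_variance_nonneg[of k] by (simp add: mult_left_mono)
      then have "ennreal (2 * (gauss_variance k * (r - q i))) \<le> ennreal c" by (rule ennreal_leI)
      then show ?thesis using i(2) gauss_variance_nonneg[of k] by (simp add: ennreal_mult)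
    qed
    finally show ?thesis using True by simp
  qed
  have half: "2 * ennreal (1 / 2) = 1"
    unfolding ennreal_numeral[symmetric] by (subst ennreal_mult'[symmetric]) auto
  then have half': "ennreal (1 / 2) * 2 = 1" by (simp only: mult.commute)
  \<comment> \<open>\<open>f\<close> has not been shown to be measurable, and nonnegative integrals are additive for measurable functions
    only. So the constant first moves to the side of \<open>g\<close>, by a subtraction that is truncated at \<open>0\<close>.\<close>
  define h where "h r = g r - ennreal c * indicator {0<..t} r" for r
  have h_meas [measurable]: "h \<in> borel_measurable lborel" unfolding h_def by measurable
  have "(\<integral>\<^sup>+ r. g r \<partial>lborel) \<le> (\<integral>\<^sup>+ r. h r + ennreal c * indicator {0<..t} r \<partial>lborel)"
  proof (rule nn_integral_mono)
    fix r
    show "g r \<le> h r + ennreal c * indicator {0<..t} r"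
      using ennreal_minus_le_iff[of "g r" "ennreal c * indicator {0<..t} r" "h r"] by (simp add: h_def add.commute)
  qed
  also have "\<dots> = (\<integral>\<^sup>+ r. h r \<partial>lborel) + (\<integral>\<^sup>+ r. ennreal c * indicator {0<..t} r \<partial>lborel)"
    by (subst nn_integral_add) auto
  also have "(\<integral>\<^sup>+ r. ennreal c * indicator {0<..t} r \<partial>lborel) = ennreal c * ennreal t"
    using t by (subst nn_integral_cmult_indicator) auto
  also have "(\<integral>\<^sup>+ r. h r \<partial>lborel) = (\<integral>\<^sup>+ r. 2 * (ennreal (1/2) * h r) \<partial>lborel)"
    by (simp only: mult.assoc[symmetric] half mult_1_left)
  also have "\<dots> = 2 * (\<integral>\<^sup>+ r. ennreal (1/2) * h r \<partial>lborel)"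
    by (subst nn_integral_cmult) auto
  also have "(\<integral>\<^sup>+ r. ennreal (1/2) * h r \<partial>lborel) \<le> (\<integral>\<^sup>+ r. f r * indicator {0..t} r \<partial>lborel)"
  proof (rule nn_integral_mono)
    fix r
    have "h r \<le> 2 * (f r * indicator {0..t} r)"
      unfolding h_def using g_le[of r]
      by (cases "r \<in> {0<..t}") (simp_all add: ennreal_minus_le_iff add.commute)
    then have "ennreal (1/2) * h r \<le> ennreal (1/2) * (2 * (f r * indicator {0..t} r))" by (rule mult_left_mono) simp
    also have "\<dots> = f r * indicator {0..t} r" by (simp only: mult.assoc[symmetric] half' mult_1_left)
    finally show "ennreal (1/2) * h r \<le> f r * indicator {0..t} r" .
  qed
  finally have "(\<integral>\<^sup>+ r. g r \<partial>lborel) \<le> 2 * (\<integral>\<^sup>+ r. f r * indicator {0..t} r \<partial>lborel) + ennreal c * ennreal t"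
    by (simp add: add_right_mono mult_left_mono)
  moreover have "ennreal c * ennreal t = ennreal (2 * gauss_variance k * \<delta> * t)"
    using t by (simp add: c_def ennreal_mult'')
  ultimately have g_bound: "(\<integral>\<^sup>+ r. g r \<partial>lborel) \<le> 2 * (\<integral>\<^sup>+ r. f r * indicator {0..t} r \<partial>lborel)
      + ennreal (2 * gauss_variance k * \<delta> * t)" by simp
  have "msq (\<lambda>\<omega>. \<Sum>j\<in>J. e j \<omega> * incr l (a j) (b j) \<omega>)
      = ennreal (gauss_variance l) * (\<integral>\<^sup>+ r. g r \<partial>lborel)"
    unfolding g_def by (rule simple_isometry(2)[OF l J adm])
  also have "\<dots> \<le> ennreal (gauss_variance l) * (2 * (\<integral>\<^sup>+ r. f r * indicator {0..t} r \<partial>lborel)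
      + ennreal (2 * gauss_variance k * \<delta> * t))"
    using g_bound by (rule mult_left_mono) simp
  finally show ?thesis unfolding sum1 f_def .
qed

text \<open>An Ito integral is a mean-square limit of simple integrals whose integrands approach \<open>k (Z r)\<close>, so
  the bound for simple integrals passes to the limit.\<close>

lemma ito_riemann_error:
  fixes k l :: "'d phase \<Rightarrow> real"
  assumes l: "bounded_linear l" and k: "bounded_linear k" and t: "0 \<le> t"
    and q: "q 0 = 0" "q n = t" "\<And>i. i < n \<Longrightarrow> q i \<le> q (Suc i)" "\<And>i. i < n \<Longrightarrow> q (Suc i) - q i \<le> \<delta>"
    and ito: "is_ito_integral M F (\<lambda>r \<omega>. k (Z r \<omega>)) (\<lambda>r \<omega>. l (Z r \<omega>)) t I"
    and \<delta>: "\<delta> \<ge> 0"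
  shows "msq (\<lambda>\<omega>. (\<Sum>i<n. k (Z (q i) \<omega>) * incr l (q i) (q (Suc i)) \<omega>) - I \<omega>)
    \<le> ennreal (4 * gauss_variance l * gauss_variance k * \<delta> * t)"
proof -
  obtain N p \<eta> where simple: "\<And>m. simple_integrand M F (N m) (p m) (\<eta> m)"
    and lim1: "(\<lambda>m. \<integral>\<^sup>+ r \<in> {0..t}. msq (\<lambda>\<omega>. simple_process (N m) (p m) (\<eta> m) r \<omega> - k (Z r \<omega>)) \<partial>lborel) \<longlonglongrightarrow> 0"
    and lim2: "(\<lambda>m. msq (\<lambda>\<omega>. simple_ito (N m) (p m) (\<eta> m) (\<lambda>r \<omega>. l (Z r \<omega>)) t \<omega> - I \<omega>)) \<longlonglongrightarrow> 0"
    and I [measurable]: "I \<in> borel_measurable M"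
    using ito unfolding is_ito_integral_def msq_def[symmetric] by blast
  define R where "R \<omega> = (\<Sum>i<n. k (Z (q i) \<omega>) * incr l (q i) (q (Suc i)) \<omega>)" for \<omega>
  define S where "S m = simple_ito (N m) (p m) (\<eta> m) (\<lambda>r \<omega>. l (Z r \<omega>)) t" for m
  define A where "A m = (\<integral>\<^sup>+ r \<in> {0..t}. msq (\<lambda>\<omega>. simple_process (N m) (p m) (\<eta> m) r \<omega> - k (Z r \<omega>)) \<partial>lborel)" for m
  define B where "B m = msq (\<lambda>\<omega>. S m \<omega> - I \<omega>)" for m
  have q0: "0 \<le> q i" "q i \<le> t" if "i \<le> n" for i
    using partition_nonneg[of q n i] q that by auto
  have R [measurable]: "R \<in> borel_measurable M"
    unfolding R_def[abs_def]
  proof (intro borel_measurable_sum borel_measurable_times)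
    fix i assume "i \<in> {..<n}"
    then show "(\<lambda>\<omega>. k (Z (q i) \<omega>)) \<in> borel_measurable M" "incr l (q i) (q (Suc i)) \<in> borel_measurable M"
      using q0[of i] q0[of "Suc i"]
      by (auto intro!: functional_square_integrable k l F_measurable[OF incr_adapted[of l "q i" t "q (Suc i)"]])
  qed
  have S [measurable]: "S m \<in> borel_measurable M" for m
    unfolding S_def simple_ito_def[abs_def]
  proof (intro borel_measurable_sum borel_measurable_times borel_measurable_diff)
    fix i assume i: "i \<in> {..<N m}"
    have si: "0 \<le> p m 0" "\<And>i. i < N m \<Longrightarrow> p m i \<le> p m (Suc i)" "\<eta> m i \<in> borel_measurable (F (p m i))"
      using simple[of m] i by (auto simp: simple_integrand_def)
    then show "\<eta> m i \<in> borel_measurable M" by (blast intro: F_measurable)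
    have "0 \<le> p m i" "0 \<le> p m (Suc i)" using partition_nonneg(1)[OF si(1,2)] i by auto
    then show "(\<lambda>\<omega>. l (Z (min (p m (Suc i)) t) \<omega>)) \<in> borel_measurable M" "(\<lambda>\<omega>. l (Z (min (p m i) t) \<omega>)) \<in> borel_measurable M"
      using t by (auto intro!: functional_square_integrable l)
  qed
  define G where "G = ennreal (gauss_variance l)"
  have bound: "msq (\<lambda>\<omega>. R \<omega> - I \<omega>) \<le> 2 * B m + 2 * (G * (2 * A m + ennreal (2 * gauss_variance k * \<delta> * t)))" for m
  proof -
    have "msq (\<lambda>\<omega>. R \<omega> - I \<omega>) = msq (\<lambda>\<omega>. (S m \<omega> - I \<omega>) - (S m \<omega> - R \<omega>))" by simp
    also have "\<dots> \<le> 2 * B m + 2 * msq (\<lambda>\<omega>. S m \<omega> - R \<omega>)"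
      unfolding B_def by (intro msq_diff_le) measurable
    also have "\<dots> \<le> 2 * B m + 2 * (G * (2 * A m + ennreal (2 * gauss_variance k * \<delta> * t)))"
      unfolding S_def R_def G_def A_def
      by (intro add_left_mono mult_left_mono simple_vs_riemann l k t q simple) auto
    finally show ?thesis .
  qed
  have lim: "(\<lambda>m. 2 * B m + 2 * (G * (2 * A m + ennreal (2 * gauss_variance k * \<delta> * t))))
      \<longlonglongrightarrow> 2 * 0 + 2 * (G * (2 * 0 + ennreal (2 * gauss_variance k * \<delta> * t)))"
    using lim1 lim2 unfolding A_def B_def S_def G_def
    by (intro tendsto_add ennreal_tendsto_cmult tendsto_const) auto
  have "msq (\<lambda>\<omega>. R \<omega> - I \<omega>) \<le> 2 * 0 + 2 * (G * (2 * 0 + ennreal (2 * gauss_variance k * \<delta> * t)))"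
    by (rule tendsto_lowerbound[OF lim]) (use bound in auto)
  also have "\<dots> = ennreal (4 * gauss_variance l * gauss_variance k * \<delta> * t)"
    using t \<delta> gauss_variance_nonneg[of k] gauss_variance_nonneg[of l]
    by (simp add: G_def ennreal_mult[symmetric] flip: ennreal_numeral)
  finally show ?thesis by (simp add: R_def)
qed

end

section \<open>Products of Gaussian steps are Riemann sums of the horizontal Brownian motion\<close>

definition gauss_step :: "real \<Rightarrow> ('d::finite heis \<Rightarrow>\<^sub>C 'v::euclidean_space) \<Rightarrow> ('d heis \<Rightarrow>\<^sub>C 'v)" where
  "gauss_step h = right_average gauss (\<lambda>\<zeta>. (sqrt h *\<^sub>R \<zeta>, 0))"

text \<open>The operator product over the increments of \<open>q\<close>, in which the first step stands on the left and acts
  last.\<close>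

primrec step_product ::
  "(nat \<Rightarrow> real) \<Rightarrow> nat \<Rightarrow> ('d::finite heis \<Rightarrow>\<^sub>C 'v::euclidean_space) \<Rightarrow> ('d heis \<Rightarrow>\<^sub>C 'v)" where
  "step_product q 0 f = f"
| "step_product q (Suc n) f = step_product q n (gauss_step (q (Suc n) - q n) f)"

lemma gauss_step_measurable: "(\<lambda>\<zeta>. (sqrt h *\<^sub>R \<zeta>, 0 :: real)) \<in> borel_measurable (gauss :: 'd::finite phase measure)"
  by (intro borel_measurable_Pair) (simp_all add: gauss_def)

lemma step_product_uniform:
  assumes "\<And>i. i < n \<Longrightarrow> q (Suc i) - q i = h"
  shows "step_product q n f = (gauss_step h ^^ n) f"
  using assms
proof (induction n arbitrary: f)
  case (Suc n)
  then have "step_product q (Suc n) f = (gauss_step h ^^ n) (gauss_step h f)" by simp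
  then show ?case by (simp add: funpow_swap1)
qed simp

lemma step_product_append:
  "step_product q (n + m) f = step_product q n (step_product (\<lambda>i. q (n + i)) m f)"
  by (induction m arbitrary: f) auto

context two_brownian_motions
begin

text \<open>The central component of the product of the increments \<open>(Z (q (Suc i)) - Z (q i), 0)\<close> in the
  Heisenberg group. It is also the Riemann sum of the Ito integrals that define \<open>A\<close>.\<close>

definition area :: "(nat \<Rightarrow> real) \<Rightarrow> nat \<Rightarrow> 'w \<Rightarrow> real" where
  "area q n \<omega> = (\<Sum>i<n. symp (Z (q i) \<omega>) (Z (q (Suc i)) \<omega> - Z (q i) \<omega>))"

lemma gauss_step_0: "gauss_step 0 (f :: 'd heis \<Rightarrow>\<^sub>C 'v::euclidean_space) = f"
proof (rule bcontfun_eqI)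
  interpret G: prob_space "gauss :: 'd phase measure" by (rule prob_space_gauss)
  show "gauss_step 0 f \<xi> = f \<xi>" for \<xi>
    unfolding gauss_step_def apply_right_average[OF prob_space_gauss gauss_step_measurable]
    by (simp add: zero_prod_def[symmetric] G.prob_space)
qed

text \<open>The increment is independent of \<open>X\<close> and has the law of \<open>sqrt (t - s) *\<^sub>R \<zeta>\<close> under \<open>gauss\<close>, so Fubini's theorem
  integrates it out.\<close>

lemma expectation_gauss_step:
  fixes f :: "'d heis \<Rightarrow>\<^sub>C 'v::euclidean_space" and X :: "'w \<Rightarrow> 'd heis"
  assumes st: "0 \<le> s" "s \<le> t" and X: "X \<in> borel_measurable (F s)"
  shows "(\<integral>\<omega>. f (heis_mult (X \<omega>) (Z t \<omega> - Z s \<omega>, 0)) \<partial>M) = (\<integral>\<omega>. gauss_step (t - s) f (X \<omega>) \<partial>M)"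
proof (cases "s = t")
  case True
  then show ?thesis by (simp add: gauss_step_0 zero_prod_def[symmetric])
next
  case False
  with st have "s < t" by simp
  define D where "D \<omega> = (Z t \<omega> - Z s \<omega>, 0 :: real)" for \<omega>
  have XM [measurable]: "X \<in> borel_measurable M" using X by (rule F_measurable)
  have i: "indep_var borel X borel D"
    unfolding D_def using increment_indep_var[OF st(1) \<open>s < t\<close> X, of "\<lambda>z. (z, 0)"] by simp
  have DM [measurable]: "D \<in> borel_measurable M" by (rule indep_var_rv2[OF i])
  interpret DX: prob_space "distr M borel X" by (rule prob_space_distr) simp
  interpret DD: prob_space "distr M borel D" by (rule prob_space_distr) simp
  interpret P: pair_prob_space "distr M borel X" "distr M borel D" ..
  have joint: "distr M borel X \<Otimes>\<^sub>M distr M borel D = distr M (borel \<Otimes>\<^sub>M borel) (\<lambda>\<omega>. (X \<omega>, D \<omega>))"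
    using i by (simp add: indep_var_distribution_eq)
  have \<Delta>: "(\<lambda>\<omega>. Z t \<omega> - Z s \<omega>) \<in> borel_measurable M"
    using st by (intro borel_measurable_diff Z_measurable) auto
  have "distr M borel D = distr (distr M borel (\<lambda>\<omega>. Z t \<omega> - Z s \<omega>)) borel (\<lambda>z. (z, 0 :: real))"
    using \<Delta> by (subst distr_distr) (auto simp: o_def D_def[abs_def])
  also have "\<dots> = distr gauss borel (\<lambda>\<zeta>. (sqrt (t - s) *\<^sub>R \<zeta>, 0))"
    unfolding distr_increment[OF st(1) \<open>s < t\<close>]
    by (subst distr_distr) (auto simp: o_def gauss_def)
  finally have law: "distr M borel D = distr gauss borel (\<lambda>\<zeta>. (sqrt (t - s) *\<^sub>R \<zeta>, 0))" .
  have fm: "(\<lambda>p. f (heis_mult (fst p) (snd p))) \<in> borel_measurable (borel \<Otimes>\<^sub>M borel)"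
    by measurable
  have int: "integrable (distr M borel X \<Otimes>\<^sub>M distr M borel D) (\<lambda>p. f (heis_mult (fst p) (snd p)))"
    unfolding joint
    by (subst integrable_distr_eq) (use fm in \<open>auto intro!: bcontfun_integrable prob_space_axioms\<close>)
  have "(\<integral>\<omega>. f (heis_mult (X \<omega>) (D \<omega>)) \<partial>M) =
      (\<integral>p. f (heis_mult (fst p) (snd p)) \<partial>(distr M borel X \<Otimes>\<^sub>M distr M borel D))"
    unfolding joint by (subst integral_distr) (use fm in auto)
  also have "\<dots> = (\<integral>x. (\<integral>y. f (heis_mult x y) \<partial>distr M borel D) \<partial>distr M borel X)"
    using P.integral_fst'[OF int] by simp
  also have "\<dots> = (\<integral>x. gauss_step (t - s) f x \<partial>distr M borel X)"
  proof (rule Bochner_Integration.integral_cong[OF refl])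
    fix x
    have "(\<integral>y. f (heis_mult x y) \<partial>distr M borel D) = (\<integral>\<zeta>. f (heis_mult x (sqrt (t - s) *\<^sub>R \<zeta>, 0)) \<partial>gauss)"
      unfolding law by (rule integral_distr[OF gauss_step_measurable]) measurable
    then show "(\<integral>y. f (heis_mult x y) \<partial>distr M borel D) = gauss_step (t - s) f x"
      unfolding gauss_step_def apply_right_average[OF prob_space_gauss gauss_step_measurable] by simp
  qed
  also have "\<dots> = (\<integral>\<omega>. gauss_step (t - s) f (X \<omega>) \<partial>M)"
    by (rule integral_distr) auto
  finally show ?thesis by (simp add: D_def)
qed

lemma area_adapted:
  assumes q: "0 \<le> q 0" "\<And>i. i < n \<Longrightarrow> q i \<le> q (Suc i)" and m: "m \<le> n"
  shows "area q m \<in> borel_measurable (F (q n))"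
  unfolding area_def[abs_def]
proof (intro borel_measurable_sum symp_measurable borel_measurable_diff)
  fix i assume "i \<in> {..<m}"
  then show "Z (q i) \<in> borel_measurable (F (q n))" "Z (q i) \<in> borel_measurable (F (q n))" "Z (q (Suc i)) \<in> borel_measurable (F (q n))"
    using partition_nonneg[OF q, of n i] partition_nonneg[OF q, of n "Suc i"] m by (auto intro!: Z_adapted)
qed

text \<open>A product of Gaussian steps is the expectation along the polygonal path through the group with
  increments \<open>(Z (q (Suc i)) - Z (q i), 0)\<close>: the last step is integrated out by independence, and the
  rest is an instance of the claim for the averaged function.\<close>

lemma expectation_step_product:
  fixes f :: "'d heis \<Rightarrow>\<^sub>C 'v::euclidean_space"
  assumes q: "q 0 = 0" "\<And>i. i < n \<Longrightarrow> q i \<le> q (Suc i)"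
  shows "(\<integral>\<omega>. f (heis_mult \<xi> (Z (q n) \<omega>, area q n \<omega>)) \<partial>M) = step_product q n f \<xi>"
  using q(2)
proof (induction n arbitrary: f)
  case 0
  have m: "(\<lambda>\<omega>. f (heis_mult \<xi> (Z 0 \<omega>, 0))) \<in> borel_measurable M"
    using Z_measurable[of 0] by measurable
  have "(\<integral>\<omega>. f (heis_mult \<xi> (Z 0 \<omega>, 0)) \<partial>M) = (\<integral>\<omega>. f \<xi> \<partial>M)"
  proof (rule integral_cong_AE[OF m])
    show "AE \<omega> in M. f (heis_mult \<xi> (Z 0 \<omega>, 0)) = f \<xi>"
      using AE_Z_0 by eventually_elim (simp add: zero_prod_def[symmetric])
  qed simp
  then show ?case by (simp add: q area_def prob_space)
next
  case (Suc n)
  have mono: "\<And>i. i < n \<Longrightarrow> q i \<le> q (Suc i)" using Suc.prems by simp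
  have q0: "0 \<le> q n" using partition_nonneg[of q n n] q(1) mono by simp
  define X where "X \<omega> = heis_mult \<xi> (Z (q n) \<omega>, area q n \<omega>)" for \<omega>
  have "X \<in> borel_measurable (F (q n))"
    unfolding X_def
    by (intro heis_mult_measurable borel_measurable_const borel_measurable_Pair Z_adapted area_adapted)
       (use q mono q0 in auto)
  note step = expectation_gauss_step[OF q0 Suc.prems[of n] this]
  have "heis_mult \<xi> (Z (q (Suc n)) \<omega>, area q (Suc n) \<omega>) = heis_mult (X \<omega>) (Z (q (Suc n)) \<omega> - Z (q n) \<omega>, 0)" for \<omega>
    unfolding X_def heis_mult_assoc by (simp add: heis_mult_def area_def)
  then have "(\<integral>\<omega>. f (heis_mult \<xi> (Z (q (Suc n)) \<omega>, area q (Suc n) \<omega>)) \<partial>M) =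
      (\<integral>\<omega>. gauss_step (q (Suc n) - q n) f (X \<omega>) \<partial>M)"
    using step by simp
  also have "\<dots> = step_product q n (gauss_step (q (Suc n) - q n) f) \<xi>"
    unfolding X_def by (rule Suc.IH[OF mono])
  finally show ?case by simp
qed

end

locale horizontal_bm = two_brownian_motions M B1 B2 for M :: "'w measure" and B1 B2 :: "real \<Rightarrow> 'w \<Rightarrow> real^'d::finite" +
  fixes A :: "real \<Rightarrow> 'w \<Rightarrow> real"
  assumes A_measurable: "\<And>t. t \<ge> 0 \<Longrightarrow> A t \<in> borel_measurable M"
    and A_ito: "\<And>t. t \<ge> 0 \<Longrightarrow> \<exists>I J.
      (\<forall>j. is_ito_integral M F (\<lambda>r \<omega>. B2 r \<omega> $ j) (\<lambda>r \<omega>. B1 r \<omega> $ j) t (I j)) \<and>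
      (\<forall>j. is_ito_integral M F (\<lambda>r \<omega>. B1 r \<omega> $ j) (\<lambda>r \<omega>. B2 r \<omega> $ j) t (J j)) \<and>
      (AE \<omega> in M. A t \<omega> = (\<Sum>j\<in>UNIV. I j \<omega> - J j \<omega>))"
begin

definition area_const :: real where
  "area_const = (\<Sum>j\<in>UNIV. 16 * real CARD('d) *
     (gauss_variance (\<lambda>z :: 'd phase. fst z $ j) * gauss_variance (\<lambda>z :: 'd phase. snd z $ j)))"

lemma area_const_nonneg: "area_const \<ge> 0"
  unfolding area_const_def by (intro sum_nonneg mult_nonneg_nonneg gauss_variance_nonneg) auto

lemma coordinates_bounded_linear:
  "bounded_linear (\<lambda>z :: 'd phase. fst z $ j)" "bounded_linear (\<lambda>z :: 'd phase. snd z $ j)"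
  by (auto intro: bounded_linear_compose[OF bounded_linear_vec_nth] bounded_linear_fst bounded_linear_snd)

text \<open>Coordinatewise, the area is a difference of \<open>2 * CARD('d)\<close> Riemann sums of Ito integrals.\<close>

lemma area_error:
  assumes q: "q 0 = 0" "q n = t" "\<And>i. i < n \<Longrightarrow> q i \<le> q (Suc i)" "\<And>i. i < n \<Longrightarrow> q (Suc i) - q i \<le> \<delta>"
    and t: "t \<ge> 0" and \<delta>: "\<delta> \<ge> 0"
  shows "integrable M (\<lambda>\<omega>. (A t \<omega> - area q n \<omega>)\<^sup>2)"
    and "expectation (\<lambda>\<omega>. (A t \<omega> - area q n \<omega>)\<^sup>2) \<le> area_const * \<delta> * t"
proof -
  define l :: "'d \<Rightarrow> 'd phase \<Rightarrow> real" where "l j = (\<lambda>z. fst z $ j)" for j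
  define k :: "'d \<Rightarrow> 'd phase \<Rightarrow> real" where "k j = (\<lambda>z. snd z $ j)" for j
  have lk: "bounded_linear (l j)" "bounded_linear (k j)" for j
    unfolding l_def k_def by (rule coordinates_bounded_linear)+
  obtain I J where I: "\<And>j. is_ito_integral M F (\<lambda>r \<omega>. k j (Z r \<omega>)) (\<lambda>r \<omega>. l j (Z r \<omega>)) t (I j)"
    and J: "\<And>j. is_ito_integral M F (\<lambda>r \<omega>. l j (Z r \<omega>)) (\<lambda>r \<omega>. k j (Z r \<omega>)) t (J j)"
    and AIJ: "AE \<omega> in M. A t \<omega> = (\<Sum>j\<in>UNIV. I j \<omega> - J j \<omega>)"
    using A_ito[OF t] unfolding Z_def l_def k_def fst_conv snd_conv by blast
  have IJ_meas [measurable]: "I j \<in> borel_measurable M" "J j \<in> borel_measurable M" for j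
    using I[of j] J[of j] by (auto simp: is_ito_integral_def)
  define R1 where "R1 j \<omega> = (\<Sum>i<n. k j (Z (q i) \<omega>) * incr (l j) (q i) (q (Suc i)) \<omega>)" for j \<omega>
  define R2 where "R2 j \<omega> = (\<Sum>i<n. l j (Z (q i) \<omega>) * incr (k j) (q i) (q (Suc i)) \<omega>)" for j \<omega>
  define c where "c j = 4 * (gauss_variance (l j) * gauss_variance (k j))" for j
  have c_nonneg: "c j \<ge> 0" for j by (simp add: c_def gauss_variance_nonneg)
  have q0: "0 \<le> q i" "q i \<le> t" if "i \<le> n" for i
    using partition_nonneg[of q n i] q that by auto
  have R_meas [measurable]: "R1 j \<in> borel_measurable M" "R2 j \<in> borel_measurable M" for j
  proof -
    have "incr u (q i) (q (Suc i)) \<in> borel_measurable M" if "bounded_linear u" "i < n" for i u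
      using q0[of i] q0[of "Suc i"] that by (auto intro!: F_measurable[OF incr_adapted[of u "q i" t "q (Suc i)"]])
    then show "R1 j \<in> borel_measurable M" "R2 j \<in> borel_measurable M"
      unfolding R1_def[abs_def] R2_def[abs_def]
      using q0 lk by (auto intro!: borel_measurable_sum borel_measurable_times functional_square_integrable)
  qed
  have e1: "msq (\<lambda>\<omega>. R1 j \<omega> - I j \<omega>) \<le> ennreal (c j * \<delta> * t)"
    and e2: "msq (\<lambda>\<omega>. R2 j \<omega> - J j \<omega>) \<le> ennreal (c j * \<delta> * t)" for j
    using ito_riemann_error[OF lk(1)[of j] lk(2)[of j] t q I \<delta>] ito_riemann_error[OF lk(2)[of j] lk(1)[of j] t q J \<delta>]
    unfolding R1_def R2_def c_def by (simp_all add: mult_ac)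
  have area: "area q n \<omega> = (\<Sum>j\<in>UNIV. R1 j \<omega> - R2 j \<omega>)" for \<omega>
  proof -
    have "symp z (z' - z) = (\<Sum>j\<in>UNIV. k j z * (l j z' - l j z) - l j z * (k j z' - k j z))" for z z' :: "'d phase"
      by (cases z; cases z')
         (simp add: symp_def inner_vec_def l_def k_def sum_subtractf[symmetric] algebra_simps)
    then have "area q n \<omega> = (\<Sum>i<n. \<Sum>j\<in>UNIV. k j (Z (q i) \<omega>) * incr (l j) (q i) (q (Suc i)) \<omega>
        - l j (Z (q i) \<omega>) * incr (k j) (q i) (q (Suc i)) \<omega>)"
      by (simp add: area_def incr_def)
    then show ?thesis
      by (subst (asm) sum.swap) (simp add: R1_def R2_def sum_subtractf)
  qed
  have area_meas [measurable]: "area q n \<in> borel_measurable M"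
    unfolding area[abs_def] by measurable
  have [measurable]: "A t \<in> borel_measurable M" using A_measurable[OF t] .
  define d where "d = real CARD('d)"
  have nn: "c j * \<delta> * t \<ge> 0" for j using c_nonneg t \<delta> by simp
  have "msq (\<lambda>\<omega>. A t \<omega> - area q n \<omega>) = msq (\<lambda>\<omega>. \<Sum>j\<in>UNIV. (R2 j \<omega> - J j \<omega>) - (R1 j \<omega> - I j \<omega>))"
    unfolding msq_def
  proof (rule nn_integral_cong_AE)
    show "AE \<omega> in M. ennreal ((A t \<omega> - area q n \<omega>)\<^sup>2)
        = ennreal ((\<Sum>j\<in>UNIV. (R2 j \<omega> - J j \<omega>) - (R1 j \<omega> - I j \<omega>))\<^sup>2)"
      using AIJ
    proof eventually_elim
      case (elim \<omega>)
      show ?case unfolding elim area by (simp add: sum_subtractf sum.distrib algebra_simps)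
    qed
  qed
  also have "\<dots> \<le> of_nat CARD('d) * (\<Sum>j\<in>UNIV. msq (\<lambda>\<omega>. (R2 j \<omega> - J j \<omega>) - (R1 j \<omega> - I j \<omega>)))"
    by (intro msq_sum_le) measurable
  also have "\<dots> \<le> of_nat CARD('d) * (\<Sum>j\<in>UNIV. 2 * ennreal (c j * \<delta> * t) + 2 * ennreal (c j * \<delta> * t))"
  proof (intro mult_left_mono sum_mono)
    fix j
    have "msq (\<lambda>\<omega>. (R2 j \<omega> - J j \<omega>) - (R1 j \<omega> - I j \<omega>))
        \<le> 2 * msq (\<lambda>\<omega>. R2 j \<omega> - J j \<omega>) + 2 * msq (\<lambda>\<omega>. R1 j \<omega> - I j \<omega>)"
      by (intro msq_diff_le) measurable
    also have "\<dots> \<le> 2 * ennreal (c j * \<delta> * t) + 2 * ennreal (c j * \<delta> * t)"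
      by (intro add_mono mult_left_mono e1 e2) auto
    finally show "msq (\<lambda>\<omega>. (R2 j \<omega> - J j \<omega>) - (R1 j \<omega> - I j \<omega>)) \<le> \<dots>" .
  qed simp
  also have "\<dots> = ennreal (real CARD('d) * (\<Sum>j\<in>UNIV. 4 * (c j * \<delta> * t)))"
  proof -
    have four: "2 * ennreal x + 2 * ennreal x = ennreal (4 * x)" if "x \<ge> 0" for x :: real
    proof -
      have "ennreal (4 * x) = ennreal (2 * x + 2 * x)" by simp
      also have "\<dots> = ennreal (2 * x) + ennreal (2 * x)" using that by (intro ennreal_plus) auto
      finally show ?thesis using that by (simp add: ennreal_mult)
    qed
    have "(\<Sum>j\<in>UNIV. 2 * ennreal (c j * \<delta> * t) + 2 * ennreal (c j * \<delta> * t)) = ennreal (\<Sum>j\<in>UNIV. 4 * (c j * \<delta> * t))"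
      unfolding four[OF nn] using nn by (intro sum_ennreal) simp
    then show ?thesis
      using nn by (simp add: ennreal_mult sum_nonneg ennreal_of_nat_eq_real_of_nat del: sum_ennreal)
  qed
  also have "real CARD('d) * (\<Sum>j\<in>UNIV. 4 * (c j * \<delta> * t)) = area_const * \<delta> * t"
    unfolding area_const_def sum_distrib_right sum_distrib_left
    by (intro sum.cong) (auto simp: c_def l_def k_def)
  finally have bound: "(\<integral>\<^sup>+ \<omega>. ennreal ((A t \<omega> - area q n \<omega>)\<^sup>2) \<partial>M) \<le> ennreal (area_const * \<delta> * t)"
    by (simp add: msq_def)
  show int: "integrable M (\<lambda>\<omega>. (A t \<omega> - area q n \<omega>)\<^sup>2)"
    using le_less_trans[OF bound ennreal_less_top] by (intro integrableI_nonneg) auto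
  show "expectation (\<lambda>\<omega>. (A t \<omega> - area q n \<omega>)\<^sup>2) \<le> area_const * \<delta> * t"
    using bound t \<delta> area_const_nonneg by (subst (asm) nn_integral_eq_integral[OF int]) (auto simp: ennreal_le_iff)
qed

definition V :: "real \<Rightarrow> ('d heis \<Rightarrow>\<^sub>C 'v::euclidean_space) \<Rightarrow> ('d heis \<Rightarrow>\<^sub>C 'v)" where
  "V t = right_average M (\<lambda>\<omega>. (Z t \<omega>, A t \<omega>))"

lemma W_measurable: "t \<ge> 0 \<Longrightarrow> (\<lambda>\<omega>. (Z t \<omega>, A t \<omega>)) \<in> borel_measurable M"
  by (intro borel_measurable_Pair Z_measurable A_measurable)

lemmas V_lin = right_average_bounded_linear[OF prob_space_axioms W_measurable, folded V_def]
lemmas V_C0 = right_average_C0[OF prob_space_axioms W_measurable, folded V_def]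
lemmas step_lin = right_average_bounded_linear[OF prob_space_gauss gauss_step_measurable, folded gauss_step_def]
lemmas step_C0 = right_average_C0[OF prob_space_gauss gauss_step_measurable, folded gauss_step_def]

text \<open>Both sides are expectations of \<open>f\<close> at points with the same horizontal component, whose central
  components differ by \<open>A t - area q n\<close>. This is a right translation by a central element, and
  \<open>f\<close> changes little under small ones; large differences are rare by Chebyshev's inequality and cost at most twice
  the norm of \<open>f\<close>. The bound depends on the mesh only, which allows partitions with two step lengths
  in the proof of the semigroup law.\<close>

lemma step_product_approximates_V:
  fixes f :: "'d heis \<Rightarrow>\<^sub>C 'v::euclidean_space"
  assumes f: "f \<in> C0" and e: "e > 0" and \<tau>: "\<tau> \<ge> 0"
  obtains d where "d > 0" "\<And>q n t \<delta>. q 0 = 0 \<Longrightarrow> q n = t \<Longrightarrow> 0 \<le> t \<Longrightarrow> t \<le> \<tau> \<Longrightarrow> (\<And>i. i < n \<Longrightarrow> q i \<le> q (Suc i)) \<Longrightarrow>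
    (\<And>i. i < n \<Longrightarrow> q (Suc i) - q i \<le> \<delta>) \<Longrightarrow> 0 \<le> \<delta> \<Longrightarrow> \<delta> \<le> d \<Longrightarrow> norm (step_product q n f - V t f) \<le> e"
proof -
  obtain r where r: "r > 0" "\<And>\<xi> \<kappa>. norm \<kappa> < r \<Longrightarrow> norm (f (heis_mult \<xi> \<kappa>) - f \<xi>) < e / 2"
    using C0_right_translation[OF f, of "e / 2"] e by (metis half_gt_zero)
  \<comment> \<open>The Chebyshev constant: if a translation is at least \<open>r\<close>, then \<open>b\<close> times its square is at least \<open>2 * norm f\<close>.\<close>
  define b where "b = 2 * norm f / r\<^sup>2"
  have b: "b \<ge> 0" by (simp add: b_def)
  define B where "B = b * area_const * \<tau> + 1"
  define d where "d = (e / 2) / B"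
  have pos: "B > 0" unfolding B_def using b area_const_nonneg \<tau> by (simp add: add_nonneg_pos)
  have d: "d > 0" using e pos by (simp add: d_def)
  have "norm (step_product q n f - V t f) \<le> e"
    if q: "q 0 = 0" "q n = t" and t: "0 \<le> t" "t \<le> \<tau>" and q': "\<And>i. i < n \<Longrightarrow> q i \<le> q (Suc i)"
      "\<And>i. i < n \<Longrightarrow> q (Suc i) - q i \<le> \<delta>" and \<delta>: "0 \<le> \<delta>" "\<delta> \<le> d" for q n t \<delta>
  proof (rule norm_bound)
    fix \<xi>
    have err: "integrable M (\<lambda>\<omega>. (A t \<omega> - area q n \<omega>)\<^sup>2)"
      "expectation (\<lambda>\<omega>. (A t \<omega> - area q n \<omega>)\<^sup>2) \<le> area_const * \<delta> * t"
      by (rule area_error[OF q q' t(1) \<delta>(1)]; assumption)+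
    define P where "P \<omega> = (Z t \<omega>, area q n \<omega>)" for \<omega>
    define W where "W \<omega> = (Z t \<omega>, A t \<omega>)" for \<omega>
    have "area q n \<in> borel_measurable M" using area_adapted[of q n n] q(1) q' by (auto intro: F_measurable)
    then have [measurable]: "P \<in> borel_measurable M" unfolding P_def using t by (intro borel_measurable_Pair Z_measurable)
    have [measurable]: "W \<in> borel_measurable M" unfolding W_def using t by (intro W_measurable)
    have pointwise: "norm (f (heis_mult \<xi> (P \<omega>)) - f (heis_mult \<xi> (W \<omega>))) \<le> e / 2 + b * (A t \<omega> - area q n \<omega>)\<^sup>2" for \<omega>
    proof -
      define \<kappa> where "\<kappa> = (0 :: 'd phase, A t \<omega> - area q n \<omega>)"
      have W: "heis_mult \<xi> (W \<omega>) = heis_mult (heis_mult \<xi> (P \<omega>)) \<kappa>"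
        unfolding heis_mult_assoc by (simp add: W_def P_def \<kappa>_def heis_mult_vertical)
      have \<kappa>: "norm \<kappa> = \<bar>A t \<omega> - area q n \<omega>\<bar>" by (simp add: \<kappa>_def norm_prod_def)
      show ?thesis
      proof (cases "norm \<kappa> < r")
        case True
        have "norm (f (heis_mult \<xi> (P \<omega>)) - f (heis_mult \<xi> (W \<omega>))) \<le> e / 2"
          unfolding W using r(2)[OF True, of "heis_mult \<xi> (P \<omega>)"] by (simp add: norm_minus_commute)
        then show ?thesis using b by (simp add: add_increasing2)
      next
        case False
        then have "r\<^sup>2 \<le> \<bar>A t \<omega> - area q n \<omega>\<bar>\<^sup>2" using r(1) \<kappa> by (intro power_mono) auto
        then have "1 \<le> (A t \<omega> - area q n \<omega>)\<^sup>2 / r\<^sup>2" using r(1) by (simp add: le_divide_eq)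
        then have "2 * norm f * 1 \<le> 2 * norm f * ((A t \<omega> - area q n \<omega>)\<^sup>2 / r\<^sup>2)" by (intro mult_left_mono) auto
        moreover have "norm (f (heis_mult \<xi> (P \<omega>)) - f (heis_mult \<xi> (W \<omega>))) \<le> norm f + norm f"
          by (intro order_trans[OF norm_triangle_ineq4] add_mono norm_bounded)
        ultimately show ?thesis using e by (simp add: b_def)
      qed
    qed
    have intP: "integrable M (\<lambda>\<omega>. f (heis_mult \<xi> (P \<omega>)))" and intW: "integrable M (\<lambda>\<omega>. f (heis_mult \<xi> (W \<omega>)))"
      by (intro bcontfun_integrable prob_space_axioms; measurable)+
    have "(step_product q n f - V t f) \<xi> = (\<integral>\<omega>. f (heis_mult \<xi> (P \<omega>)) - f (heis_mult \<xi> (W \<omega>)) \<partial>M)"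
      using expectation_step_product[of q n f \<xi>] q q'(1) intP intW t(1)
      unfolding V_def by (simp add: apply_right_average[OF prob_space_axioms W_measurable] P_def W_def)
    also have "norm \<dots> \<le> (\<integral>\<omega>. e / 2 + b * (A t \<omega> - area q n \<omega>)\<^sup>2 \<partial>M)"
      using pointwise err(1) intP intW by (intro order_trans[OF integral_norm_bound] Bochner_Integration.integral_mono Bochner_Integration.integrable_norm) auto
    also have "\<dots> = e / 2 + b * expectation (\<lambda>\<omega>. (A t \<omega> - area q n \<omega>)\<^sup>2)"
      using err(1) by (simp add: prob_space)
    also have "b * expectation (\<lambda>\<omega>. (A t \<omega> - area q n \<omega>)\<^sup>2) \<le> b * (area_const * d * \<tau>)"
      using err(2) \<delta> t area_const_nonneg d
      by (intro mult_left_mono order_trans[OF err(2)] mult_mono b) auto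
    also have "\<dots> = (b * area_const * \<tau>) * d" by simp
    also have "\<dots> \<le> B * d" using d by (intro mult_right_mono) (auto simp: B_def)
    also have "\<dots> = e / 2" using pos by (simp add: d_def)
    finally show "norm ((step_product q n f - V t f) \<xi>) \<le> e" by simp
  qed
  then show ?thesis using that d by blast
qed

lemma steps_approximate_V:
  fixes f :: "'d heis \<Rightarrow>\<^sub>C 'v::euclidean_space"
  assumes f: "f \<in> C0" and \<tau>: "\<tau> \<ge> 0"
  shows "approximates \<tau> gauss_step V f"
  unfolding approximates_def
proof (intro allI impI)
  fix e :: real assume e: "e > 0"
  obtain d where d: "d > 0" "\<And>q n t \<delta>. q 0 = 0 \<Longrightarrow> q n = t \<Longrightarrow> 0 \<le> t \<Longrightarrow> t \<le> \<tau> \<Longrightarrow> (\<And>i. i < n \<Longrightarrow> q i \<le> q (Suc i)) \<Longrightarrow>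
    (\<And>i. i < n \<Longrightarrow> q (Suc i) - q i \<le> \<delta>) \<Longrightarrow> 0 \<le> \<delta> \<Longrightarrow> \<delta> \<le> d \<Longrightarrow> norm (step_product q n f - V t f) \<le> e"
    using step_product_approximates_V[OF f e \<tau>] by blast
  have "norm ((gauss_step h ^^ m) f - V (real m * h) f) \<le> e" if "0 \<le> h" "h < d" "real m * h \<le> \<tau>" for h m
  proof -
    have "step_product (\<lambda>i. real i * h) m f = (gauss_step h ^^ m) f"
      by (rule step_product_uniform) (simp add: algebra_simps)
    moreover have "norm (step_product (\<lambda>i. real i * h) m f - V (real m * h) f) \<le> e"
      using that by (intro d(2)[of "\<lambda>i. real i * h" m "real m * h" h]) (auto simp: algebra_simps)
    ultimately show ?thesis by simp
  qed
  then show "\<exists>d>0. \<forall>h m. 0 \<le> h \<and> h < d \<and> real m * h \<le> \<tau> \<longrightarrow>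
      norm ((gauss_step h ^^ m) f - V (real m * h) f) \<le> e" using d(1) by blast
qed

lemma step_pow_contraction:
  fixes f g :: "'d heis \<Rightarrow>\<^sub>C 'v::euclidean_space"
  shows "norm ((gauss_step h ^^ n) f - (gauss_step h ^^ n) g) \<le> norm (f - g)"
proof (induction n)
  case (Suc n)
  have "(gauss_step h ^^ Suc n) f - (gauss_step h ^^ Suc n) g = gauss_step h ((gauss_step h ^^ n) f - (gauss_step h ^^ n) g)"
    by (simp add: linear_diff[OF bounded_linear.linear[OF step_lin(1)]])
  then show ?case using step_lin(2)[of h "(gauss_step h ^^ n) f - (gauss_step h ^^ n) g"] Suc by simp
qed simp

lemma V_0: "f \<in> C0 \<Longrightarrow> V 0 f = (f :: 'd heis \<Rightarrow>\<^sub>C 'v::euclidean_space)"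
proof -
  assume f: "f \<in> C0"
  have "norm (f - V 0 f) \<le> 0"
  proof (rule field_le_epsilon)
    fix e :: real assume "e > 0"
    then obtain d where "d > 0" "\<And>h m. 0 \<le> h \<Longrightarrow> h < d \<Longrightarrow> real m * h \<le> 0 \<Longrightarrow> norm ((gauss_step h ^^ m) f - V (real m * h) f) \<le> e"
      using approximatesE[OF steps_approximate_V[OF f, of 0]] by (metis order_refl)
    from this(2)[of 0 0] this(1) show "norm (f - V 0 f) \<le> 0 + e" by simp
  qed
  then show ?thesis by simp
qed

text \<open>The partition of \<open>[0, s + t]\<close> into \<open>n\<close> steps of length \<open>s / n\<close> followed by \<open>n\<close> steps of length \<open>t / n\<close>
  approximates \<open>V (s + t)\<close>, while its product factors into products that approximate \<open>V s\<close> and \<open>V t\<close>.\<close>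

lemma V_add:
  fixes f :: "'d heis \<Rightarrow>\<^sub>C 'v::euclidean_space"
  assumes s: "s \<ge> 0" and t: "t \<ge> 0" and f: "f \<in> C0"
  shows "V (s + t) f = V s (V t f)"
proof -
  have "norm (V (s + t) f - V s (V t f)) \<le> 0"
  proof (rule field_le_epsilon)
    fix e :: real assume e: "e > 0"
    \<comment> \<open>One share of the error for each of the products over \<open>[0, s + t]\<close>, \<open>[0, s]\<close> and \<open>[0, t]\<close>.\<close>
    define e' where "e' = e / 3"
    have e': "e' > 0" using e by (simp add: e'_def)
    obtain d1 where d1: "d1 > 0" "\<And>q n t' \<delta>. q 0 = 0 \<Longrightarrow> q n = t' \<Longrightarrow> 0 \<le> t' \<Longrightarrow> t' \<le> s + t \<Longrightarrow> (\<And>i. i < n \<Longrightarrow> q i \<le> q (Suc i)) \<Longrightarrow>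
      (\<And>i. i < n \<Longrightarrow> q (Suc i) - q i \<le> \<delta>) \<Longrightarrow> 0 \<le> \<delta> \<Longrightarrow> \<delta> \<le> d1 \<Longrightarrow> norm (step_product q n f - V t' f) \<le> e'"
      using step_product_approximates_V[OF f e', of "s + t"] s t by (metis add_nonneg_nonneg)
    obtain d2 where d2: "d2 > 0" "\<And>h m. 0 \<le> h \<Longrightarrow> h < d2 \<Longrightarrow> real m * h \<le> t \<Longrightarrow> norm ((gauss_step h ^^ m) f - V (real m * h) f) \<le> e'"
      using approximatesE[OF steps_approximate_V[OF f t] e'] by blast
    have Vt: "V t f \<in> C0" using V_C0[OF t f] .
    obtain d3 where d3: "d3 > 0" "\<And>h m. 0 \<le> h \<Longrightarrow> h < d3 \<Longrightarrow> real m * h \<le> s \<Longrightarrow> norm ((gauss_step h ^^ m) (V t f) - V (real m * h) (V t f)) \<le> e'"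
      using approximatesE[OF steps_approximate_V[OF Vt s] e'] by blast
    define D where "D = min d1 (min d2 d3)"
    have D: "D > 0" using d1(1) d2(1) d3(1) by (simp add: D_def)
    obtain n where n': "(s + t) / D < real n" using reals_Archimedean2 by blast
    have "0 \<le> (s + t) / D" using s t D by simp
    then have n0: "n > 0" using n' by (cases n) auto
    have "(s + t) / real n < D"
      using n' n0 D by (simp add: pos_divide_less_eq mult.commute)
    then have n: "n > 0" "(s + t) / real n < d1" "(s + t) / real n < d2" "(s + t) / real n < d3"
      using n0 by (auto simp: D_def)
    have sn: "s / real n \<le> (s + t) / real n" "t / real n \<le> (s + t) / real n" using s t by (auto intro: divide_right_mono)
    define q where "q i = (if i \<le> n then real i * (s / real n) else s + real (i - n) * (t / real n))" for i
    have step1: "q (Suc i) - q i = s / real n" if "i < n" for i using that by (simp add: q_def algebra_simps add_divide_distrib)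
    have step2: "q (Suc (n + i)) - q (n + i) = t / real n" for i
      using n(1) by (cases i) (simp_all add: q_def algebra_simps add_divide_distrib)
    have steps: "q (Suc i) - q i = s / real n \<or> q (Suc i) - q i = t / real n" for i
      using step1[of i] step2[of "i - n"] by (cases "i < n") auto
    have "step_product q (n + n) f = (gauss_step (s / real n) ^^ n) ((gauss_step (t / real n) ^^ n) f)"
      unfolding step_product_append
      by (subst step_product_uniform[where h = "s / real n"], simp add: step1)
         (subst step_product_uniform[where h = "t / real n"], simp_all add: step2)
    moreover have "norm (step_product q (n + n) f - V (s + t) f) \<le> e'"
    proof (rule d1(2)[of q "n + n" "s + t" "(s + t) / real n"])
      show "q (n + n) = s + t" using n(1) by (simp add: q_def)
      show "q i \<le> q (Suc i)" for i using steps[of i] s t n(1) by (smt (verit) divide_nonneg_nonneg of_nat_0_le_iff)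
      show "q (Suc i) - q i \<le> (s + t) / real n" for i using steps[of i] sn by auto
    qed (use s t n in \<open>auto simp: q_def\<close>)
    ultimately have 1: "norm ((gauss_step (s / real n) ^^ n) ((gauss_step (t / real n) ^^ n) f) - V (s + t) f) \<le> e'" by simp
    have "norm ((gauss_step (t / real n) ^^ n) f - V t f) \<le> e'"
      using d2(2)[of "t / real n" n] n sn t by simp
    then have 2: "norm ((gauss_step (s / real n) ^^ n) ((gauss_step (t / real n) ^^ n) f) - (gauss_step (s / real n) ^^ n) (V t f)) \<le> e'"
      by (rule order_trans[OF step_pow_contraction])
    have 3: "norm ((gauss_step (s / real n) ^^ n) (V t f) - V s (V t f)) \<le> e'"
      using d3(2)[of "s / real n" n] n sn s by simp
    have "norm (V (s + t) f - V s (V t f)) \<le> e' + (e' + e')"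
      using norm_diff_triangle_le[OF 1[unfolded norm_minus_commute[of _ "V (s + t) f"]] norm_diff_triangle_le[OF 2 3]] .
    then show "norm (V (s + t) f - V s (V t f)) \<le> 0 + e" by (simp add: e'_def)
  qed
  then show ?thesis by simp
qed

text \<open>Again small right translations are harmless, and the others are rare by Chebyshev's inequality
  with the second moment of \<open>sqrt t *\<^sub>R \<zeta>\<close>.\<close>

lemma gauss_step_tendsto:
  fixes f :: "'d heis \<Rightarrow>\<^sub>C 'v::euclidean_space"
  assumes f: "f \<in> C0" and e: "e > 0"
  shows "\<exists>d>0. \<forall>t. 0 \<le> t \<and> t < d \<longrightarrow> norm (gauss_step t f - f) \<le> e"
proof -
  interpret G: prob_space "gauss :: 'd phase measure" by (rule prob_space_gauss)
  obtain r where r: "r > 0" "\<And>\<xi> \<kappa>. norm \<kappa> < r \<Longrightarrow> norm (f (heis_mult \<xi> \<kappa>) - f \<xi>) < e / 2"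
    using C0_right_translation[OF f, of "e / 2"] e by (metis half_gt_zero)
  \<comment> \<open>The Chebyshev constant: if a translation is at least \<open>r\<close>, then \<open>b\<close> times its square is at least \<open>2 * norm f\<close>.\<close>
  define b where "b = 2 * norm f / r\<^sup>2"
  have b: "b \<ge> 0" by (simp add: b_def)
  define m where "m = (\<integral>\<zeta>. (norm \<zeta>)\<^sup>2 \<partial>(gauss :: 'd phase measure))"
  have m: "m \<ge> 0" by (simp add: m_def)
  define B where "B = b * m + 1"
  define d where "d = (e / 2) / B"
  have pos: "B > 0" unfolding B_def using b m by (simp add: add_nonneg_pos)
  have d: "d > 0" using e pos by (simp add: d_def)
  have "norm (gauss_step t f - f) \<le> e" if t: "0 \<le> t" "t < d" for t
  proof (rule norm_bound)
    fix \<xi>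
    have pointwise: "norm (f (heis_mult \<xi> (sqrt t *\<^sub>R \<zeta>, 0)) - f \<xi>) \<le> e / 2 + b * t * (norm \<zeta>)\<^sup>2" for \<zeta>
    proof (cases "norm (sqrt t *\<^sub>R \<zeta>, 0 :: real) < r")
      case True
      then show ?thesis using r(2)[OF True, of \<xi>] b t by (simp add: add_increasing2)
    next
      case False
      then have "r\<^sup>2 \<le> (sqrt t * norm \<zeta>)\<^sup>2" using r(1) t by (intro power_mono) (auto simp: norm_Pair)
      then have "1 \<le> t * (norm \<zeta>)\<^sup>2 / r\<^sup>2" using r(1) t by (simp add: power_mult_distrib)
      then have "2 * norm f * 1 \<le> 2 * norm f * (t * (norm \<zeta>)\<^sup>2 / r\<^sup>2)" by (intro mult_left_mono) auto
      moreover have "norm (f (heis_mult \<xi> (sqrt t *\<^sub>R \<zeta>, 0)) - f \<xi>) \<le> norm f + norm f"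
        by (intro order_trans[OF norm_triangle_ineq4] add_mono norm_bounded)
      ultimately show ?thesis using e by (simp add: b_def)
    qed
    have int: "integrable gauss (\<lambda>\<zeta>. f (heis_mult \<xi> (sqrt t *\<^sub>R \<zeta>, 0)))"
      by (intro bcontfun_integrable prob_space_gauss heis_mult_measurable borel_measurable_const gauss_step_measurable)
    have "(gauss_step t f - f) \<xi> = (\<integral>\<zeta>. f (heis_mult \<xi> (sqrt t *\<^sub>R \<zeta>, 0)) - f \<xi> \<partial>gauss)"
      using int unfolding gauss_step_def
      by (simp add: apply_right_average[OF prob_space_gauss gauss_step_measurable] G.prob_space)
    also have "norm \<dots> \<le> (\<integral>\<zeta>. e / 2 + b * t * (norm \<zeta>)\<^sup>2 \<partial>(gauss :: 'd phase measure))"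
    proof (rule order_trans[OF integral_norm_bound Bochner_Integration.integral_mono])
      show "integrable gauss (\<lambda>\<zeta>. norm (f (heis_mult \<xi> (sqrt t *\<^sub>R \<zeta>, 0)) - f \<xi>))"
        using int by (intro Bochner_Integration.integrable_norm Bochner_Integration.integrable_diff) auto
      show "integrable (gauss :: 'd phase measure) (\<lambda>\<zeta>. e / 2 + b * t * (norm \<zeta>)\<^sup>2)"
        using gauss_second_moment by simp
    qed (rule pointwise)
    also have "\<dots> = e / 2 + b * t * m"
      using gauss_second_moment by (simp add: m_def G.prob_space)
    also have "b * t * m = (b * m) * t" by simp
    also have "\<dots> \<le> (b * m) * d" using t b m by (intro mult_left_mono) auto
    also have "\<dots> \<le> B * d" using d by (intro mult_right_mono) (auto simp: B_def)
    also have "\<dots> = e / 2" using pos by (simp add: d_def)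
    finally show "norm ((gauss_step t f - f) \<xi>) \<le> e" by simp
  qed
  then show ?thesis using d by blast
qed

text \<open>For small \<open>t\<close> a single step already approximates \<open>V t\<close>.\<close>

lemma V_tendsto:
  fixes f :: "'d heis \<Rightarrow>\<^sub>C 'v::euclidean_space"
  assumes f: "f \<in> C0"
  shows "((\<lambda>t. V t f) \<longlongrightarrow> f) (at_right 0)"
proof (rule tendstoI)
  fix e :: real assume e: "e > 0"
  obtain d1 where d1: "d1 > 0" "\<And>t. 0 \<le> t \<Longrightarrow> t < d1 \<Longrightarrow> norm (gauss_step t f - f) \<le> e / 3"
    using gauss_step_tendsto[OF f, of "e / 3"] e by auto
  obtain d2 where d2: "d2 > 0" "\<And>h m. 0 \<le> h \<Longrightarrow> h < d2 \<Longrightarrow> real m * h \<le> 1 \<Longrightarrow> norm ((gauss_step h ^^ m) f - V (real m * h) f) \<le> e / 3"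
    using approximatesE[OF steps_approximate_V[OF f, of 1], of "e / 3"] e by auto
  have "\<forall>\<^sub>F t in at_right 0. t \<in> {0<..<min (min d1 d2) 1}"
    using d1(1) d2(1) by (intro eventually_at_right_real) simp
  then show "\<forall>\<^sub>F t in at_right 0. dist (V t f) f < e"
  proof eventually_elim
    case (elim t)
    have "norm (V t f - gauss_step t f) \<le> e / 3" using d2(2)[of t 1] elim by (simp add: norm_minus_commute)
    moreover have "norm (gauss_step t f - f) \<le> e / 3" using d1(2)[of t] elim by simp
    ultimately have "norm (V t f - f) \<le> e / 3 + e / 3" by (rule norm_diff_triangle_le)
    then show ?case using e by (simp add: dist_norm)
  qed
qed

lemma V_scs: "strongly_continuous_semigroup C0 (V :: real \<Rightarrow> ('d heis \<Rightarrow>\<^sub>C 'v::euclidean_space) \<Rightarrow> _)"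
  unfolding strongly_continuous_semigroup_def
proof (intro conjI allI impI ballI)
  fix t :: real and f g :: "'d heis \<Rightarrow>\<^sub>C 'v" and a b assume "t \<ge> 0"
  then show "V t (a *\<^sub>R f + b *\<^sub>R g) = a *\<^sub>R V t f + b *\<^sub>R V t g"
    by (simp add: linear_add linear_scale bounded_linear.linear[OF V_lin(1)])
next
  fix t :: real assume "t \<ge> 0"
  then show "\<exists>K. \<forall>f\<in>(C0 :: ('d heis \<Rightarrow>\<^sub>C 'v) set). norm (V t f) \<le> K * norm f"
    by (intro exI[of _ 1]) (auto intro: V_lin(2))
qed (auto intro: V_C0 V_0 V_add V_tendsto)

end

section \<open>The Feynman-Kac product formula\<close>

lemma horizontal_brownian_motion_imp_locale:
  assumes "horizontal_brownian_motion M B1 B2 A"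
  shows "horizontal_bm M B1 B2 A"
proof -
  interpret prob_space M
    using assms by (simp add: horizontal_brownian_motion_def standard_brownian_motion_def)
  interpret two_brownian_motions M B1 B2
    by unfold_locales (use assms in \<open>auto simp: horizontal_brownian_motion_def\<close>)
  have F: "F = natural_filtration M (\<lambda>r \<omega>. (B1 r \<omega>, B2 r \<omega>))"
    by (simp add: F_def Z_def[abs_def])
  show ?thesis
    by unfold_locales (use assms in \<open>auto simp: horizontal_brownian_motion_def Let_def F\<close>)
qed

lemma S_fun_eq:
  fixes \<psi> :: "'d::finite heis \<Rightarrow>\<^sub>C 'v::euclidean_space"
  assumes "prob_space (gauss :: 'd phase measure)"
  shows "S_fun c \<tau> \<psi> = apply_bcontfun (gauss_step \<tau> \<psi> + \<tau> *\<^sub>R multop c \<psi>)"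
  unfolding gauss_step_def S_fun_def
  by (auto simp: fun_eq_iff apply_right_average[OF assms gauss_step_measurable] apply_multop
      heis_mult_def symp_scaleR_right)

lemma S_op_eq:
  fixes \<psi> :: "'d::finite heis \<Rightarrow>\<^sub>C 'v::euclidean_space"
  assumes "prob_space (gauss :: 'd phase measure)"
  shows "S_op c \<tau> \<psi> = gauss_step \<tau> \<psi> + \<tau> *\<^sub>R multop c \<psi>"
  unfolding S_op_def S_fun_eq[OF assms] by (rule apply_bcontfun_inverse)

lemma L_c_eq:
  fixes c :: "'d::finite heis \<Rightarrow>\<^sub>C real"
  shows "(L_c M W c :: (('d heis \<Rightarrow>\<^sub>C 'v::euclidean_space) \<times> _) set) = {(f, h). \<exists>g. (f, g) \<in> generator C0 (hbm_semigroup M W) \<and> h = g + multop c f}"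
proof -
  have "(\<forall>\<xi>. apply_bcontfun h \<xi> = (1 / 2) *\<^sub>R apply_bcontfun (2 *\<^sub>R g) \<xi> + c \<xi> *\<^sub>R f \<xi>) \<longleftrightarrow> h = g + multop c f" for f g h :: "'d heis \<Rightarrow>\<^sub>C 'v"
    by (auto simp: apply_multop intro!: bcontfun_eqI)
  then show ?thesis unfolding L_c_def L_op_def by fastforce
qed

theorem theorem4:
  fixes M :: "'w measure"
    and B1 B2 :: "real \<Rightarrow> 'w \<Rightarrow> real^'d::finite"
    and A :: "real \<Rightarrow> 'w \<Rightarrow> real"
    and W :: "real \<Rightarrow> 'w \<Rightarrow> 'd heis"
    and c :: "'d heis \<Rightarrow>\<^sub>C real"
  assumes "horizontal_brownian_motion M B1 B2 A"
    and "\<And>t \<omega>. W t \<omega> = ((B1 t \<omega>, B2 t \<omega>), A t \<omega>)"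
  shows "(\<forall>\<tau>\<ge>0. \<forall>\<psi> \<in> (C0 :: ('d heis \<Rightarrow>\<^sub>C 'v::{real_normed_field, euclidean_space}) set).
            S_fun c \<tau> \<psi> \<in> apply_bcontfun ` C0) \<and>
         (\<forall>\<psi> \<in> (C0 :: ('d heis \<Rightarrow>\<^sub>C 'v) set). \<forall>\<tau>\<^sub>0 > 0.
            (\<lambda>n. SUP \<tau>\<in>{0..\<tau>\<^sub>0}.
                   ereal (norm ((S_op c (\<tau> / real n) ^^ n) \<psi> - semigroup_of C0 (L_c M W c) \<tau> \<psi>)))
              \<longlonglongrightarrow> 0)"
proof -
  interpret horizontal_bm M B1 B2 A
    by (rule horizontal_brownian_motion_imp_locale[OF assms(1)])
  have hbm_V: "hbm_semigroup M W = (V :: real \<Rightarrow> ('d heis \<Rightarrow>\<^sub>C 'v) \<Rightarrow> _)"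
    by (simp add: fun_eq_iff hbm_semigroup_def V_def right_average_def assms(2) Z_def)
  interpret P: bounded_perturbation "C0 :: ('d heis \<Rightarrow>\<^sub>C 'v) set" V "multop c" "norm c"
    by (rule bounded_perturbation.intro)
       (auto intro: closed_C0 subspace_C0 V_lin V_scs multop_bounded_linear multop_C0 norm_multop)
  have S: "S_op c h = (\<lambda>\<psi> :: 'd heis \<Rightarrow>\<^sub>C 'v. gauss_step h \<psi> + h *\<^sub>R multop c \<psi>)" for h
    by (simp add: fun_eq_iff S_op_eq[OF prob_space_gauss])
  have semigroup: "semigroup_of C0 (L_c M W c) \<tau> \<psi> = P.T \<tau> \<psi>" if "\<psi> \<in> C0" "\<tau> \<ge> 0" for \<tau> \<psi>
    using that by (intro P.semigroup_of_eq) (simp_all add: L_c_eq hbm_V)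
  show ?thesis
  proof (intro conjI ballI allI impI)
    fix \<tau> :: real and \<psi> :: "'d heis \<Rightarrow>\<^sub>C 'v" assume "\<psi> \<in> C0"
    then have "gauss_step \<tau> \<psi> + \<tau> *\<^sub>R multop c \<psi> \<in> C0"
      by (intro P.X_add P.X_scale step_C0 multop_C0)
    then show "S_fun c \<tau> \<psi> \<in> apply_bcontfun ` C0"
      unfolding S_fun_eq[OF prob_space_gauss] by blast
  next
    fix \<psi> :: "'d heis \<Rightarrow>\<^sub>C 'v" and \<tau>\<^sub>0 :: real assume \<psi>: "\<psi> \<in> C0" and \<tau>\<^sub>0: "\<tau>\<^sub>0 > 0"
    define D where "D n \<tau> = ereal (norm ((S_op c (\<tau> / real n) ^^ n) \<psi> - semigroup_of C0 (L_c M W c) \<tau> \<psi>))" for n \<tau>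
    have small: "\<forall>\<^sub>F n in sequentially. \<forall>\<tau>\<in>{0..\<tau>\<^sub>0}. D n \<tau> \<le> ereal e" if e: "e > 0" for e
    proof -
      have "approximates \<tau>\<^sub>0 (\<lambda>h g. gauss_step h g + h *\<^sub>R multop c g) P.T \<psi>"
        by (rule P.product_formula[OF step_lin steps_approximate_V \<psi>]) (use \<tau>\<^sub>0 in auto)
      then obtain d where d: "d > 0" "\<And>h m. 0 \<le> h \<Longrightarrow> h < d \<Longrightarrow> real m * h \<le> \<tau>\<^sub>0 \<Longrightarrow>
          norm (((\<lambda>g. gauss_step h g + h *\<^sub>R multop c g) ^^ m) \<psi> - P.T (real m * h) \<psi>) \<le> e"
        using e by (rule approximatesE) blast
      obtain n0 where n0: "\<tau>\<^sub>0 / d < real n0" using reals_Archimedean2 by blast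
      show ?thesis
        unfolding eventually_sequentially
      proof (intro exI allI impI ballI)
        fix n \<tau> assume n: "n0 \<le> n" and \<tau>: "\<tau> \<in> {0..\<tau>\<^sub>0}"
        have "0 < \<tau>\<^sub>0 / d" using \<tau>\<^sub>0 d(1) by simp
        moreover have n': "\<tau>\<^sub>0 / d < real n" using n0 n by linarith
        ultimately have pos: "real n > 0" by linarith
        have "\<tau> / real n \<le> \<tau>\<^sub>0 / real n" using \<tau> pos by (intro divide_right_mono) auto
        also have "\<dots> < d" using n' d(1) pos by (simp add: pos_divide_less_eq mult.commute)
        finally have "\<tau> / real n < d" .
        then have "norm ((S_op c (\<tau> / real n) ^^ n) \<psi> - P.T (real n * (\<tau> / real n)) \<psi>) \<le> e"
          unfolding S using \<tau> pos by (intro d(2)) auto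
        then show "D n \<tau> \<le> ereal e"
          using semigroup[OF \<psi>, of \<tau>] \<tau> pos by (simp add: D_def)
      qed
    qed
    have "(\<lambda>n. SUP \<tau>\<in>{0..\<tau>\<^sub>0}. D n \<tau>) \<longlonglongrightarrow> 0"
    proof (rule order_tendstoI)
      fix a :: ereal assume "a < 0"
      also have "0 \<le> D n 0" for n by (simp add: D_def)
      also have "D n 0 \<le> (SUP \<tau>\<in>{0..\<tau>\<^sub>0}. D n \<tau>)" for n using \<tau>\<^sub>0 by (intro SUP_upper) auto
      finally show "\<forall>\<^sub>F n in sequentially. a < (SUP \<tau>\<in>{0..\<tau>\<^sub>0}. D n \<tau>)" by simp
    next
      fix a :: ereal assume "0 < a"
      then obtain e where e: "0 < ereal e" "ereal e < a" using ereal_dense2 by blast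
      then have "e > 0" by simp
      show "\<forall>\<^sub>F n in sequentially. (SUP \<tau>\<in>{0..\<tau>\<^sub>0}. D n \<tau>) < a"
        using small[OF \<open>e > 0\<close>]
      proof eventually_elim
        case (elim n)
        then have "(SUP \<tau>\<in>{0..\<tau>\<^sub>0}. D n \<tau>) \<le> ereal e" by (intro SUP_least) auto
        then show ?case using e(2) by (rule le_less_trans)
      qed
    qed
    then show "(\<lambda>n. SUP \<tau>\<in>{0..\<tau>\<^sub>0}.
        ereal (norm ((S_op c (\<tau> / real n) ^^ n) \<psi> - semigroup_of C0 (L_c M W c) \<tau> \<psi>))) \<longlonglongrightarrow> 0"
      by (simp add: D_def)
  qed
qed

end
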